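(* Let $h:L\to M$ and $g:N\to M$ be morphisms of DGLAs over $\mathbb{C}$. There exists an $L_\infty$-algebra structure $(C^\cdot_{(h,g)},\langle\ \rangle_1,\langle\ \rangle_2,\ldots)$ on the complex $C^\cdot_{(h,g)}$ that extends its differential structure and makes $(H_{(h,g)},q_1,q_2,0,\ldots)$ and $(C^\cdot_{(h,g)},\langle\ \rangle_1,\langle\ \rangle_2,\ldots)$ quasi-isomorphic $L_\infty$-algebras, via an $L_\infty$-quasi-isomorphism $\imath_\infty$ (from $C^\cdot_{(h,g)}$ to $H_{(h,g)}$) extending $\imath$, i.e. with linear part $\imath$.
   Context: DGLA means differential graded Lie algebra (differential of degree $+1$) over $\mathbb{C}$. $V[1]^i=V^{i+1}$. **$L_\infty$-algebras.** An $L_\infty$ structure on a graded vector space $V$ is a system of degree-one linear maps $q_k:\bigodot^k(V[1])\to V[1]$, $k\ge1$, such that the induced coderivation $Q$ of the graded coalgebra $\bigoplus_{n\ge1}\bigodot^nV[1]$, $Q(v_1\odot\cdots\odot v_n)=\sum_{k=1}^n\sum_{\sigma\in S(k,n-k)}\varepsilon(\sigma)q_k(v_{\sigma(1)}\odot\cdots\odot v_{\sigma(k)})\odot v_{\sigma(k+1)}\odot\cdots\odot v_{\sigma(n)}$ ($S(k,n-k)$ the unshuffles, $\varepsilon(\sigma)$ the Koszul sign), satisfies $Q\circ Q=0$. An $L_\infty$-morphism $f_\infty:V\to W$ is a sequence of degree-zero linear maps $f_n:\bigodot^nV[1]\to W[1]$, $n\ge1$, whose induced coalgebra morphism commutes with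 the codifferentials; its linear part is $f_1$, and it is a quasi-isomorphism if $f_1$ is a quasi-isomorphism of complexes. **The cone.** $C^i_{(h,g)}=L^i\oplus N^i\oplus M^{i-1}$ with differential $D(l,n,m)=(dl,dn,-dm-g(n)+h(l))$. The suspended differential is $\langle(l,n,m)\rangle_1=(-dl,-dn,dm+g(n)-h(l))$; "extends its differential structure" means that the first multiplication is this $\langle\ \rangle_1$. **The DGLA $H_{(h,g)}$.** $M[t,dt]=M\otimes\mathbb{C}[t,dt]$, where $\mathbb{C}[t,dt]$ is the differential graded algebra of polynomial differential forms on the affine line, with evaluations $e_a:M[t,dt]\to M$, $e_a(\sum m_it^i+n_it^idt)=\sum m_ia^i$. $$H_{(h,g)}=\{(l,n,m(t,dt))\in L\times N\times M[t,dt]\mid h(l)=e_1(m(t,dt)),\ g(n)=e_0(m(t,dt))\}$$ is a DGLA with componentwise structure, regarded as an $L_\infty$-algebra via $q_1(x)=-dx$, $q_2(x\odot y)=(-1)^{\deg x}[x,y]$ ($\deg x$ the unshifted degree in $H_{(h,g)}$), $q_k=0$ for $k\ge3$. **The map $\imath$.** $\imath:C^\cdot_{(h,g)}[1]\to H_{(h,g)}[1]$, $\imath(l,n,m)=(l,n,(1-t)g(n)+th(l)+dt\,m)$. *)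

theory Defs
  imports
    Complex_Main
    "HOL-Library.Poly_Mapping"
    "HOL-Library.Product_Plus"
    "HOL-Computational_Algebra.Polynomial"
    "HOL-Combinatorics.Permutations"
begin

section \<open>Graded complex vector spaces and complexes\<close>

text \<open>
  A graded vector space is a family of complex vector spaces indexed by the integers. Its
  members \<open>homog V i\<close> are subspaces of one ambient type; they need not be independent
  there, since the degree of an element is always carried along explicitly. Accordingly
  every map of graded spaces takes the degrees of its arguments as extra arguments.
\<close>

record 'a graded_space =
  smul :: "complex \<Rightarrow> 'a \<Rightarrow> 'a"
  homog :: "int \<Rightarrow> 'a set"

definition graded_vector_space :: "('a::ab_group_add, 'r) graded_space_scheme \<Rightarrow> bool" where
  "graded_vector_space V \<longleftrightarrow>
     vector_space (smul V) \<and> (\<forall>i. module.subspace (smul V) (homog V i))"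

definition shift :: "('a, 'r) graded_space_scheme \<Rightarrow> 'a graded_space" where
  "shift V = \<lparr>smul = smul V, homog = (\<lambda>i. homog V (i + 1))\<rparr>"

definition graded_linear ::
    "('a::ab_group_add, 'r) graded_space_scheme \<Rightarrow> ('b::ab_group_add, 's) graded_space_scheme
      \<Rightarrow> int \<Rightarrow> (int \<Rightarrow> 'a \<Rightarrow> 'b) \<Rightarrow> bool" where
  "graded_linear V W e f \<longleftrightarrow>
     (\<forall>i. \<forall>x\<in>homog V i. f i x \<in> homog W (i + e) \<and>
        (\<forall>y\<in>homog V i. f i (x + y) = f i x + f i y) \<and>
        (\<forall>c. f i (smul V c x) = smul W c (f i x)))"

definition cocycles ::
    "('a::ab_group_add, 'r) graded_space_scheme \<Rightarrow> (int \<Rightarrow> 'a \<Rightarrow> 'a) \<Rightarrow> int \<Rightarrow> 'a set" where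
  "cocycles V d i = {x \<in> homog V i. d i x = 0}"

definition cohomologous ::
    "('a::ab_group_add, 'r) graded_space_scheme \<Rightarrow> (int \<Rightarrow> 'a \<Rightarrow> 'a) \<Rightarrow> int \<Rightarrow> 'a rel" where
  "cohomologous V d i =
     {(x, y). x \<in> cocycles V d i \<and> y \<in> cocycles V d i \<and> x - y \<in> d (i - 1) ` homog V (i - 1)}"

definition cohomology ::
    "('a::ab_group_add, 'r) graded_space_scheme \<Rightarrow> (int \<Rightarrow> 'a \<Rightarrow> 'a) \<Rightarrow> int \<Rightarrow> 'a set set" where
  "cohomology V d i = cocycles V d i // cohomologous V d i"

text \<open>The induced map sends the class of a cocycle \<open>x\<close> to the class of \<open>f i x\<close>.\<close>

definition quasi_isomorphism ::
    "('a::ab_group_add, 'r) graded_space_scheme \<Rightarrow> (int \<Rightarrow> 'a \<Rightarrow> 'a)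
      \<Rightarrow> ('b::ab_group_add, 's) graded_space_scheme \<Rightarrow> (int \<Rightarrow> 'b \<Rightarrow> 'b)
      \<Rightarrow> (int \<Rightarrow> 'a \<Rightarrow> 'b) \<Rightarrow> bool" where
  "quasi_isomorphism V d W d' f \<longleftrightarrow>
     graded_linear V W 0 f \<and>
     (\<forall>i. \<forall>x\<in>homog V i. f (i + 1) (d i x) = d' i (f i x)) \<and>
     (\<forall>i. bij_betw (\<lambda>X. cohomologous W d' i `` (f i ` X)) (cohomology V d i) (cohomology W d' i))"


section \<open>Differential graded Lie algebras\<close>

record 'a dgla = "'a graded_space" +
  diff :: "int \<Rightarrow> 'a \<Rightarrow> 'a"
  bracket :: "int \<Rightarrow> int \<Rightarrow> 'a \<Rightarrow> 'a \<Rightarrow> 'a"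

definition is_dgla :: "('a::ab_group_add, 'r) dgla_scheme \<Rightarrow> bool" where
  "is_dgla L \<longleftrightarrow>
     graded_vector_space L \<and>
     graded_linear L L 1 (diff L) \<and>
     (\<forall>i. \<forall>x\<in>homog L i. diff L (i + 1) (diff L i x) = 0) \<and>
     (\<forall>i. \<forall>x\<in>homog L i. graded_linear L L i (\<lambda>j. bracket L i j x)) \<and>
     (\<forall>j. \<forall>y\<in>homog L j. graded_linear L L j (\<lambda>i x. bracket L i j x y)) \<and>
     (\<forall>i j. \<forall>x\<in>homog L i. \<forall>y\<in>homog L j.
        bracket L i j x y = - smul L ((-1) powi (i * j)) (bracket L j i y x)) \<and>
     (\<forall>i j k. \<forall>x\<in>homog L i. \<forall>y\<in>homog L j. \<forall>z\<in>homog L k.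
        bracket L i (j + k) x (bracket L j k y z) =
          bracket L (i + j) k (bracket L i j x y) z +
          smul L ((-1) powi (i * j)) (bracket L j (i + k) y (bracket L i k x z))) \<and>
     (\<forall>i j. \<forall>x\<in>homog L i. \<forall>y\<in>homog L j.
        diff L (i + j) (bracket L i j x y) =
          bracket L (i + 1) j (diff L i x) y +
          smul L ((-1) powi i) (bracket L i (j + 1) x (diff L j y)))"

definition dgla_morphism ::
    "('a::ab_group_add, 'r) dgla_scheme \<Rightarrow> ('b::ab_group_add, 's) dgla_scheme
      \<Rightarrow> (int \<Rightarrow> 'a \<Rightarrow> 'b) \<Rightarrow> bool" where
  "dgla_morphism L M h \<longleftrightarrow>
     graded_linear L M 0 h \<and>
     (\<forall>i. \<forall>x\<in>homog L i. h (i + 1) (diff L i x) = diff M i (h i x)) \<and>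
     (\<forall>i j. \<forall>x\<in>homog L i. \<forall>y\<in>homog L j.
        h (i + j) (bracket L i j x y) = bracket M i j (h i x) (h j y))"


section \<open>The reduced symmetric coalgebra\<close>

text \<open>
  The direct sum of the symmetric powers of \<open>U\<close> over all \<open>n \<ge> 1\<close> is presented as the free
  complex vector space on nonempty words of homogeneous elements (each paired with its
  degree), modulo the subspace \<open>sym_relations U\<close> expressing multilinearity and graded
  commutativity. Two elements of the free space are equal in the coalgebra iff their
  difference lies in that subspace. The word \<open>[(i\<^sub>1, v\<^sub>1), \<dots>, (i\<^sub>n, v\<^sub>n)]\<close> stands for the
  symmetric product of \<open>v\<^sub>1, \<dots>, v\<^sub>n\<close>.
\<close>

type_synonym 'a gword = "(int \<times> 'a) list"
type_synonym 'a free_sym = "'a gword \<Rightarrow>\<^sub>0 complex"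

definition free_scale :: "complex \<Rightarrow> ('w \<Rightarrow>\<^sub>0 complex) \<Rightarrow> ('w \<Rightarrow>\<^sub>0 complex)" where
  "free_scale c z = Poly_Mapping.map ((*) c) z"

lemma lookup_free_scale: "Poly_Mapping.lookup (free_scale c z) w = c * Poly_Mapping.lookup z w"
  by (simp add: free_scale_def Poly_Mapping.map.rep_eq when_def)

lemma vector_space_free_scale:
  "vector_space (free_scale :: complex \<Rightarrow> ('w \<Rightarrow>\<^sub>0 complex) \<Rightarrow> _)"
  by unfold_locales
    (auto intro!: poly_mapping_eqI simp: lookup_free_scale lookup_add algebra_simps)

definition linear_extension ::
    "('w \<Rightarrow> ('v \<Rightarrow>\<^sub>0 complex)) \<Rightarrow> ('w \<Rightarrow>\<^sub>0 complex) \<Rightarrow> ('v \<Rightarrow>\<^sub>0 complex)" where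
  "linear_extension \<phi> z =
     (\<Sum>w\<in>Poly_Mapping.keys z. free_scale (Poly_Mapping.lookup z w) (\<phi> w))"

definition words :: "('a, 'r) graded_space_scheme \<Rightarrow> 'a gword set" where
  "words U = {w. w \<noteq> [] \<and> (\<forall>(i, x)\<in>set w. x \<in> homog U i)}"

definition word_degree :: "'a gword \<Rightarrow> int" where
  "word_degree w = sum_list (map fst w)"

definition sym_relations :: "('a::ab_group_add, 'r) graded_space_scheme \<Rightarrow> 'a free_sym set" where
  "sym_relations U = module.span free_scale
     ({Poly_Mapping.single (u @ (i, x + y) # v) 1 - Poly_Mapping.single (u @ (i, x) # v) 1
         - Poly_Mapping.single (u @ (i, y) # v) 1
       | u v i x y. u @ (i, x) # v \<in> words U \<and> y \<in> homog U i}
    \<union> {Poly_Mapping.single (u @ (i, smul U c x) # v) 1 - Poly_Mapping.single (u @ (i, x) # v) c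
       | u v i x c. u @ (i, x) # v \<in> words U}
    \<union> {Poly_Mapping.single (u @ (i, x) # (j, y) # v) 1
         - Poly_Mapping.single (u @ (j, y) # (i, x) # v) ((-1) powi (i * j))
       | u v i x j y. u @ (i, x) # (j, y) # v \<in> words U})"

text \<open>
  A family of linear maps of degree \<open>e\<close> from the symmetric powers of \<open>U\<close> to \<open>W\<close> is a
  graded symmetric multilinear function on words; its \<open>k\<close>-th member is the restriction to
  words of length \<open>k\<close>.
\<close>

definition sym_multilinear ::
    "('a::ab_group_add, 'r) graded_space_scheme \<Rightarrow> ('b::ab_group_add, 's) graded_space_scheme
      \<Rightarrow> int \<Rightarrow> ('a gword \<Rightarrow> 'b) \<Rightarrow> bool" where
  "sym_multilinear U W e f \<longleftrightarrow>
     (\<forall>w\<in>words U. f w \<in> homog W (word_degree w + e)) \<and>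
     (\<forall>u v i x y. u @ (i, x) # v \<in> words U \<and> y \<in> homog U i \<longrightarrow>
        f (u @ (i, x + y) # v) = f (u @ (i, x) # v) + f (u @ (i, y) # v)) \<and>
     (\<forall>u v i x c. u @ (i, x) # v \<in> words U \<longrightarrow>
        f (u @ (i, smul U c x) # v) = smul W c (f (u @ (i, x) # v))) \<and>
     (\<forall>u v i x j y. u @ (i, x) # (j, y) # v \<in> words U \<longrightarrow>
        f (u @ (i, x) # (j, y) # v) =
          smul W ((-1) powi (i * j)) (f (u @ (j, y) # (i, x) # v)))"

text \<open>
  Unshuffles of type \<open>(n\<^sub>1, \<dots>, n\<^sub>s)\<close>: permutations (of positions counted from 0) that are
  increasing on each of the consecutive blocks of lengths \<open>n\<^sub>1, \<dots>, n\<^sub>s\<close>.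
\<close>

definition unshuffles :: "nat list \<Rightarrow> (nat \<Rightarrow> nat) set" where
  "unshuffles ns = {\<sigma>. \<sigma> permutes {..<sum_list ns} \<and>
     (\<forall>b<length ns. strict_mono_on {sum_list (take b ns)..<sum_list (take (Suc b) ns)} \<sigma>)}"

lemma finite_unshuffles: "finite (unshuffles ns)"
  by (rule finite_subset[OF _ finite_permutations[of "{..<sum_list ns}"]])
    (auto simp: unshuffles_def)

definition koszul_sign :: "(nat \<Rightarrow> nat) \<Rightarrow> 'a gword \<Rightarrow> complex" where
  "koszul_sign \<sigma> w =
     (\<Prod>(a, b) \<in> {(a, b). a < b \<and> b < length w \<and> \<sigma> a > \<sigma> b}.
        (-1) powi (fst (w ! \<sigma> a) * fst (w ! \<sigma> b)))"

definition coderivation :: "('a gword \<Rightarrow> 'a) \<Rightarrow> 'a gword \<Rightarrow> 'a free_sym" where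
  "coderivation q w =
     (\<Sum>k = 1..length w. \<Sum>\<sigma>\<in>unshuffles [k, length w - k].
        let v = permute_list \<sigma> w
        in Poly_Mapping.single ((word_degree (take k v) + 1, q (take k v)) # drop k v)
             (koszul_sign \<sigma> w))"

definition compositions :: "nat \<Rightarrow> nat list set" where
  "compositions n = {ns. sum_list ns = n \<and> 0 \<notin> set ns}"

lemma finite_compositions: "finite (compositions n)"
proof (rule finite_subset[OF _ finite_lists_length_le[of "{..n}" n]])
  have "length ns \<le> sum_list ns" if "0 \<notin> set ns" for ns :: "nat list"
    using that by (induction ns) auto
  then show "compositions n \<subseteq> {xs. set xs \<subseteq> {..n} \<and> length xs \<le> n}"
    by (auto simp: compositions_def member_le_sum_list)
qed simp

fun split_blocks :: "nat list \<Rightarrow> 'b list \<Rightarrow> 'b list list" where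
  "split_blocks [] w = []"
| "split_blocks (n # ns) w = take n w # split_blocks ns (drop n w)"

text \<open>
  The morphism of coalgebras with corestriction \<open>f\<close> is the sum over all ways to distribute
  the factors of a word over \<open>s\<close> nonempty blocks; blocks are ordered here, so each
  unordered distribution occurs \<open>s!\<close> times.
\<close>

definition coalgebra_morphism :: "('a gword \<Rightarrow> 'b) \<Rightarrow> 'a gword \<Rightarrow> 'b free_sym" where
  "coalgebra_morphism f w =
     (\<Sum>ns\<in>compositions (length w). \<Sum>\<sigma>\<in>unshuffles ns.
        Poly_Mapping.single
          (map (\<lambda>v. (word_degree v, f v)) (split_blocks ns (permute_list \<sigma> w)))
          (koszul_sign \<sigma> w / fact (length ns)))"


section \<open>\<open>L\<^sub>\<infinity>\<close>-algebras\<close>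

definition Linf_algebra ::
    "('a::ab_group_add, 'r) graded_space_scheme \<Rightarrow> ('a gword \<Rightarrow> 'a) \<Rightarrow> bool" where
  "Linf_algebra V q \<longleftrightarrow>
     graded_vector_space V \<and>
     sym_multilinear (shift V) (shift V) 1 q \<and>
     (\<forall>w\<in>words (shift V).
        linear_extension (coderivation q) (coderivation q w) \<in> sym_relations (shift V))"

definition Linf_morphism ::
    "('a::ab_group_add, 'r) graded_space_scheme \<Rightarrow> ('a gword \<Rightarrow> 'a)
      \<Rightarrow> ('b::ab_group_add, 's) graded_space_scheme \<Rightarrow> ('b gword \<Rightarrow> 'b)
      \<Rightarrow> ('a gword \<Rightarrow> 'b) \<Rightarrow> bool" where
  "Linf_morphism V q W q' f \<longleftrightarrow>
     Linf_algebra V q \<and> Linf_algebra W q' \<and>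
     sym_multilinear (shift V) (shift W) 0 f \<and>
     (\<forall>w\<in>words (shift V).
        linear_extension (coalgebra_morphism f) (coderivation q w)
          - linear_extension (coderivation q') (coalgebra_morphism f w)
        \<in> sym_relations (shift W))"

definition linear_part :: "('a gword \<Rightarrow> 'b) \<Rightarrow> int \<Rightarrow> 'a \<Rightarrow> 'b" where
  "linear_part f i x = f [(i, x)]"

definition Linf_quasi_isomorphism ::
    "('a::ab_group_add, 'r) graded_space_scheme \<Rightarrow> ('a gword \<Rightarrow> 'a)
      \<Rightarrow> ('b::ab_group_add, 's) graded_space_scheme \<Rightarrow> ('b gword \<Rightarrow> 'b)
      \<Rightarrow> ('a gword \<Rightarrow> 'b) \<Rightarrow> bool" where
  "Linf_quasi_isomorphism V q W q' f \<longleftrightarrow>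
     Linf_morphism V q W q' f \<and>
     quasi_isomorphism (shift V) (linear_part q) (shift W) (linear_part q') (linear_part f)"

text \<open>
  In a word over \<open>shift L\<close>, the letter \<open>(i, x)\<close> has \<open>x\<close> of degree \<open>i + 1\<close> in \<open>L\<close>.
\<close>

fun dgla_Linf :: "('a::ab_group_add, 'r) dgla_scheme \<Rightarrow> 'a gword \<Rightarrow> 'a" where
  "dgla_Linf L [(i, x)] = - diff L (i + 1) x"
| "dgla_Linf L [(i, x), (j, y)] = smul L ((-1) powi (i + 1)) (bracket L (i + 1) (j + 1) x y)"
| "dgla_Linf L _ = 0"


section \<open>Polynomial forms with values in a DGLA\<close>

text \<open>
  The pair \<open>(p, r)\<close> with coefficients \<open>p\<^sub>k\<close>, \<open>r\<^sub>k\<close> stands for the sum of the \<open>p\<^sub>k t\<^sup>k + r\<^sub>k t\<^sup>k dt\<close>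
  in the tensor product of \<open>M\<close> with the polynomial forms on the line; in degree \<open>i\<close> the \<open>p\<^sub>k\<close>
  have degree \<open>i\<close> and the \<open>r\<^sub>k\<close> degree \<open>i - 1\<close>. Signs follow the Koszul rule: for \<open>m\<close>, \<open>m'\<close>
  in \<open>M\<close> and forms \<open>a\<close>, \<open>b\<close> the differential of \<open>m a\<close> is \<open>(d m) a + (-1)^(deg m) m (d a)\<close>,
  and \<open>[m a, m' b] = (-1)^(deg a * deg m') [m, m'] (a b)\<close>.
\<close>

definition poly_bilinear ::
    "('a::zero \<Rightarrow> 'a \<Rightarrow> 'b::comm_monoid_add) \<Rightarrow> 'a poly \<Rightarrow> 'a poly \<Rightarrow> 'b poly" where
  "poly_bilinear b p p' =
     (\<Sum>k\<le>degree p. \<Sum>l\<le>degree p'. monom (b (coeff p k) (coeff p' l)) (k + l))"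

definition poly_derivative ::
    "('a::ab_group_add, 'r) graded_space_scheme \<Rightarrow> 'a poly \<Rightarrow> 'a poly" where
  "poly_derivative M p = (\<Sum>k\<le>degree p. monom (smul M (of_nat k) (coeff p k)) (k - 1))"

definition poly_forms :: "('a::ab_group_add, 'r) dgla_scheme \<Rightarrow> ('a poly \<times> 'a poly) dgla" where
  "poly_forms M = \<lparr>
     smul = (\<lambda>c (p, r). (map_poly (smul M c) p, map_poly (smul M c) r)),
     homog = (\<lambda>i. {(p, r). (\<forall>k. coeff p k \<in> homog M i) \<and> (\<forall>k. coeff r k \<in> homog M (i - 1))}),
     diff = (\<lambda>i (p, r).
       (map_poly (diff M i) p,
        map_poly (diff M (i - 1)) r + map_poly (smul M ((-1) powi i)) (poly_derivative M p))),
     bracket = (\<lambda>i j (p, r) (p', r').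
       (poly_bilinear (bracket M i j) p p',
        poly_bilinear (bracket M i (j - 1)) p r'
          + map_poly (smul M ((-1) powi j)) (poly_bilinear (bracket M (i - 1) j) r p')))\<rparr>"

definition form_eval ::
    "('a::ab_group_add, 'r) graded_space_scheme \<Rightarrow> complex \<Rightarrow> 'a poly \<times> 'a poly \<Rightarrow> 'a" where
  "form_eval M a = (\<lambda>(p, r). \<Sum>k\<le>degree p. smul M (a ^ k) (coeff p k))"


section \<open>The DGLA \<open>H\<close>, the cone, and the map between them\<close>

definition H_dgla ::
    "('l::ab_group_add) dgla \<Rightarrow> ('n::ab_group_add) dgla \<Rightarrow> ('m::ab_group_add) dgla
      \<Rightarrow> (int \<Rightarrow> 'l \<Rightarrow> 'm) \<Rightarrow> (int \<Rightarrow> 'n \<Rightarrow> 'm) \<Rightarrow> ('l \<times> 'n \<times> 'm poly \<times> 'm poly) dgla" where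
  "H_dgla L N M h g = \<lparr>
     smul = (\<lambda>c (l, n, \<omega>). (smul L c l, smul N c n, smul (poly_forms M) c \<omega>)),
     homog = (\<lambda>i. {(l, n, \<omega>). l \<in> homog L i \<and> n \<in> homog N i \<and> \<omega> \<in> homog (poly_forms M) i \<and>
                     h i l = form_eval M 1 \<omega> \<and> g i n = form_eval M 0 \<omega>}),
     diff = (\<lambda>i (l, n, \<omega>). (diff L i l, diff N i n, diff (poly_forms M) i \<omega>)),
     bracket = (\<lambda>i j (l, n, \<omega>) (l', n', \<omega>').
       (bracket L i j l l', bracket N i j n n', bracket (poly_forms M) i j \<omega> \<omega>'))\<rparr>"

definition mapping_cone ::
    "('l::ab_group_add) dgla \<Rightarrow> ('n::ab_group_add) dgla \<Rightarrow> ('m::ab_group_add) dgla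
      \<Rightarrow> ('l \<times> 'n \<times> 'm) graded_space" where
  "mapping_cone L N M = \<lparr>
     smul = (\<lambda>c (l, n, m). (smul L c l, smul N c n, smul M c m)),
     homog = (\<lambda>i. homog L i \<times> homog N i \<times> homog M (i - 1))\<rparr>"

definition cone_diff ::
    "('l::ab_group_add) dgla \<Rightarrow> ('n::ab_group_add) dgla \<Rightarrow> ('m::ab_group_add) dgla
      \<Rightarrow> (int \<Rightarrow> 'l \<Rightarrow> 'm) \<Rightarrow> (int \<Rightarrow> 'n \<Rightarrow> 'm) \<Rightarrow> int \<Rightarrow> 'l \<times> 'n \<times> 'm \<Rightarrow> 'l \<times> 'n \<times> 'm" where
  "cone_diff L N M h g i =
     (\<lambda>(l, n, m). (diff L i l, diff N i n, - diff M (i - 1) m - g i n + h i l))"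

text \<open>
  The two maps below live on the shifted cone, where \<open>(l, n, m)\<close> of degree \<open>i\<close> has \<open>l\<close>, \<open>n\<close>
  of degree \<open>i + 1\<close> and \<open>m\<close> of degree \<open>i\<close> in \<open>L\<close>, \<open>N\<close> and \<open>M\<close>.
\<close>

definition cone_suspended_diff ::
    "('l::ab_group_add) dgla \<Rightarrow> ('n::ab_group_add) dgla \<Rightarrow> ('m::ab_group_add) dgla
      \<Rightarrow> (int \<Rightarrow> 'l \<Rightarrow> 'm) \<Rightarrow> (int \<Rightarrow> 'n \<Rightarrow> 'm) \<Rightarrow> int \<Rightarrow> 'l \<times> 'n \<times> 'm \<Rightarrow> 'l \<times> 'n \<times> 'm" where
  "cone_suspended_diff L N M h g i =
     (\<lambda>(l, n, m). (- diff L (i + 1) l, - diff N (i + 1) n,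
                   diff M i m + g (i + 1) n - h (i + 1) l))"

lemma cone_suspended_diff_eq:
  "cone_suspended_diff L N M h g i x = - cone_diff L N M h g (i + 1) x"
  by (cases x) (simp add: cone_suspended_diff_def cone_diff_def)

text \<open>
  By the Koszul rule \<open>dt m = (-1)^(deg m) m dt\<close>; only with this sign is the map a morphism of
  complexes.
\<close>

definition cone_to_H ::
    "('m::ab_group_add) dgla \<Rightarrow> (int \<Rightarrow> 'l \<Rightarrow> 'm) \<Rightarrow> (int \<Rightarrow> 'n \<Rightarrow> 'm)
      \<Rightarrow> int \<Rightarrow> 'l \<times> 'n \<times> 'm \<Rightarrow> 'l \<times> 'n \<times> 'm poly \<times> 'm poly" where
  "cone_to_H M h g i =
     (\<lambda>(l, n, m).
       (l, n,
        monom (g (i + 1) n) 0 - monom (g (i + 1) n) 1 + monom (h (i + 1) l) 1,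
        monom (smul M ((-1) powi i) m) 0))"

end

theory Submission
  imports Defs
begin

text \<open>
  The structure on the cone is obtained by homotopy transfer. Integration of forms over \<open>[0, 1]\<close>
  gives a chain map \<open>\<pi>\<close> left inverse to \<open>\<imath>\<close> and a homotopy \<open>K\<close> with \<open>q\<^sub>1 K + K q\<^sub>1 = \<imath> \<pi> - id\<close>.
  Let \<open>f\<close> solve \<open>f = \<imath> + K B\<close>, where \<open>B\<close> is the composition of the higher operations \<open>q\<^sub>2 + q\<^sub>3 + \<dots>\<close>
  with the coalgebra morphism \<open>F\<close> induced by \<open>f\<close>, and let the transferred coderivation \<open>P\<close> have
  corestriction \<open>\<langle> \<rangle>\<^sub>1 + \<pi> B\<close>. If \<open>f P = q F\<close> holds on shorter words, then \<open>Q Q = 0\<close> gives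
  \<open>B P = - q\<^sub>1 B\<close>. Applying \<open>K\<close> yields \<open>f P = q F\<close>, and applying \<open>\<pi>\<close> yields \<open>P P = 0\<close>.

  An element of the free space on words lies in the subspace of relations iff every symmetric
  multilinear functional annihilates it. All identities between coalgebra maps are therefore
  proved for the values of such functionals, as identities between signed sums over unshuffles.
\<close>

section \<open>Signed sums over unshuffles\<close>

text \<open>The equation for \<open>f\<close> is not circular: the higher operations need at least
  two blocks, so \<open>B\<close> on a word sees \<open>f\<close> only on shorter words. For the
  same reason the identity on shorter words suffices to control \<open>B P\<close>, and an induction
  on the length closes. Equality in the coalgebra is equality modulo relations, and the coalgebra
  morphism is given with ordered blocks and factorials. Symmetric functionals remove both
  difficulties. Once blocks are listed by their first letters, a value of a coderivation, which
  stands first, heads the first block; this makes \<open>F P\<close> and \<open>Q F\<close> expand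
  in the same shape, with \<open>f P\<close> and \<open>q F\<close> as the only difference. The
  other obstacle is that all given maps are linear only on homogeneous parts of the ambient types.
  Moving a map through a sum over unshuffles therefore requires every summand to be homogeneous of
  the right degree, which is why the rules below keep track of lengths, degrees and letters. Signs
  are written \<open>sg k x\<close>, which makes sense in any abelian group.\<close>

definition sg :: "int \<Rightarrow> 'a::ab_group_add \<Rightarrow> 'a" where
  "sg k x = (if even k then x else - x)"

lemma sg_simps [simp]:
  "sg 0 x = x" "sg k 0 = 0" "sg k (sg l x) = sg (k + l) x" "sg k (- x) = - sg k x"
  "sg (k + k) x = x" "sg (2 * k) x = x"
  by (auto simp: sg_def)

lemma sg_Pair [simp]: "sg k (x, y) = (sg k x, sg k y)"
  by (simp add: sg_def)

lemma sg_add: "sg k (x + y) = sg k x + sg k y"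
  by (auto simp: sg_def)

lemma sg_diff: "sg k (x - y) = sg k x - sg k y"
  by (auto simp: sg_def)

lemma sg_parity: "even (k + l) \<Longrightarrow> sg k x = sg l x"
  by (auto simp: sg_def)

lemma word_degree_simps [simp]:
  "word_degree [] = 0" "word_degree (a # w) = fst a + word_degree w"
  "word_degree (u @ v) = word_degree u + word_degree v"
  by (auto simp: word_degree_def)

text \<open>The maps to be moved through sums are additive only on a homogeneous part
  \<open>S\<close> of the ambient type. Stated with differences, one clause yields negation, signs
  and sums.\<close>

definition additive_on :: "'b set \<Rightarrow> ('b::ab_group_add \<Rightarrow> 'c::ab_group_add) \<Rightarrow> bool" where
  "additive_on S H \<longleftrightarrow> 0 \<in> S \<and> (\<forall>x\<in>S. \<forall>y\<in>S. x - y \<in> S \<and> H (x - y) = H x - H y)"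

lemma additive_onD:
  assumes "additive_on S H"
  shows "0 \<in> S" "H 0 = 0" "x \<in> S \<Longrightarrow> - x \<in> S" "x \<in> S \<Longrightarrow> H (- x) = - H x"
    "x \<in> S \<Longrightarrow> y \<in> S \<Longrightarrow> x + y \<in> S" "x \<in> S \<Longrightarrow> y \<in> S \<Longrightarrow> H (x + y) = H x + H y"
    "x \<in> S \<Longrightarrow> sg k x \<in> S" "x \<in> S \<Longrightarrow> H (sg k x) = sg k (H x)"
proof -
  show 0: "0 \<in> S" and H0: "H 0 = 0"
    using assms by (auto simp: additive_on_def dest!: bspec[where x=0])
  have neg: "- x \<in> S" "H (- x) = - H x" if "x \<in> S" for x
    using assms 0 H0 that unfolding additive_on_def by (metis diff_0)+
  then show "x \<in> S \<Longrightarrow> - x \<in> S" "x \<in> S \<Longrightarrow> H (- x) = - H x"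
    "x \<in> S \<Longrightarrow> sg k x \<in> S" "x \<in> S \<Longrightarrow> H (sg k x) = sg k (H x)"
    by (auto simp: sg_def)
  show "x \<in> S \<Longrightarrow> y \<in> S \<Longrightarrow> x + y \<in> S" "x \<in> S \<Longrightarrow> y \<in> S \<Longrightarrow> H (x + y) = H x + H y"
    using assms neg unfolding additive_on_def by (metis diff_minus_eq_add)+
qed

text \<open>
  \<open>usum \<phi> w\<close> evaluates \<open>\<phi>\<close> on the (counital) coproduct of \<open>w\<close>. The arguments of \<open>\<phi>\<close> are kept in
  the order of \<open>w\<close>, so only moving a letter past the first argument costs a sign.
\<close>

primrec usum :: "('a gword \<Rightarrow> 'a gword \<Rightarrow> 'b::ab_group_add) \<Rightarrow> 'a gword \<Rightarrow> 'b" where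
  "usum \<phi> [] = \<phi> [] []"
| "usum \<phi> (a # w) =
     usum (\<lambda>u v. \<phi> (a # u) v) w + usum (\<lambda>u v. sg (fst a * word_degree u) (\<phi> u (a # v))) w"

text \<open>These three facts are all that later arguments use about the two blocks: lengths serve
  inductions, degrees serve signs, letters serve homogeneity.\<close>

lemma usum_cong':
  assumes "\<And>u v. length u + length v = length w \<Longrightarrow> word_degree u + word_degree v = word_degree w
    \<Longrightarrow> set u \<union> set v = set w \<Longrightarrow> \<phi> u v = \<psi> u v"
  shows "usum \<phi> w = usum \<psi> w"
  using assms
proof (induction w arbitrary: \<phi> \<psi>)
  case (Cons a w)
  have "usum (\<lambda>u v. \<phi> (a # u) v) w = usum (\<lambda>u v. \<psi> (a # u) v) w"
    by (rule Cons.IH, rule Cons.prems) auto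
  moreover have "usum (\<lambda>u v. sg (fst a * word_degree u) (\<phi> u (a # v))) w
      = usum (\<lambda>u v. sg (fst a * word_degree u) (\<psi> u (a # v))) w"
    by (rule Cons.IH, rule arg_cong[where f="sg _"], rule Cons.prems) auto
  ultimately show ?case by simp
qed simp

text \<open>As a congruence rule for recursive definitions it exposes the bound on the length of the
  second block, on which the termination of \<open>esum\<close> rests.\<close>

lemma usum_cong [fundef_cong]:
  assumes "w = w'" and "\<And>u v. length u + length v = length w' \<Longrightarrow> \<phi> u v = \<psi> u v"
  shows "usum \<phi> w = usum \<psi> w'"
  using assms by (auto intro: usum_cong')

lemma usum_zero [simp]: "usum (\<lambda>u v. 0) w = 0"
  by (induction w) auto

lemma usum_add: "usum (\<lambda>u v. \<phi> u v + \<psi> u v) w = usum \<phi> w + usum \<psi> w"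
  by (induction w arbitrary: \<phi> \<psi>) (auto simp: sg_add algebra_simps)

text \<open>Membership in \<open>S\<close> is proved along with the equation because additivity of
  \<open>H\<close> applies to partial sums only if they lie in \<open>S\<close>.\<close>

lemma usum_pull':
  assumes "additive_on S H"
    and "\<And>u v. length u + length v = length w \<Longrightarrow> word_degree u + word_degree v = word_degree w
    \<Longrightarrow> set u \<union> set v = set w \<Longrightarrow> \<phi> u v \<in> S"
  shows "usum \<phi> w \<in> S \<and> H (usum \<phi> w) = usum (\<lambda>u v. H (\<phi> u v)) w"
  using assms(2)
proof (induction w arbitrary: \<phi>)
  case (Cons a w)
  have mem: "\<phi> (a # u) v \<in> S" "\<phi> u (a # v) \<in> S"
    if "length u + length v = length w" "word_degree u + word_degree v = word_degree w"
      "set u \<union> set v = set w" for u v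
    using that by (auto intro!: Cons.prems)
  have 1: "usum (\<lambda>u v. \<phi> (a # u) v) w \<in> S \<and>
      H (usum (\<lambda>u v. \<phi> (a # u) v) w) = usum (\<lambda>u v. H (\<phi> (a # u) v)) w"
    by (rule Cons.IH) (rule mem)
  have 2: "usum (\<lambda>u v. sg (fst a * word_degree u) (\<phi> u (a # v))) w \<in> S \<and>
      H (usum (\<lambda>u v. sg (fst a * word_degree u) (\<phi> u (a # v))) w) =
      usum (\<lambda>u v. H (sg (fst a * word_degree u) (\<phi> u (a # v)))) w"
    by (rule Cons.IH) (intro additive_onD[OF assms(1)] mem)
  have 3: "usum (\<lambda>u v. H (sg (fst a * word_degree u) (\<phi> u (a # v)))) w =
      usum (\<lambda>u v. sg (fst a * word_degree u) (H (\<phi> u (a # v)))) w"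
    by (rule usum_cong') (intro additive_onD[OF assms(1)] mem)
  show ?case
    using 1 2 3 by (simp add: additive_onD[OF assms(1)])
qed simp

lemmas usum_pull = usum_pull'[THEN conjunct2]

lemma usum_pull_UNIV:
  assumes "\<And>x y. H (x + y) = H x + H y"
  shows "H (usum \<phi> w) = usum (\<lambda>u v. H (\<phi> u v)) w"
proof (rule usum_pull[of UNIV])
  show "additive_on UNIV H"
    using assms by (auto simp: additive_on_def) (metis add_diff_cancel diff_add_cancel)
qed simp

lemma usum_sg: "usum (\<lambda>u v. sg k (\<phi> u v)) w = sg k (usum \<phi> w)"
  by (rule usum_pull_UNIV[symmetric]) (rule sg_add)

lemma usum_minus: "usum (\<lambda>u v. - \<phi> u v) w = - usum \<phi> w"
  by (rule usum_pull_UNIV[symmetric]) simp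

text \<open>Both sides distribute the letters over three blocks. A letter that enters the third
  block passes the first two, and its sign splits accordingly because degrees add up.\<close>

lemma usum_coassoc:
  "usum (\<lambda>u v. usum (\<lambda>x y. G x y v) u) w = usum (\<lambda>x r. usum (\<lambda>y v. G x y v) r) w"
proof (induction w arbitrary: G)
  case (Cons a w)
  have deg: "usum (\<lambda>u v. sg (fst a * word_degree u) (usum (\<lambda>x y. G x y (a # v)) u)) w =
     usum (\<lambda>u v. usum (\<lambda>x y. sg (fst a * word_degree x) (sg (fst a * word_degree y) (G x y (a # v)))) u) w"
    by (auto intro!: usum_cong' simp: usum_sg[symmetric] distrib_left[symmetric])
  show ?case
    by (simp only: usum.simps usum_add deg Cons.IH sg_add)
      (simp only: usum_sg usum_add add.assoc)
qed simp

text \<open>When a letter joins one block, the sign of exchanging the blocks changes by the degree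
  of the letter times that of the other block. This matches the sign that \<open>usum\<close>
  charges for placing it in the second block.\<close>

lemma usum_cocomm:
  "usum \<phi> w = usum (\<lambda>u v. sg (word_degree u * word_degree v) (\<phi> v u)) w"
proof (induction w arbitrary: \<phi>)
  case (Cons a w)
  have "usum (\<lambda>u v. sg (word_degree u * word_degree v) (\<phi> (a # v) u)) w =
      usum (\<lambda>u v. sg (fst a * word_degree u) (sg (word_degree u * word_degree (a # v)) (\<phi> (a # v) u))) w"
    by (intro usum_cong refl) (auto simp: algebra_simps intro!: sg_parity)
  moreover have "usum (\<lambda>u v. sg (word_degree u * word_degree v) (sg (fst a * word_degree v) (\<phi> v (a # u)))) w
    = usum (\<lambda>u v. sg (word_degree (a # u) * word_degree v) (\<phi> v (a # u))) w"
    by (intro usum_cong refl) (auto simp: algebra_simps intro!: sg_parity)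
  ultimately show ?case
    by (simp only: usum.simps Cons.IH[of "\<lambda>u v. \<phi> (a # u) v"]
        Cons.IH[of "\<lambda>u v. sg (fst a * word_degree u) (\<phi> u (a # v))"] add.commute)
qed simp

text \<open>Exchange of the first two of three blocks. This is how contributions with two
  interchangeable blocks are matched or cancelled later on.\<close>

lemma usum_swap:
  "usum (\<lambda>u r. usum (\<lambda>v y. G u v y) r) w =
   usum (\<lambda>v r. usum (\<lambda>u y. sg (word_degree u * word_degree v) (G u v y)) r) w"
proof -
  have "usum (\<lambda>u r. usum (\<lambda>v y. G u v y) r) w = usum (\<lambda>z y. usum (\<lambda>u v. G u v y) z) w"
    by (rule usum_coassoc[symmetric])
  also have "\<dots> = usum (\<lambda>z y. usum (\<lambda>v u. sg (word_degree v * word_degree u) (G u v y)) z) w"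
    by (subst usum_cocomm) (rule refl)
  also have "\<dots> = usum (\<lambda>v r. usum (\<lambda>u y. sg (word_degree v * word_degree u) (G u v y)) r) w"
    by (rule usum_coassoc)
  finally show ?thesis by (simp add: mult.commute)
qed

text \<open>The counit property: if all letters stay in the first block, none moves past another and
  no sign arises.\<close>

lemma usum_right_unit: "usum (\<lambda>u v. if v = [] then \<phi> u else 0) w = \<phi> w"
  by (induction w arbitrary: \<phi>) simp_all

text \<open>In the applications \<open>T\<close> is multiplication by a scalar \<open>c\<close>, and
  \<open>a'\<close>, \<open>a\<close>, \<open>b\<close> are letters with entries
  \<open>c x + y\<close>, \<open>x\<close>, \<open>y\<close> of one degree. Keeping \<open>T\<close>
  an abstract additive map lets the values lie in any abelian group.\<close>

lemma usum_linear_letter: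
  assumes add: "\<And>x y. T (x + y) = T x + T y"
    and deg: "fst a' = fst a" "fst b = fst a"
    and left: "\<And>p q r. set p \<union> set q \<union> set r \<subseteq> set u \<union> set v \<Longrightarrow>
      length p + length q + length r = length u + length v \<Longrightarrow>
      \<phi> (p @ a' # q) r = T (\<phi> (p @ a # q) r) + \<phi> (p @ b # q) r"
    and right: "\<And>p q r. set p \<union> set q \<union> set r \<subseteq> set u \<union> set v \<Longrightarrow>
      length p + length q + length r = length u + length v \<Longrightarrow>
      \<phi> r (p @ a' # q) = T (\<phi> r (p @ a # q)) + \<phi> r (p @ b # q)"
  shows "usum \<phi> (u @ a' # v) = T (usum \<phi> (u @ a # v)) + usum \<phi> (u @ b # v)"
  using left right
proof (induction u arbitrary: \<phi>)
  case Nil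
  have T: "T (sg k x) = sg k (T x)" for k x
    by (rule additive_onD(8)[of UNIV])
      (use add in \<open>auto simp: additive_on_def, metis add_diff_cancel diff_add_cancel\<close>)
  have 1: "usum (\<lambda>p q. \<phi> (a' # p) q) v = usum (\<lambda>p q. T (\<phi> (a # p) q) + \<phi> (b # p) q) v"
    by (rule usum_cong') (use Nil(1)[of "[]"] in auto)
  have 2: "usum (\<lambda>p q. sg (fst a' * word_degree p) (\<phi> p (a' # q))) v =
    usum (\<lambda>p q. T (sg (fst a * word_degree p) (\<phi> p (a # q))) + sg (fst b * word_degree p) (\<phi> p (b # q))) v"
  proof (rule usum_cong', goal_cases)
    case (1 p q)
    then have "set q \<subseteq> set v \<and> set p \<subseteq> set v" by blast
    with 1 show ?case using Nil(2)[of "[]" q p] by (auto simp: deg T sg_add)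
  qed
  show ?case
    unfolding append_Nil usum.simps 1 2 usum_add add usum_pull_UNIV[of T, OF add]
    by (simp add: add_ac)
next
  case (Cons c u)
  have T: "T (sg k x) = sg k (T x)" for k x
    by (rule additive_onD(8)[of UNIV])
      (use add in \<open>auto simp: additive_on_def, metis add_diff_cancel diff_add_cancel\<close>)
  have 1: "usum (\<lambda>p q. \<phi> (c # p) q) (u @ a' # v) =
      T (usum (\<lambda>p q. \<phi> (c # p) q) (u @ a # v)) + usum (\<lambda>p q. \<phi> (c # p) q) (u @ b # v)"
  proof (rule Cons.IH, goal_cases)
    case (1 p q r)
    then show ?case using Cons.prems(1)[of "c # p" q r] by auto
  next
    case (2 p q r)
    then show ?case using Cons.prems(2)[of p q "c # r"] by auto
  qed
  have 2: "usum (\<lambda>p q. sg (fst c * word_degree p) (\<phi> p (c # q))) (u @ a' # v) =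
      T (usum (\<lambda>p q. sg (fst c * word_degree p) (\<phi> p (c # q))) (u @ a # v))
      + usum (\<lambda>p q. sg (fst c * word_degree p) (\<phi> p (c # q))) (u @ b # v)"
  proof (rule Cons.IH, goal_cases)
    case (1 p q r)
    then have "set p \<union> set q \<union> set (c # r) \<subseteq> set (c # u) \<union> set v" by auto
    with 1 show ?case using Cons.prems(1)[of p q "c # r"] by (auto simp: T sg_add deg)
  next
    case (2 p q r)
    then have "set (c # p) \<union> set q \<union> set r \<subseteq> set (c # u) \<union> set v" by auto
    with 2 show ?case using Cons.prems(2)[of "c # p" q r] by (auto simp: T sg_add deg)
  qed
  show ?case
    unfolding append_Cons usum.simps 1 2 add by (simp add: add_ac)
qed

text \<open>If the two neighbouring letters fall into one block, the symmetry of
  \<open>\<phi>\<close> applies. If they are separated, the same two blocks arise from both words,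
  and the signs charged by \<open>usum\<close> differ by the Koszul sign of the two letters.\<close>

lemma usum_symmetric:
  assumes left: "\<And>p q r. set p \<union> set q \<union> set r \<subseteq> set u \<union> set v \<Longrightarrow>
      length p + length q + length r = length u + length v \<Longrightarrow>
      \<phi> (p @ a # b # q) r = sg (fst a * fst b) (\<phi> (p @ b # a # q) r)"
    and right: "\<And>p q r. set p \<union> set q \<union> set r \<subseteq> set u \<union> set v \<Longrightarrow>
      length p + length q + length r = length u + length v \<Longrightarrow>
      \<phi> r (p @ a # b # q) = sg (fst a * fst b) (\<phi> r (p @ b # a # q))"
  shows "usum \<phi> (u @ a # b # v) = sg (fst a * fst b) (usum \<phi> (u @ b # a # v))"
  using assms
proof (induction u arbitrary: \<phi>)
  case Nil
  have 1: "usum (\<lambda>u v. \<phi> (a # b # u) v) v = usum (\<lambda>u v. sg (fst a * fst b) (\<phi> (b # a # u) v)) v"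
    by (rule usum_cong') (use Nil(1)[of "[]"] in auto)
  have 2: "usum (\<lambda>u v. sg (fst b * word_degree u) (sg (fst a * word_degree u) (\<phi> u (a # b # v)))) v
    = usum (\<lambda>u v. sg (fst a * fst b) (sg (fst a * word_degree u) (sg (fst b * word_degree u) (\<phi> u (b # a # v))))) v"
  proof (rule usum_cong', goal_cases)
    case (1 p q)
    then have "set q \<subseteq> set v \<and> set p \<subseteq> set v" by blast
    with 1 show ?case using Nil(2)[of "[]" q p] by (auto simp: algebra_simps)
  qed
  have 3: "usum (\<lambda>u v. sg (fst b * word_degree u) (\<phi> (a # u) (b # v))) v =
     usum (\<lambda>u v. sg (fst a * fst b) (sg (fst b * word_degree (a # u)) (\<phi> (a # u) (b # v)))) v"
    by (rule usum_cong') (auto simp: algebra_simps intro!: sg_parity)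
  have 4: "usum (\<lambda>u v. sg (fst a * word_degree (b # u)) (\<phi> (b # u) (a # v))) v =
     usum (\<lambda>u v. sg (fst a * fst b) (sg (fst a * word_degree u) (\<phi> (b # u) (a # v)))) v"
    by (rule usum_cong') (auto simp: algebra_simps intro!: sg_parity)
  show ?case
    unfolding append_Nil usum.simps 1 2 3 4
    by (simp only: sg_add usum_sg usum_add) (simp only: add_ac)
next
  case (Cons c u)
  have 1: "usum (\<lambda>p q. \<phi> (c # p) q) (u @ a # b # v) =
      sg (fst a * fst b) (usum (\<lambda>p q. \<phi> (c # p) q) (u @ b # a # v))"
  proof (rule Cons.IH, goal_cases)
    case (1 p q r)
    then show ?case using Cons.prems(1)[of "c # p" q r] by auto
  next
    case (2 p q r)
    then show ?case using Cons.prems(2)[of p q "c # r"] by auto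
  qed
  have 2: "usum (\<lambda>p q. sg (fst c * word_degree p) (\<phi> p (c # q))) (u @ a # b # v) =
      sg (fst a * fst b) (usum (\<lambda>p q. sg (fst c * word_degree p) (\<phi> p (c # q))) (u @ b # a # v))"
  proof (rule Cons.IH, goal_cases)
    case (1 p q r)
    then have "set p \<union> set q \<union> set (c # r) \<subseteq> set (c # u) \<union> set v" by auto
    with 1 show ?case using Cons.prems(1)[of p q "c # r"] by (auto simp: algebra_simps)
  next
    case (2 p q r)
    then have "set (c # p) \<union> set q \<union> set r \<subseteq> set (c # u) \<union> set v" by auto
    with 2 show ?case using Cons.prems(2)[of "c # p" q r] by (auto simp: algebra_simps)
  qed
  show ?case
    unfolding append_Cons usum.simps 1 2 by (simp add: sg_add)
qed

section \<open>Coalgebra morphisms and coderivations\<close>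

text \<open>
  \<open>esum f \<phi> w\<close> evaluates \<open>\<phi>\<close> on the image of \<open>w\<close> under the coalgebra morphism with
  corestriction \<open>f\<close>: the blocks of an unordered distribution are listed in the order of their
  first letters, so that no factorials are needed.
\<close>

function esum :: "('a gword \<Rightarrow> 'b) \<Rightarrow> ('b gword \<Rightarrow> 'c::ab_group_add) \<Rightarrow> 'a gword \<Rightarrow> 'c" where
  "esum f \<phi> [] = \<phi> []"
| "esum f \<phi> (a # w) =
     usum (\<lambda>u v. esum f (\<lambda>t. \<phi> ((word_degree (a # u), f (a # u)) # t)) v) w"
  by pat_completeness auto
termination by (relation "measure (\<lambda>(f, \<phi>, w). length w)") auto

definition maps_words :: "(int \<times> 'a) set \<Rightarrow> (int \<times> 'b) set \<Rightarrow> int \<Rightarrow> ('a gword \<Rightarrow> 'b) \<Rightarrow> bool" where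
  "maps_words A B e f \<longleftrightarrow> (\<forall>u. u \<noteq> [] \<longrightarrow> set u \<subseteq> A \<longrightarrow> (word_degree u + e, f u) \<in> B)"

lemma maps_wordsD: "maps_words A B e f \<Longrightarrow> u \<noteq> [] \<Longrightarrow> set u \<subseteq> A \<Longrightarrow> (word_degree u + e, f u) \<in> B"
  by (simp add: maps_words_def)

lemma maps_words_UNIV [simp]: "maps_words A UNIV e f"
  by (simp add: maps_words_def)

text \<open>The induced coalgebra morphism has degree zero and produces the empty word only from the
  empty word, so the words on which \<open>\<phi>\<close> is evaluated inherit the degree and the
  nonemptiness of \<open>w\<close>.\<close>

lemma esum_cong':
  assumes f: "maps_words A B 0 f" and w: "set w \<subseteq> A"
    and "\<And>t. set t \<subseteq> B \<Longrightarrow> word_degree t = word_degree w \<Longrightarrow> t = [] \<longleftrightarrow> w = [] \<Longrightarrow> \<phi> t = \<psi> t"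
  shows "esum f \<phi> w = esum f \<psi> w"
  using assms(2-)
proof (induction w arbitrary: \<phi> \<psi> rule: length_induct)
  case (1 w)
  show ?case
  proof (cases w)
    case Nil
    then show ?thesis using 1 by simp
  next
    case (Cons a w')
    show ?thesis unfolding Cons esum.simps
    proof (intro usum_cong')
      fix u v assume uv: "length u + length v = length w'"
        "word_degree u + word_degree v = word_degree w'" "set u \<union> set v = set w'"
      show "esum f (\<lambda>t. \<phi> ((word_degree (a # u), f (a # u)) # t)) v =
          esum f (\<lambda>t. \<psi> ((word_degree (a # u), f (a # u)) # t)) v"
      proof (rule 1(1)[rule_format])
        show "length v < length w" "set v \<subseteq> A"
          using uv 1(2) by (auto simp: Cons)
        fix t assume t: "set t \<subseteq> B" "word_degree t = word_degree v"
        have "(word_degree (a # u), f (a # u)) \<in> B"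
          using maps_wordsD[OF f, of "a # u"] uv 1(2) by (auto simp: Cons)
        then show "\<phi> ((word_degree (a # u), f (a # u)) # t) = \<psi> ((word_degree (a # u), f (a # u)) # t)"
          using t uv by (intro 1(3)) (auto simp: Cons)
      qed
    qed
  qed
qed

lemma esum_cong_fun:
  fixes f f' :: "'a gword \<Rightarrow> 'b"
  assumes "\<And>u. u \<noteq> [] \<Longrightarrow> length u \<le> length w \<Longrightarrow> f u = f' u"
  shows "esum f \<phi> w = esum f' \<phi> w"
  using assms
proof (induction w arbitrary: \<phi> rule: length_induct)
  case (1 w)
  show ?case
  proof (cases w)
    case (Cons a w')
    show ?thesis unfolding Cons esum.simps
    proof (intro usum_cong')
      fix u v :: "'a gword" assume uv: "length u + length v = length w'"
      have "f (a # u) = f' (a # u)"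
        using uv by (intro 1(2)) (auto simp: Cons)
      moreover have "esum f (\<lambda>t. \<phi> ((word_degree (a # u), f (a # u)) # t)) v =
          esum f' (\<lambda>t. \<phi> ((word_degree (a # u), f (a # u)) # t)) v"
        using uv by (intro 1(1)[rule_format] 1(2)) (auto simp: Cons)
      ultimately show "esum f (\<lambda>t. \<phi> ((word_degree (a # u), f (a # u)) # t)) v =
          esum f' (\<lambda>t. \<phi> ((word_degree (a # u), f' (a # u)) # t)) v"
        by simp
    qed
  qed simp
qed

lemma esum_zero [simp]: "esum f (\<lambda>t. 0 :: 'c::ab_group_add) = (\<lambda>w. 0)"
proof
  show "esum f (\<lambda>t. 0 :: 'c) w = 0" for w
  proof (induction w rule: length_induct)
    case (1 w)
    show ?case
    proof (cases w)
      case (Cons a w')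
      have "usum (\<lambda>u v. esum f (\<lambda>t. 0 :: 'c) v) w' = usum (\<lambda>u v. 0) w'"
        by (intro usum_cong refl 1[rule_format]) (auto simp: Cons)
      then show ?thesis unfolding Cons esum.simps by simp
    qed simp
  qed
qed

lemma esum_add: "esum f (\<lambda>t. \<phi> t + \<psi> t) w = esum f \<phi> w + esum f \<psi> w"
proof (induction w arbitrary: \<phi> \<psi> rule: length_induct)
  case (1 w)
  show ?case
  proof (cases w)
    case (Cons a w')
    show ?thesis unfolding Cons esum.simps usum_add[symmetric]
      by (intro usum_cong refl 1[rule_format]) (auto simp: Cons)
  qed simp
qed

lemma esum_pull':
  assumes f: "maps_words A B 0 f" and w: "set w \<subseteq> A" and S: "additive_on S H"
    and "\<And>t. set t \<subseteq> B \<Longrightarrow> word_degree t = word_degree w \<Longrightarrow> t = [] \<longleftrightarrow> w = [] \<Longrightarrow> \<phi> t \<in> S"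
  shows "esum f \<phi> w \<in> S \<and> H (esum f \<phi> w) = esum f (\<lambda>t. H (\<phi> t)) w"
  using assms(2,4)
proof (induction w arbitrary: \<phi> rule: length_induct)
  case (1 w)
  show ?case
  proof (cases w)
    case Nil
    then show ?thesis using 1 by simp
  next
    case (Cons a w')
    define \<psi> where "\<psi> u t = \<phi> ((word_degree (a # u), f (a # u)) # t)" for u t
    have IH: "esum f (\<psi> u) v \<in> S \<and> H (esum f (\<psi> u) v) = esum f (\<lambda>t. H (\<psi> u t)) v"
      if uv: "length u + length v = length w'"
        "word_degree u + word_degree v = word_degree w'" "set u \<union> set v = set w'" for u v
    proof (rule 1(1)[rule_format])
      show "length v < length w" "set v \<subseteq> A"
        using uv 1(2) by (auto simp: Cons)
      fix t assume t: "set t \<subseteq> B" "word_degree t = word_degree v"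
      have "(word_degree (a # u), f (a # u)) \<in> B"
        using maps_wordsD[OF f, of "a # u"] uv 1(2) by (auto simp: Cons)
      then show "\<psi> u t \<in> S"
        using t uv unfolding \<psi>_def by (intro 1(3)) (auto simp: Cons)
    qed
    have "usum (\<lambda>u v. esum f (\<psi> u) v) w' \<in> S \<and>
        H (usum (\<lambda>u v. esum f (\<psi> u) v) w') = usum (\<lambda>u v. H (esum f (\<psi> u) v)) w'"
      using IH by (intro usum_pull'[OF S]) auto
    moreover have "usum (\<lambda>u v. H (esum f (\<psi> u) v)) w' = usum (\<lambda>u v. esum f (\<lambda>t. H (\<psi> u t)) v) w'"
      using IH by (intro usum_cong') auto
    ultimately show ?thesis unfolding Cons esum.simps \<psi>_def[symmetric] by simp
  qed
qed

lemmas esum_mem = esum_pull'[THEN conjunct1] and esum_pull = esum_pull'[THEN conjunct2]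

lemma additive_on_UNIV: "(\<And>x y. H (x + y) = H x + H y) \<Longrightarrow> additive_on UNIV H"
  by (auto simp: additive_on_def) (metis add_diff_cancel diff_add_cancel)

lemma esum_pull_UNIV:
  assumes "\<And>x y. H (x + y) = H x + H y"
  shows "H (esum f \<phi> w) = esum f (\<lambda>t. H (\<phi> t)) w"
  by (rule esum_pull[OF maps_words_UNIV[of UNIV]]) (use assms in \<open>auto intro: additive_on_UNIV\<close>)

lemma esum_sg: "esum f (\<lambda>t. sg k (\<phi> t)) w = sg k (esum f \<phi> w)"
  by (rule esum_pull_UNIV[symmetric]) (rule sg_add)

lemma usum_usum_commute:
  "usum (\<lambda>u v. usum (\<lambda>p q. X u v p q) w) w' = usum (\<lambda>p q. usum (\<lambda>u v. X u v p q) w') w"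
  by (induction w arbitrary: X) (simp_all add: usum_add usum_sg)

lemma esum_usum_commute:
  "esum f (\<lambda>t. usum (\<lambda>p q. X t p q) w) w' = usum (\<lambda>p q. esum f (\<lambda>t. X t p q) w') w"
proof (induction w' arbitrary: X rule: length_induct)
  case (1 w')
  show ?case
  proof (cases w')
    case (Cons a w'')
    have "usum (\<lambda>u v. esum f (\<lambda>t. usum (\<lambda>p q. X ((word_degree (a # u), f (a # u)) # t) p q) w) v) w''
      = usum (\<lambda>u v. usum (\<lambda>p q. esum f (\<lambda>t. X ((word_degree (a # u), f (a # u)) # t) p q) v) w) w''"
      by (intro usum_cong refl 1[rule_format]) (auto simp: Cons)
    then show ?thesis unfolding Cons esum.simps usum_usum_commute[of _ w''] .
  qed simp
qed

lemma esum_Nil: "esum f (\<lambda>t. if t = [] then X else 0) w = (if w = [] then X else 0)"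
  by (cases w) simp_all

text \<open>Projection to one-letter words leaves room for one block only, so it recovers the
  corestriction \<open>f\<close> of the coalgebra morphism.\<close>

lemma esum_singleton:
  assumes "w \<noteq> []"
  shows "esum f (\<lambda>t. if length t = 1 then \<phi> t else 0) w = \<phi> [(word_degree w, f w)]"
proof -
  obtain a w' where w: "w = a # w'" using assms by (cases w) auto
  have "esum f (\<lambda>t. if length t = 1 then \<phi> t else 0) w =
    usum (\<lambda>u v. esum f (\<lambda>t. if t = [] then \<phi> [(word_degree (a # u), f (a # u))] else 0) v) w'"
    unfolding w esum.simps
    by (intro usum_cong refl arg_cong2[where f="esum f"] ext) auto
  then show ?thesis
    unfolding esum_Nil usum_right_unit w .
qed

text \<open>The exponential of the corestriction is grouplike, i.e. a morphism of coalgebras.\<close>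

lemma esum_usum:
  "esum f (usum \<rho>) w = usum (\<lambda>u v. esum f (\<lambda>y. esum f (\<rho> y) v) u) w"
proof (induction w arbitrary: \<rho> rule: length_induct)
  case (1 w)
  show ?case
  proof (cases w)
    case (Cons a w')
    define F where "F u = (word_degree (a # u), f (a # u))" for u
    \<comment> \<open>The letter \<open>F u\<close> made from the first block goes to the left or to
      the right factor of the coproduct. In the second case it passes the left word, whose degree is
      that of \<open>x\<close>.\<close>
    have IH: "esum f (\<lambda>t. usum \<rho> (F u # t)) v =
       usum (\<lambda>x r. esum f (\<lambda>y. esum f (\<rho> (F u # y)) r) x) v
       + usum (\<lambda>x r. sg (word_degree (a # u) * word_degree x)
            (esum f (\<lambda>y. esum f (\<lambda>z. \<rho> y (F u # z)) r) x)) v"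
      if "length v < length w" for u v
    proof -
      have "esum f (\<lambda>t. usum \<rho> (F u # t)) v =
        usum (\<lambda>x r. esum f (\<lambda>y. esum f (\<rho> (F u # y)) r) x) v
        + usum (\<lambda>x r. esum f (\<lambda>y. esum f (\<lambda>z. sg (fst (F u) * word_degree y) (\<rho> y (F u # z))) r) x) v"
        using 1 that by (simp add: esum_add)
      moreover have "esum f (\<lambda>y. esum f (\<lambda>z. sg (fst (F u) * word_degree y) (\<rho> y (F u # z))) r) x
        = esum f (\<lambda>y. sg (word_degree (a # u) * word_degree x) (esum f (\<lambda>z. \<rho> y (F u # z)) r)) x" for x r
        by (rule esum_cong'[OF maps_words_UNIV[of UNIV]]) (simp_all add: F_def esum_sg)
      ultimately show ?thesis by (simp add: esum_sg)
    qed
    have "esum f (usum \<rho>) w = usum (\<lambda>u v. esum f (\<lambda>t. usum \<rho> (F u # t)) v) w'"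
      unfolding Cons esum.simps F_def ..
    also have "\<dots> = usum (\<lambda>u v. usum (\<lambda>x r. esum f (\<lambda>y. esum f (\<rho> (F u # y)) r) x) v
       + usum (\<lambda>x r. sg (word_degree (a # u) * word_degree x)
            (esum f (\<lambda>y. esum f (\<lambda>z. \<rho> y (F u # z)) r) x)) v) w'"
      using IH by (intro usum_cong refl) (simp add: Cons)
    \<comment> \<open>In the second sum the block of \<open>a\<close> is split off before the left
      factor \<open>x\<close>. After \<open>usum_swap\<close> the two signs combine to that of
      moving \<open>a\<close> alone past \<open>x\<close>, since the degree of \<open>u\<close>
      enters twice.\<close>
    also have "\<dots> = usum (\<lambda>u v. usum (\<lambda>x r. esum f (\<lambda>y. esum f (\<rho> (F u # y)) r) x) v) w'
       + usum (\<lambda>x v. usum (\<lambda>u r. sg (word_degree u * word_degree x) (sg (word_degree (a # u) * word_degree x)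
            (esum f (\<lambda>y. esum f (\<lambda>z. \<rho> y (F u # z)) r) x))) v) w'"
      unfolding usum_add by (subst (2) usum_swap) (rule refl)
    also have "usum (\<lambda>u v. usum (\<lambda>x r. esum f (\<lambda>y. esum f (\<rho> (F u # y)) r) x) v) w'
       = usum (\<lambda>u v. esum f (\<lambda>y. esum f (\<rho> y) v) (a # u)) w'"
      unfolding esum.simps F_def[symmetric] by (rule usum_coassoc[symmetric])
    also have "usum (\<lambda>x v. usum (\<lambda>u r. sg (word_degree u * word_degree x) (sg (word_degree (a # u) * word_degree x)
            (esum f (\<lambda>y. esum f (\<lambda>z. \<rho> y (F u # z)) r) x))) v) w'
       = usum (\<lambda>x v. usum (\<lambda>u r. sg (fst a * word_degree x)
            (esum f (\<lambda>y. esum f (\<lambda>z. \<rho> y (F u # z)) r) x)) v) w'"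
      by (intro usum_cong refl) (auto simp: algebra_simps intro!: sg_parity)
    also have "\<dots> = usum (\<lambda>x v. sg (fst a * word_degree x) (esum f (\<lambda>y. esum f (\<rho> y) (a # v)) x)) w'"
      unfolding usum_sg esum.simps F_def[symmetric] esum_usum_commute ..
    finally show ?thesis unfolding Cons usum.simps .
  qed simp
qed

text \<open>\<open>cod q \<phi> w\<close> evaluates \<open>\<phi>\<close> on the image of \<open>w\<close> under the coderivation with corestriction \<open>q\<close>.\<close>

definition cod :: "('a gword \<Rightarrow> 'a) \<Rightarrow> ('a gword \<Rightarrow> 'c::ab_group_add) \<Rightarrow> 'a gword \<Rightarrow> 'c" where
  "cod q \<phi> = usum (\<lambda>u v. if u = [] then 0 else \<phi> ((word_degree u + 1, q u) # v))"

text \<open>A coderivation puts its value in front of the remaining letters. Additivity in the first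
  letter is therefore what moves a functional through the sum that forms this value.\<close>

definition head_additive :: "(int \<times> 'a::ab_group_add) set \<Rightarrow> ('a gword \<Rightarrow> 'c::ab_group_add) \<Rightarrow> bool" where
  "head_additive B \<phi> \<longleftrightarrow>
     (\<forall>d t. set t \<subseteq> B \<longrightarrow> additive_on {x. (d, x) \<in> B} (\<lambda>x. \<phi> ((d, x) # t)))"

lemma esum_additive:
  assumes f: "maps_words A B 0 f" and w: "set w \<subseteq> A" and S: "\<And>x y. x \<in> S \<Longrightarrow> y \<in> S \<Longrightarrow> x - y \<in> S" "0 \<in> S"
    and \<phi>: "\<And>t. set t \<subseteq> B \<Longrightarrow> additive_on S (\<lambda>x. \<phi> x t)"
  shows "additive_on S (\<lambda>x. esum f (\<phi> x) w)"
proof -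
  have diff: "esum f (\<lambda>t. \<phi> x t - \<phi> y t) w = esum f (\<phi> x) w - esum f (\<phi> y) w" for x y
  proof -
    have "esum f (\<phi> x) w = esum f (\<lambda>t. (\<phi> x t - \<phi> y t) + \<phi> y t) w" by simp
    then show ?thesis by (simp only: esum_add add_diff_cancel_right')
  qed
  have "esum f (\<phi> (x - y)) w = esum f (\<lambda>t. \<phi> x t - \<phi> y t) w" if "x \<in> S" "y \<in> S" for x y
    by (rule esum_cong'[OF f w]) (use \<phi> that in \<open>auto simp: additive_on_def\<close>)
  then show ?thesis
    using S diff by (auto simp: additive_on_def)
qed

lemma head_additive_esum:
  assumes "maps_words A B 0 f" "set w \<subseteq> A" "head_additive B \<phi>"
  shows "additive_on {x. (d, x) \<in> B} (\<lambda>x. esum f (\<lambda>t. \<phi> ((d, x) # t)) w)"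
proof (rule esum_additive[OF assms(1,2)])
  have *: "additive_on {x. (d, x) \<in> B} (\<lambda>x. \<phi> ((d, x) # []))"
    using assms(3) unfolding head_additive_def by (metis empty_set empty_subsetI)
  then show "0 \<in> {x. (d, x) \<in> B}"
    "\<And>x y. x \<in> {x. (d, x) \<in> B} \<Longrightarrow> y \<in> {x. (d, x) \<in> B} \<Longrightarrow> x - y \<in> {x. (d, x) \<in> B}"
    unfolding additive_on_def by blast+
qed (use assms(3) in \<open>auto simp: head_additive_def\<close>)

text \<open>The value of \<open>q\<close> stands first and hence heads the first block. By
  coassociativity its arguments and the other letters of that block form one sub-word
  \<open>z\<close>, on which the corestriction of the composite is evaluated; the remaining blocks
  come from \<open>y\<close>.\<close>

lemma cod_esum:
  assumes f: "maps_words A B 0 f" and q: "maps_words A A 1 q" and \<phi>: "head_additive B \<phi>"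
    and w: "set w \<subseteq> A"
  shows "cod q (esum f \<phi>) w = usum (\<lambda>z y. esum f (\<lambda>t. \<phi> ((word_degree z + 1, cod q f z) # t)) y) w"
proof -
  define H where "H d y X = esum f (\<lambda>t. \<phi> ((d, X) # t)) y" for d y X
  have H: "additive_on {x. (d, x) \<in> B} (H d y)" if "set y \<subseteq> A" for d y
    unfolding H_def using head_additive_esum[OF f that \<phi>] by blast
  have "cod q (esum f \<phi>) w =
    usum (\<lambda>u v. usum (\<lambda>x y. if u = [] then 0 else H (word_degree u + 1 + word_degree x) y
       (f ((word_degree u + 1, q u) # x))) v) w"
    unfolding cod_def H_def by (intro usum_cong refl) auto
  also have "\<dots> = usum (\<lambda>z y. usum (\<lambda>u x. if u = [] then 0 else H (word_degree u + 1 + word_degree x) y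
       (f ((word_degree u + 1, q u) # x))) z) w"
    by (rule usum_coassoc[symmetric])
  also have "\<dots> = usum (\<lambda>z y. H (word_degree z + 1) y (cod q f z)) w"
  proof (rule usum_cong')
    fix z y assume zy: "set z \<union> set y = set w"
    then have z: "set z \<subseteq> A" and y: "set y \<subseteq> A" using w by auto
    have "H (word_degree z + 1) y (cod q f z) = usum (\<lambda>u x. H (word_degree z + 1) y
        (if u = [] then 0 else f ((word_degree u + 1, q u) # x))) z"
      unfolding cod_def
    proof (rule usum_pull[OF H[OF y]])
      fix u x assume ux: "word_degree u + word_degree x = word_degree z" "set u \<union> set x = set z"
      have "(word_degree z + 1, f ((word_degree u + 1, q u) # x)) \<in> B" if "u \<noteq> []"
        using maps_wordsD[OF f, of "(word_degree u + 1, q u) # x"] maps_wordsD[OF q that] ux z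
        by (auto simp: algebra_simps)
      then show "(if u = [] then 0 else f ((word_degree u + 1, q u) # x)) \<in> {x. (word_degree z + 1, x) \<in> B}"
        using additive_onD(1)[OF H[OF y]] by auto
    qed
    also have "\<dots> = usum (\<lambda>u x. if u = [] then 0 else H (word_degree u + 1 + word_degree x) y
       (f ((word_degree u + 1, q u) # x))) z"
      by (rule usum_cong') (auto simp: additive_onD(2)[OF H[OF y]] algebra_simps)
    finally show "usum (\<lambda>u x. if u = [] then 0 else H (word_degree u + 1 + word_degree x) y
       (f ((word_degree u + 1, q u) # x))) z = H (word_degree z + 1) y (cod q f z)" ..
  qed
  finally show ?thesis unfolding H_def .
qed

text \<open>Since the morphism respects the coproduct, the arguments of \<open>q\<close> are blocks
  of a sub-word \<open>z\<close>, and the other letters are blocks of its complement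
  \<open>y\<close>. The outcome has the shape of \<open>cod_esum\<close>, so comparing two such
  composites reduces to comparing their corestrictions.\<close>

lemma esum_cod:
  assumes f: "maps_words A B 0 f" and q: "maps_words B B 1 q" and \<phi>: "head_additive B \<phi>"
    and w: "set w \<subseteq> A"
  shows "esum f (cod q \<phi>) w =
    usum (\<lambda>z y. if z = [] then 0 else esum f (\<lambda>t. \<phi> ((word_degree z + 1, esum f q z) # t)) y) w"
  unfolding cod_def esum_usum
proof (rule usum_cong')
  fix z y assume zy: "set z \<union> set y = set w"
  then have z: "set z \<subseteq> A" and y: "set y \<subseteq> A" using w by auto
  show "esum f (\<lambda>s. esum f (\<lambda>t. if s = [] then 0 else \<phi> ((word_degree s + 1, q s) # t)) y) z =
    (if z = [] then 0 else esum f (\<lambda>t. \<phi> ((word_degree z + 1, esum f q z) # t)) y)"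
  proof (cases "z = []")
    case False
    have "esum f (\<lambda>s. esum f (\<lambda>t. if s = [] then 0 else \<phi> ((word_degree s + 1, q s) # t)) y) z
      = esum f (\<lambda>s. esum f (\<lambda>t. \<phi> ((word_degree z + 1, q s) # t)) y) z"
      by (rule esum_cong'[OF f z]) (simp_all add: False)
    also have "\<dots> = esum f (\<lambda>t. \<phi> ((word_degree z + 1, esum f q z) # t)) y"
      using maps_wordsD[OF q] False
      by (intro esum_pull[OF f z head_additive_esum[OF f y \<phi>], symmetric]) (metis mem_Collect_eq)
    finally show ?thesis using False by simp
  qed simp
qed

text \<open>The changed letter lies in exactly one block. There \<open>f\<close> turns the change
  into one of a single letter of the image word, where \<open>\<phi>\<close> is linear;
  \<open>TW\<close> and \<open>T\<close> stand for scalar multiplication on the values of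
  \<open>f\<close> and of \<open>\<phi>\<close>.\<close>

lemma esum_linear_letter:
  assumes T: "\<And>x y. T (x + y) = T x + T y"
    and deg: "fst a' = fst a" "fst b = fst a"
    and A: "a \<in> A" "b \<in> A" "a' \<in> A" and f: "maps_words A B 0 f"
    and flin: "\<And>p q. set p \<union> set q \<subseteq> A \<Longrightarrow> f (p @ a' # q) = TW (f (p @ a # q)) + f (p @ b # q)"
    and \<phi>lin: "\<And>p q d x y. set p \<union> set q \<subseteq> B \<Longrightarrow> (d, x) \<in> B \<Longrightarrow> (d, y) \<in> B \<Longrightarrow>
       \<phi> (p @ (d, TW x + y) # q) = T (\<phi> (p @ (d, x) # q)) + \<phi> (p @ (d, y) # q)"
    and uv: "set u \<union> set v \<subseteq> A"
  shows "esum f \<phi> (u @ a' # v) = T (esum f \<phi> (u @ a # v)) + esum f \<phi> (u @ b # v)"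
  using uv \<phi>lin
proof (induction "length u + length v" arbitrary: u v \<phi> rule: less_induct)
  case less
  have block: "esum f (\<lambda>t. \<phi> ((word_degree (p @ a' # q), f (p @ a' # q)) # t)) r =
     T (esum f (\<lambda>t. \<phi> ((word_degree (p @ a # q), f (p @ a # q)) # t)) r)
     + esum f (\<lambda>t. \<phi> ((word_degree (p @ b # q), f (p @ b # q)) # t)) r"
    if pqr: "set p \<union> set q \<subseteq> A" "set r \<subseteq> A" for p q r
  proof -
    have "esum f (\<lambda>t. \<phi> ((word_degree (p @ a' # q), f (p @ a' # q)) # t)) r =
      esum f (\<lambda>t. T (\<phi> ((word_degree (p @ a # q), f (p @ a # q)) # t))
        + \<phi> ((word_degree (p @ b # q), f (p @ b # q)) # t)) r"
    proof (rule esum_cong'[OF f pqr(2)])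
      fix t assume t: "set t \<subseteq> B"
      have "(word_degree (p @ a # q), f (p @ a # q)) \<in> B" "(word_degree (p @ a # q), f (p @ b # q)) \<in> B"
        using maps_wordsD[OF f, of "p @ a # q"] maps_wordsD[OF f, of "p @ b # q"] pqr A by (auto simp: deg)
      from less(3)[of "[]", OF _ this, of t] t
      show "\<phi> ((word_degree (p @ a' # q), f (p @ a' # q)) # t) =
        T (\<phi> ((word_degree (p @ a # q), f (p @ a # q)) # t))
        + \<phi> ((word_degree (p @ b # q), f (p @ b # q)) # t)"
        using flin[OF pqr(1)] by (simp add: deg)
    qed
    then show ?thesis
      by (simp only: esum_add esum_pull_UNIV[of T, OF T])
  qed
  show ?case
  proof (cases u)
    case Nil
    have "usum (\<lambda>p q. esum f (\<lambda>t. \<phi> ((word_degree (a' # p), f (a' # p)) # t)) q) v =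
      usum (\<lambda>p q. T (esum f (\<lambda>t. \<phi> ((word_degree (a # p), f (a # p)) # t)) q)
        + esum f (\<lambda>t. \<phi> ((word_degree (b # p), f (b # p)) # t)) q) v"
    proof (rule usum_cong')
      fix p q assume "set p \<union> set q = set v"
      with less.prems(1) have "set [] \<union> set p \<subseteq> A" "set q \<subseteq> A" by auto
      from block[OF this] show "esum f (\<lambda>t. \<phi> ((word_degree (a' # p), f (a' # p)) # t)) q =
       T (esum f (\<lambda>t. \<phi> ((word_degree (a # p), f (a # p)) # t)) q)
        + esum f (\<lambda>t. \<phi> ((word_degree (b # p), f (b # p)) # t)) q" by simp
    qed
    then show ?thesis
      unfolding Nil append_Nil esum.simps by (simp only: usum_add usum_pull_UNIV[of T, OF T])
  next
    case (Cons c u')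
    show ?thesis unfolding Cons append_Cons esum.simps
    proof (rule usum_linear_letter, goal_cases)
      case (4 p q r)
      then have "set (c # p) \<union> set q \<subseteq> A" "set r \<subseteq> A" using less.prems(1) by (auto simp: Cons)
      from block[OF this] show ?case by simp
    next
      case (5 p q r)
      then have "set (c # r) \<subseteq> A" using less.prems(1) by (auto simp: Cons)
      then have r: "(word_degree (c # r), f (c # r)) \<in> B"
        using maps_wordsD[OF f, of "c # r"] by auto
      show ?case
      proof (rule less.hyps)
        show "length p + length q < length u + length v" using 5 by (simp add: Cons)
        show "set p \<union> set q \<subseteq> A" using less.prems(1) 5 by (auto simp: Cons)
        fix p' q' d x y
        assume *: "set p' \<union> set q' \<subseteq> B" "(d, x) \<in> B" "(d, y) \<in> B"
        show "\<phi> ((word_degree (c # r), f (c # r)) # p' @ (d, TW x + y) # q') =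
          T (\<phi> ((word_degree (c # r), f (c # r)) # p' @ (d, x) # q'))
          + \<phi> ((word_degree (c # r), f (c # r)) # p' @ (d, y) # q')"
          using less.prems(2)[of "(word_degree (c # r), f (c # r)) # p'" q' d x y] * r by simp
      qed
    qed (use T deg in auto)
  qed
qed

text \<open>Interchanging two neighbouring letters alters the order of the blocks only if both are
  first in their blocks, and then the symmetry of \<open>\<phi>\<close> applies. Within one block
  the symmetry of \<open>f\<close> applies, and in the remaining case only the signs of
  \<open>usum\<close> change.\<close>

lemma esum_symmetric:
  assumes A: "a \<in> A" "b \<in> A" and f: "maps_words A B 0 f"
    and fsym: "\<And>p q. set p \<union> set q \<subseteq> A \<Longrightarrow> f (p @ a # b # q) = sg (fst a * fst b) (f (p @ b # a # q))"
    and \<phi>neg: "\<And>p q d x. set p \<union> set q \<subseteq> B \<Longrightarrow> (d, x) \<in> B \<Longrightarrow>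
       \<phi> (p @ (d, - x) # q) = - \<phi> (p @ (d, x) # q)"
    and \<phi>sym: "\<And>p q x y. set p \<union> set q \<subseteq> B \<Longrightarrow> x \<in> B \<Longrightarrow> y \<in> B \<Longrightarrow>
       \<phi> (p @ x # y # q) = sg (fst x * fst y) (\<phi> (p @ y # x # q))"
    and uv: "set u \<union> set v \<subseteq> A"
  shows "esum f \<phi> (u @ a # b # v) = sg (fst a * fst b) (esum f \<phi> (u @ b # a # v))"
  using uv \<phi>neg \<phi>sym
proof (induction "length u + length v" arbitrary: u v \<phi> rule: less_induct)
  case less
  have block: "esum f (\<lambda>t. \<phi> ((word_degree (p @ a # b # q), f (p @ a # b # q)) # t)) r =
     sg (fst a * fst b) (esum f (\<lambda>t. \<phi> ((word_degree (p @ b # a # q), f (p @ b # a # q)) # t)) r)"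
    if pqr: "set p \<union> set q \<subseteq> A" "set r \<subseteq> A" for p q r
    unfolding esum_sg[symmetric]
  proof (rule esum_cong'[OF f pqr(2)])
    fix t assume t: "set t \<subseteq> B"
    have "(word_degree (p @ b # a # q), f (p @ b # a # q)) \<in> B"
      using maps_wordsD[OF f, of "p @ b # a # q"] pqr A by auto
    from less(3)[of "[]", OF _ this, of t] t
    show "\<phi> ((word_degree (p @ a # b # q), f (p @ a # b # q)) # t) =
       sg (fst a * fst b) (\<phi> ((word_degree (p @ b # a # q), f (p @ b # a # q)) # t))"
      using fsym[OF pqr(1)] by (simp add: sg_def add_ac)
  qed
  show ?case
  proof (cases u)
    case Nil
    define F where "F c p = (word_degree (c # p), f (c # p))" for c p
    have F: "F c p \<in> B" if "c \<in> {a, b}" "set p \<subseteq> A" for c p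
      unfolding F_def using maps_wordsD[OF f, of "c # p"] that A by auto
    have 1: "usum (\<lambda>p q. esum f (\<lambda>t. \<phi> ((word_degree (a # b # p), f (a # b # p)) # t)) q) v =
      sg (fst a * fst b) (usum (\<lambda>p q. esum f (\<lambda>t. \<phi> ((word_degree (b # a # p), f (b # a # p)) # t)) q) v)"
      unfolding usum_sg[symmetric]
    proof (rule usum_cong')
      fix p q assume "set p \<union> set q = set v"
      with less.prems(1) have "set [] \<union> set p \<subseteq> A" "set q \<subseteq> A" by auto
      from block[OF this]
      show "esum f (\<lambda>t. \<phi> ((word_degree (a # b # p), f (a # b # p)) # t)) q =
        sg (fst a * fst b) (esum f (\<lambda>t. \<phi> ((word_degree (b # a # p), f (b # a # p)) # t)) q)" by simp
    qed
    \<comment> \<open>If the block of \<open>a\<close> leaves out \<open>b\<close>, then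
      \<open>b\<close> is the first remaining letter and heads the next block. Here
      \<open>usum_swap\<close> exchanges the two blocks and \<open>\<phi>sym\<close> exchanges their
      values.\<close>
    have "usum (\<lambda>p r. sg (fst b * word_degree p) (usum (\<lambda>p' q. esum f (\<lambda>t. \<phi> (F a p # F b p' # t)) q) r)) v
      = usum (\<lambda>p' r. usum (\<lambda>p q. sg (word_degree p * word_degree p')
          (sg (fst b * word_degree p) (esum f (\<lambda>t. \<phi> (F a p # F b p' # t)) q))) r) v"
      unfolding usum_sg[symmetric] by (rule usum_swap)
    also have "\<dots> = usum (\<lambda>p' r. usum (\<lambda>p q. sg (fst a * fst b)
          (sg (fst a * word_degree p') (esum f (\<lambda>t. \<phi> (F b p' # F a p # t)) q))) r) v"
    proof (intro usum_cong')
      fix p' r p q assume "set p' \<union> set r = set v" "set p \<union> set q = set r"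
      then have A': "set p' \<subseteq> A" "set p \<subseteq> A" "set q \<subseteq> A" using less.prems(1) by auto
      have "esum f (\<lambda>t. \<phi> (F a p # F b p' # t)) q =
         esum f (\<lambda>t. sg (word_degree (a # p) * word_degree (b # p')) (\<phi> (F b p' # F a p # t))) q"
      proof (rule esum_cong'[OF f A'(3)])
        fix t assume "set t \<subseteq> B"
        then show "\<phi> (F a p # F b p' # t) =
           sg (word_degree (a # p) * word_degree (b # p')) (\<phi> (F b p' # F a p # t))"
          using less.prems(3)[of "[]" t "F a p" "F b p'"] F A' by (auto simp: F_def)
      qed
      then show "sg (word_degree p * word_degree p')
          (sg (fst b * word_degree p) (esum f (\<lambda>t. \<phi> (F a p # F b p' # t)) q)) =
        sg (fst a * fst b) (sg (fst a * word_degree p') (esum f (\<lambda>t. \<phi> (F b p' # F a p # t)) q))"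
        by (auto simp: esum_sg algebra_simps intro!: sg_parity)
    qed
    finally have 2: "usum (\<lambda>p r. sg (fst b * word_degree p) (usum (\<lambda>p' q. esum f (\<lambda>t. \<phi> (F a p # F b p' # t)) q) r)) v
      = sg (fst a * fst b) (usum (\<lambda>p r. sg (fst a * word_degree p) (usum (\<lambda>p' q. esum f (\<lambda>t. \<phi> (F b p # F a p' # t)) q) r)) v)"
      by (simp only: usum_sg)
    show ?thesis
      unfolding Nil append_Nil esum.simps usum.simps sg_add 1 using 2 unfolding F_def by simp
  next
    case (Cons c u')
    show ?thesis unfolding Cons append_Cons esum.simps
    proof (rule usum_symmetric, goal_cases)
      case (1 p q r)
      then have "set (c # p) \<union> set q \<subseteq> A" "set r \<subseteq> A" using less.prems(1) by (auto simp: Cons)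
      from block[OF this] show ?case by simp
    next
      case (2 p q r)
      then have "set (c # r) \<subseteq> A" using less.prems(1) by (auto simp: Cons)
      then have r: "(word_degree (c # r), f (c # r)) \<in> B"
        using maps_wordsD[OF f, of "c # r"] by auto
      show ?case
      proof (rule less.hyps)
        show "length p + length q < length u + length v" using 2 by (simp add: Cons)
        show "set p \<union> set q \<subseteq> A" using less.prems(1) 2 by (auto simp: Cons)
        fix p' q' d x
        assume *: "set p' \<union> set q' \<subseteq> B" "(d, x) \<in> B"
        show "\<phi> ((word_degree (c # r), f (c # r)) # p' @ (d, - x) # q') =
          - \<phi> ((word_degree (c # r), f (c # r)) # p' @ (d, x) # q')"
          using less.prems(2)[of "(word_degree (c # r), f (c # r)) # p'" q' d x] * r by simp
      next
        fix p' q' x y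
        assume *: "set p' \<union> set q' \<subseteq> B" "x \<in> B" "y \<in> B"
        show "\<phi> ((word_degree (c # r), f (c # r)) # p' @ x # y # q') =
          sg (fst x * fst y) (\<phi> ((word_degree (c # r), f (c # r)) # p' @ y # x # q'))"
          using less.prems(3)[of "(word_degree (c # r), f (c # r)) # p'" q' x y] * r by simp
      qed
    qed
  qed
qed

section \<open>Homotopy transfer\<close>

definition letters :: "('a, 'r) graded_space_scheme \<Rightarrow> (int \<times> 'a) set" where
  "letters U = {(i, x). x \<in> homog U i}"

lemma mem_letters [simp]: "(i, x) \<in> letters U \<longleftrightarrow> x \<in> homog U i"
  by (simp add: letters_def)

lemma words_iff: "w \<in> words U \<longleftrightarrow> w \<noteq> [] \<and> set w \<subseteq> letters U"
  by (auto simp: words_def letters_def)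

lemma graded_vector_spaceD:
  assumes "graded_vector_space V"
  shows "vector_space (smul V)" "0 \<in> homog V i"
    "x \<in> homog V i \<Longrightarrow> y \<in> homog V i \<Longrightarrow> x + y \<in> homog V i"
    "x \<in> homog V i \<Longrightarrow> y \<in> homog V i \<Longrightarrow> x - y \<in> homog V i"
    "x \<in> homog V i \<Longrightarrow> - x \<in> homog V i" "x \<in> homog V i \<Longrightarrow> smul V c x \<in> homog V i"
    "x \<in> homog V i \<Longrightarrow> sg k x \<in> homog V i"
    "smul V c (x + y) = smul V c x + smul V c y" "smul V 1 x = x" "smul V c 0 = 0"
    "smul V 0 x = 0" "smul V c (- x) = - smul V c x" "smul V (- 1) x = - x"
    "smul V ((-1) powi k) x = sg k x" "smul V c (sg k x) = sg k (smul V c x)"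
    "smul V c (smul V d x) = smul V (c * d) x" "smul V (c + d) x = smul V c x + smul V d x"
proof -
  interpret V: vector_space "smul V" using assms by (simp add: graded_vector_space_def)
  have s: "V.subspace (homog V i)" for i
    using assms by (simp add: graded_vector_space_def)
  show "vector_space (smul V)" by unfold_locales
  show "0 \<in> homog V i" using V.subspace_0[OF s] .
  show "x \<in> homog V i \<Longrightarrow> y \<in> homog V i \<Longrightarrow> x + y \<in> homog V i" by (rule V.subspace_add[OF s])
  show "x \<in> homog V i \<Longrightarrow> y \<in> homog V i \<Longrightarrow> x - y \<in> homog V i" by (rule V.subspace_diff[OF s])
  show "x \<in> homog V i \<Longrightarrow> smul V c x \<in> homog V i" by (rule V.subspace_scale[OF s])
  show n: "x \<in> homog V i \<Longrightarrow> - x \<in> homog V i" by (rule V.subspace_neg[OF s])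
  then show "x \<in> homog V i \<Longrightarrow> sg k x \<in> homog V i" by (simp add: sg_def)
  show "smul V ((-1) powi k) x = sg k x" 
    by (simp add: sg_def power_int_minus_left V.scale_minus_left V.vector_space_assms(4))
  show "smul V c (sg k x) = sg k (smul V c x)"
    by (simp add: sg_def V.scale_minus_right)
  show "smul V c (x + y) = smul V c x + smul V c y" by (rule V.vector_space_assms)
  show "smul V (c + d) x = smul V c x + smul V d x" by (rule V.vector_space_assms)
  show "smul V 1 x = x" "smul V c (smul V d x) = smul V (c * d) x"
    by (rule V.vector_space_assms)+
  show "smul V (- 1) x = - x"
    by (simp only: V.scale_minus_left V.vector_space_assms(4))
  show "smul V c 0 = 0" "smul V 0 x = 0" "smul V c (- x) = - smul V c x"
    by (rule V.scale_zero_right V.scale_zero_left V.scale_minus_right)+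
qed

lemma graded_linearD:
  assumes "graded_vector_space V" "graded_vector_space W" "graded_linear V W e f"
  shows "x \<in> homog V i \<Longrightarrow> f i x \<in> homog W (i + e)"
    "x \<in> homog V i \<Longrightarrow> y \<in> homog V i \<Longrightarrow> f i (x + y) = f i x + f i y"
    "x \<in> homog V i \<Longrightarrow> f i (smul V c x) = smul W c (f i x)"
    "f i 0 = 0" "x \<in> homog V i \<Longrightarrow> f i (- x) = - f i x"
    "x \<in> homog V i \<Longrightarrow> y \<in> homog V i \<Longrightarrow> f i (x - y) = f i x - f i y"
    "x \<in> homog V i \<Longrightarrow> f i (sg k x) = sg k (f i x)"
    "additive_on (homog V i) (f i)"
proof -
  note V = graded_vector_spaceD[OF assms(1)] and W = graded_vector_spaceD[OF assms(2)]
  show "x \<in> homog V i \<Longrightarrow> f i x \<in> homog W (i + e)"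
    and add: "x \<in> homog V i \<Longrightarrow> y \<in> homog V i \<Longrightarrow> f i (x + y) = f i x + f i y"
    and scale: "x \<in> homog V i \<Longrightarrow> f i (smul V c x) = smul W c (f i x)" for i x y c
    using assms(3) by (auto simp: graded_linear_def)
  show zero: "f i 0 = 0" using scale[OF V(2), of i 0] by (simp add: V W)
  show neg: "x \<in> homog V i \<Longrightarrow> f i (- x) = - f i x" for x i
    using scale[of x i "-1"] by (simp add: V W)
  show diff: "x \<in> homog V i \<Longrightarrow> y \<in> homog V i \<Longrightarrow> f i (x - y) = f i x - f i y" for x y i
    using add[of x i "- y"] neg[of y i] V(5)[of y i] by simp
  show "x \<in> homog V i \<Longrightarrow> f i (sg k x) = sg k (f i x)"
    by (auto simp: sg_def neg)
  show "additive_on (homog V i) (f i)"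
    by (auto simp: additive_on_def diff V)
qed

lemma sym_multilinearD:
  assumes "graded_vector_space U" "graded_vector_space W" "sym_multilinear U W e f"
  shows "maps_words (letters U) (letters W) e f"
    "set p \<union> set q \<subseteq> letters U \<Longrightarrow> x \<in> homog U i \<Longrightarrow> y \<in> homog U i \<Longrightarrow>
       f (p @ (i, smul U c x + y) # q) = smul W c (f (p @ (i, x) # q)) + f (p @ (i, y) # q)"
    "set p \<union> set q \<subseteq> letters U \<Longrightarrow> (i, x) \<in> letters U \<Longrightarrow> f (p @ (i, - x) # q) = - f (p @ (i, x) # q)"
    "set p \<union> set q \<subseteq> letters U \<Longrightarrow> a \<in> letters U \<Longrightarrow> b \<in> letters U \<Longrightarrow>
       f (p @ a # b # q) = sg (fst a * fst b) (f (p @ b # a # q))"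
    "head_additive (letters U) f"
proof -
  note U = graded_vector_spaceD[OF assms(1)] and W = graded_vector_spaceD[OF assms(2)]
  show "maps_words (letters U) (letters W) e f"
    using assms(3) by (auto simp: sym_multilinear_def maps_words_def words_iff)
  note clauses = assms(3)[unfolded sym_multilinear_def, THEN conjunct2]
  have add: "set p \<union> set q \<subseteq> letters U \<Longrightarrow> x \<in> homog U i \<Longrightarrow> y \<in> homog U i \<Longrightarrow>
       f (p @ (i, x + y) # q) = f (p @ (i, x) # q) + f (p @ (i, y) # q)" for p q i x y
    by (rule clauses[THEN conjunct1, rule_format]) (auto simp: words_iff)
  have scale: "set p \<union> set q \<subseteq> letters U \<Longrightarrow> x \<in> homog U i \<Longrightarrow>
       f (p @ (i, smul U c x) # q) = smul W c (f (p @ (i, x) # q))" for p q i x c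
    by (rule clauses[THEN conjunct2, THEN conjunct1, rule_format]) (auto simp: words_iff)
  have sym: "set p \<union> set q \<subseteq> letters U \<Longrightarrow> (i, x) \<in> letters U \<Longrightarrow> (j, y) \<in> letters U \<Longrightarrow>
       f (p @ (i, x) # (j, y) # q) = smul W ((-1) powi (i * j)) (f (p @ (j, y) # (i, x) # q))" for p q i x j y
    by (rule clauses[THEN conjunct2, THEN conjunct2, rule_format]) (auto simp: words_iff)
  show "set p \<union> set q \<subseteq> letters U \<Longrightarrow> x \<in> homog U i \<Longrightarrow> y \<in> homog U i \<Longrightarrow>
       f (p @ (i, smul U c x + y) # q) = smul W c (f (p @ (i, x) # q)) + f (p @ (i, y) # q)"
    by (simp add: add scale U)
  show neg: "set p \<union> set q \<subseteq> letters U \<Longrightarrow> (i, x) \<in> letters U \<Longrightarrow>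
      f (p @ (i, - x) # q) = - f (p @ (i, x) # q)" for p q i x
    using scale[of p q x i "-1"] by (simp add: U W)
  show "set p \<union> set q \<subseteq> letters U \<Longrightarrow> a \<in> letters U \<Longrightarrow> b \<in> letters U \<Longrightarrow>
       f (p @ a # b # q) = sg (fst a * fst b) (f (p @ b # a # q))"
    using sym[of p q "fst a" "snd a" "fst b" "snd b"] by (simp add: W(14))
  show "head_additive (letters U) f"
    unfolding head_additive_def additive_on_def
  proof (safe; simp add: U)
    fix d t x y
    assume "set t \<subseteq> letters U" "x \<in> homog U d" "y \<in> homog U d"
    then show "f ((d, x - y) # t) = f ((d, x) # t) - f ((d, y) # t)"
      using add[of "[]" t x d "- y"] neg[of "[]" t d y] by (simp add: U)
  qed
qed

lemma sym_multilinearI: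
  assumes "graded_vector_space U" "graded_vector_space W"
    and deg: "\<And>w. w \<in> words U \<Longrightarrow> f w \<in> homog W (word_degree w + e)"
    and lin: "\<And>p q i x y c. set p \<union> set q \<subseteq> letters U \<Longrightarrow> x \<in> homog U i \<Longrightarrow> y \<in> homog U i \<Longrightarrow>
       f (p @ (i, smul U c x + y) # q) = smul W c (f (p @ (i, x) # q)) + f (p @ (i, y) # q)"
    and sym: "\<And>p q a b. set p \<union> set q \<subseteq> letters U \<Longrightarrow> a \<in> letters U \<Longrightarrow> b \<in> letters U \<Longrightarrow>
       f (p @ a # b # q) = sg (fst a * fst b) (f (p @ b # a # q))"
  shows "sym_multilinear U W e f"
proof -
  note U = graded_vector_spaceD[OF assms(1)] and W = graded_vector_spaceD[OF assms(2)]
  \<comment> \<open>With zero entries and \<open>c = -1\<close> the linearity clause gives the value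
    minus itself.\<close>
  have zero: "f (p @ (i, 0) # q) = 0" if "set p \<union> set q \<subseteq> letters U" for p q i
    using lin[OF that U(2)[of i] U(2)[of i], of "-1"] by (simp add: U W)
  show ?thesis unfolding sym_multilinear_def
  proof (intro conjI allI impI ballI)
    fix u v i x y assume "u @ (i, x) # v \<in> words U \<and> y \<in> homog U i"
    then show "f (u @ (i, x + y) # v) = f (u @ (i, x) # v) + f (u @ (i, y) # v)"
      using lin[of u v x i y 1] by (simp add: words_iff U W)
  next
    fix u v i x c assume "u @ (i, x) # v \<in> words U"
    then show "f (u @ (i, smul U c x) # v) = smul W c (f (u @ (i, x) # v))"
      using lin[of u v x i 0 c] zero[of u v i] by (simp add: words_iff U)
  next
    fix u v i x j y assume "u @ (i, x) # (j, y) # v \<in> words U"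
    then show "f (u @ (i, x) # (j, y) # v) = smul W ((-1) powi (i * j)) (f (u @ (j, y) # (i, x) # v))"
      using sym[of u v "(i, x)" "(j, y)"] by (simp add: words_iff W)
  qed (rule deg)
qed

lemma graded_linear_linear_part:
  assumes "sym_multilinear U W e f"
  shows "graded_linear U W e (linear_part f)"
  unfolding graded_linear_def linear_part_def
proof (intro allI ballI conjI)
  note clauses = assms[unfolded sym_multilinear_def]
  fix i x assume x: "x \<in> homog U i"
  show "f [(i, x)] \<in> homog W (i + e)"
    using clauses[THEN conjunct1, rule_format, of "[(i, x)]"] x by (simp add: words_iff)
  show "f [(i, x + y)] = f [(i, x)] + f [(i, y)]" if "y \<in> homog U i" for y
    using clauses[THEN conjunct2, THEN conjunct1, rule_format, of "[]" i x "[]" y] x that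
    by (simp add: words_iff)
  show "f [(i, smul U c x)] = smul W c (f [(i, x)])" for c
    using clauses[THEN conjunct2, THEN conjunct2, THEN conjunct1, rule_format, of "[]" i x "[]" c] x
    by (simp add: words_iff)
qed

lemma additive_on_id: "graded_vector_space V \<Longrightarrow> additive_on (homog V i) (\<lambda>x. x)"
  by (simp add: additive_on_def graded_vector_spaceD)

lemma sym_multilinear_esum:
  assumes gvs: "graded_vector_space U" "graded_vector_space W" "graded_vector_space X"
    and f: "sym_multilinear U W 0 f" and \<phi>: "sym_multilinear W X e \<phi>"
  shows "sym_multilinear U X e (esum f \<phi>)"
proof (rule sym_multilinearI[OF gvs(1,3)])
  note U = graded_vector_spaceD[OF gvs(1)] and W = graded_vector_spaceD[OF gvs(2)]
    and X = graded_vector_spaceD[OF gvs(3)]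
  note f = sym_multilinearD[OF gvs(1,2) f] and \<phi> = sym_multilinearD[OF gvs(2,3) \<phi>]
  show "esum f \<phi> w \<in> homog X (word_degree w + e)" if "w \<in> words U" for w
  proof (rule esum_mem[OF f(1) _ additive_on_id[OF gvs(3)]])
    show "set w \<subseteq> letters U" using that by (simp add: words_iff)
    show "\<phi> t \<in> homog X (word_degree w + e)"
      if "set t \<subseteq> letters W" "word_degree t = word_degree w" "t = [] \<longleftrightarrow> w = []" for t
      using maps_wordsD[OF \<phi>(1) _ that(1)] that \<open>w \<in> words U\<close> by (auto simp: words_iff)
  qed
  show "esum f \<phi> (p @ (i, smul U c x + y) # q) = smul X c (esum f \<phi> (p @ (i, x) # q)) + esum f \<phi> (p @ (i, y) # q)"
    if "set p \<union> set q \<subseteq> letters U" "x \<in> homog U i" "y \<in> homog U i" for p q i x y c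
  proof (rule esum_linear_letter[where TW="smul W c", OF _ _ _ _ _ _ f(1)])
    show "f (p @ (i, smul U c x + y) # q) = smul W c (f (p @ (i, x) # q)) + f (p @ (i, y) # q)"
      if "set p \<union> set q \<subseteq> letters U" for p q
      by (rule f(2)) fact+
    show "\<phi> (p @ (d, smul W c x + y) # q) = smul X c (\<phi> (p @ (d, x) # q)) + \<phi> (p @ (d, y) # q)"
      if "set p \<union> set q \<subseteq> letters W" "(d, x) \<in> letters W" "(d, y) \<in> letters W" for p q d x y
      by (rule \<phi>(2)) (use that in auto)
  qed (use that in \<open>auto simp: U X\<close>)
  show "esum f \<phi> (p @ a # b # q) = sg (fst a * fst b) (esum f \<phi> (p @ b # a # q))"
    if "set p \<union> set q \<subseteq> letters U" "a \<in> letters U" "b \<in> letters U" for p q a b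
    by (rule esum_symmetric[OF that(2,3) f(1) f(4)[OF _ that(2,3)] \<phi>(3,4) that(1)])
qed

lemma sym_multilinear_comp:
  assumes gvs: "graded_vector_space U" "graded_vector_space W" "graded_vector_space X"
    and K: "graded_linear W X e' K" and \<phi>: "sym_multilinear U W e \<phi>"
  shows "sym_multilinear U X (e + e') (\<lambda>w. K (word_degree w + e) (\<phi> w))"
proof (rule sym_multilinearI[OF gvs(1,3)])
  note U = graded_vector_spaceD[OF gvs(1)] and W = graded_vector_spaceD[OF gvs(2)]
  note \<phi> = sym_multilinearD[OF gvs(1,2) \<phi>] and K = graded_linearD[OF gvs(2,3) K]
  have mem: "\<phi> w \<in> homog W (word_degree w + e)" if "w \<noteq> []" "set w \<subseteq> letters U" for w
    using maps_wordsD[OF \<phi>(1) that] by simp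
  show "K (word_degree w + e) (\<phi> w) \<in> homog X (word_degree w + (e + e'))" if "w \<in> words U" for w
    using K(1)[OF mem[of w]] that by (simp add: words_iff add_ac)
  show "K (word_degree (p @ (i, smul U c x + y) # q) + e) (\<phi> (p @ (i, smul U c x + y) # q))
     = smul X c (K (word_degree (p @ (i, x) # q) + e) (\<phi> (p @ (i, x) # q)))
       + K (word_degree (p @ (i, y) # q) + e) (\<phi> (p @ (i, y) # q))"
    if pq: "set p \<union> set q \<subseteq> letters U" and xy: "x \<in> homog U i" "y \<in> homog U i" for p q i x y c
  proof -
    have "\<phi> (p @ (i, x) # q) \<in> homog W (word_degree (p @ (i, x) # q) + e)"
      "\<phi> (p @ (i, y) # q) \<in> homog W (word_degree (p @ (i, x) # q) + e)"
      using mem[of "p @ (i, x) # q"] mem[of "p @ (i, y) # q"] pq xy by auto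
    then show ?thesis using \<phi>(2)[OF pq xy] by (simp add: K W)
  qed
  show "K (word_degree (p @ a # b # q) + e) (\<phi> (p @ a # b # q)) =
      sg (fst a * fst b) (K (word_degree (p @ b # a # q) + e) (\<phi> (p @ b # a # q)))"
    if pq: "set p \<union> set q \<subseteq> letters U" and ab: "a \<in> letters U" "b \<in> letters U" for p q a b
    using \<phi>(4)[OF pq ab] mem[of "p @ b # a # q"] pq ab by (simp add: K add_ac)
qed

text \<open>Every clause of \<open>sym_multilinear\<close> compares words of equal length only, so a
  family of such maps can be glued along the length.\<close>

lemma sym_multilinear_by_length:
  assumes "\<And>n. sym_multilinear U W e (f n)"
  shows "sym_multilinear U W e (\<lambda>w. f (length w) w)"
  using assms unfolding sym_multilinear_def by simp

lemma sym_multilinear_zero: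
  "graded_vector_space W \<Longrightarrow> sym_multilinear U W e (\<lambda>w. 0)"
  by (simp add: sym_multilinear_def graded_vector_spaceD)

lemma sym_multilinear_linear_part:
  assumes gvs: "graded_vector_space U" "graded_vector_space W"
    and g: "graded_linear U W e g" and f: "sym_multilinear U W e f"
  shows "sym_multilinear U W e (\<lambda>w. if length w = 1 then g (fst (hd w)) (snd (hd w)) else f w)"
proof (rule sym_multilinearI[OF gvs])
  note U = graded_vector_spaceD[OF gvs(1)]
  note f = sym_multilinearD[OF gvs f] and g = graded_linearD[OF gvs g]
  show "(if length w = 1 then g (fst (hd w)) (snd (hd w)) else f w) \<in> homog W (word_degree w + e)"
    if "w \<in> words U" for w
    using that maps_wordsD[OF f(1), of w] g(1) by (auto simp: words_iff length_Suc_conv)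
  show "(if length (p @ (i, smul U c x + y) # q) = 1
        then g (fst (hd (p @ (i, smul U c x + y) # q))) (snd (hd (p @ (i, smul U c x + y) # q)))
        else f (p @ (i, smul U c x + y) # q)) =
      smul W c (if length (p @ (i, x) # q) = 1
        then g (fst (hd (p @ (i, x) # q))) (snd (hd (p @ (i, x) # q))) else f (p @ (i, x) # q)) +
      (if length (p @ (i, y) # q) = 1
        then g (fst (hd (p @ (i, y) # q))) (snd (hd (p @ (i, y) # q))) else f (p @ (i, y) # q))"
    if "set p \<union> set q \<subseteq> letters U" "x \<in> homog U i" "y \<in> homog U i" for p q i x y c
    using that f(2)[OF that] by (simp add: g U)
  show "(if length (p @ a # b # q) = 1 then g (fst (hd (p @ a # b # q))) (snd (hd (p @ a # b # q)))
        else f (p @ a # b # q)) =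
      sg (fst a * fst b) (if length (p @ b # a # q) = 1
        then g (fst (hd (p @ b # a # q))) (snd (hd (p @ b # a # q))) else f (p @ b # a # q))"
    if "set p \<union> set q \<subseteq> letters U" "a \<in> letters U" "b \<in> letters U" for p q a b
    using f(4)[OF that] by simp
qed

text \<open>A single block covering all of \<open>w\<close> contributes a one-letter word, which
  \<open>\<phi>\<close> kills; all other blocks are shorter than \<open>w\<close>. This makes the
  recursion for the transferred morphism well founded.\<close>

lemma esum_cong_fun':
  fixes f f' :: "'a gword \<Rightarrow> 'b"
  assumes \<phi>: "\<And>y. \<phi> [y] = 0" and f: "\<And>u. u \<noteq> [] \<Longrightarrow> length u < length w \<Longrightarrow> f u = f' u"
  shows "esum f \<phi> w = esum f' \<phi> w"
proof (cases w)
  case (Cons a w')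
  show ?thesis unfolding Cons esum.simps
  proof (intro usum_cong refl)
    fix u v :: "'a gword" assume uv: "length u + length v = length w'"
    show "esum f (\<lambda>t. \<phi> ((word_degree (a # u), f (a # u)) # t)) v =
       esum f' (\<lambda>t. \<phi> ((word_degree (a # u), f' (a # u)) # t)) v"
    proof (cases "v = []")
      case False
      then have "f (a # u) = f' (a # u)" using uv by (intro f) (cases v; auto simp: Cons)+
      moreover have "esum f (\<lambda>t. \<phi> ((word_degree (a # u), f (a # u)) # t)) v =
       esum f' (\<lambda>t. \<phi> ((word_degree (a # u), f (a # u)) # t)) v"
        using uv by (intro esum_cong_fun f) (auto simp: Cons)
      ultimately show ?thesis by simp
    qed (simp add: \<phi>)
  qed
qed simp

text \<open>Degrees are those after the shift, so \<open>q\<close> has degree one in every arity,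
  and on one-letter words it is the differential of \<open>W\<close>. The condition that the
  coderivation squares to zero is stated through its corestriction \<open>cod q q\<close>.\<close>

locale homotopy_transfer =
  fixes U :: "('a::ab_group_add, 'r) graded_space_scheme"
    and W :: "('b::ab_group_add, 's) graded_space_scheme"
    and q :: "'b gword \<Rightarrow> 'b"
    and \<delta> :: "int \<Rightarrow> 'a \<Rightarrow> 'a" and \<iota> :: "int \<Rightarrow> 'a \<Rightarrow> 'b" and \<pi> :: "int \<Rightarrow> 'b \<Rightarrow> 'a"
    and K :: "int \<Rightarrow> 'b \<Rightarrow> 'b"
  assumes gvs: "graded_vector_space U" "graded_vector_space W"
    and q: "sym_multilinear W W 1 q"
    and q_square: "\<And>w. w \<in> words W \<Longrightarrow> cod q q w = 0"
    and \<delta>: "graded_linear U U 1 \<delta>" and \<iota>: "graded_linear U W 0 \<iota>"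
    and \<pi>: "graded_linear W U 0 \<pi>" and K: "graded_linear W W (-1) K"
    and \<delta>\<delta>: "\<And>i x. x \<in> homog U i \<Longrightarrow> \<delta> (i + 1) (\<delta> i x) = 0"
    and \<iota>_chain: "\<And>i x. x \<in> homog U i \<Longrightarrow> q [(i, \<iota> i x)] = \<iota> (i + 1) (\<delta> i x)"
    and \<pi>_chain: "\<And>i y. y \<in> homog W i \<Longrightarrow> \<pi> (i + 1) (q [(i, y)]) = \<delta> i (\<pi> i y)"
    and homotopy: "\<And>i y. y \<in> homog W i \<Longrightarrow>
      q [(i - 1, K i y)] + K (i + 1) (q [(i, y)]) = \<iota> i (\<pi> i y) - y"
begin

definition q2 :: "'b gword \<Rightarrow> 'b" where
  "q2 t = (if length t \<ge> 2 then q t else 0)"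

text \<open>
  \<open>approx n\<close> computes the transferred morphism \<open>f = \<iota> + K (q\<^sub>2 + q\<^sub>3 + \<dots>) f\<close> on words of
  length at most \<open>n\<close>.
\<close>

primrec approx :: "nat \<Rightarrow> 'a gword \<Rightarrow> 'b" where
  "approx 0 = (\<lambda>w. 0)"
| "approx (Suc n) = (\<lambda>w. if length w = 1 then \<iota> (fst (hd w)) (snd (hd w))
     else K (word_degree w + 1) (esum (approx n) q2 w))"

definition f :: "'a gword \<Rightarrow> 'b" where
  "f w = approx (length w) w"

definition B :: "'a gword \<Rightarrow> 'b" where
  "B = esum f q2"

definition p :: "'a gword \<Rightarrow> 'a" where
  "p w = (if length w = 1 then \<delta> (fst (hd w)) (snd (hd w)) else \<pi> (word_degree w + 1) (B w))"

lemma q2: "sym_multilinear W W 1 q2"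
proof -
  let ?q = "\<lambda>n::nat. if n \<ge> 2 then q else (\<lambda>w. 0)"
  have "sym_multilinear W W 1 (?q n)" for n
    by (cases "n \<ge> 2") (simp_all add: q sym_multilinear_zero[OF gvs(2)])
  then have "sym_multilinear W W 1 (\<lambda>t. ?q (length t) t)"
    by (rule sym_multilinear_by_length)
  moreover have "q2 = (\<lambda>t. ?q (length t) t)"
    by (rule ext) (simp add: q2_def)
  ultimately show ?thesis by (simp only:)
qed

lemma approx: "sym_multilinear U W 0 (approx n)"
proof (induction n)
  case (Suc n)
  show ?case
    using sym_multilinear_linear_part[OF gvs \<iota> sym_multilinear_comp[OF gvs(1) gvs(2) gvs(2) K
        sym_multilinear_esum[OF gvs(1) gvs(2) gvs(2) Suc q2], simplified]]
    by simp
qed (simp add: sym_multilinear_zero gvs)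

text \<open>The higher operations call the approximation on proper sub-words only, where by
  induction it has already stabilised.\<close>

lemma approx_eq_f: "w \<noteq> [] \<Longrightarrow> length w \<le> n \<Longrightarrow> approx n w = f w"
proof (induction "length w" arbitrary: n w rule: less_induct)
  case less
  obtain m where n: "n = Suc m" using less.prems by (cases n) auto
  obtain k where k: "length w = Suc k" using less.prems by (cases w) auto
  have "esum (approx m) q2 w = esum (approx k) q2 w"
    using less n k by (intro esum_cong_fun') (simp_all add: q2_def)
  then show ?case by (simp add: f_def n k)
qed

lemma f_single: "f [(i, x)] = \<iota> i x"
  by (simp add: f_def)

lemma f_long: "length w \<ge> 2 \<Longrightarrow> f w = K (word_degree w + 1) (B w)"
proof -
  assume w: "length w \<ge> 2"
  then obtain k where k: "length w = Suc k" by (cases "length w") auto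
  have "esum (approx k) q2 w = esum f q2 w"
    using k by (intro esum_cong_fun') (simp_all add: q2_def approx_eq_f)
  then show ?thesis using w by (simp add: f_def k B_def)
qed

lemma f: "sym_multilinear U W 0 f"
  unfolding f_def using approx by (rule sym_multilinear_by_length)

lemma B: "sym_multilinear U W 1 B"
  unfolding B_def by (rule sym_multilinear_esum[OF gvs gvs(2) f q2])

lemma p: "sym_multilinear U U 1 p"
  unfolding p_def
  using sym_multilinear_linear_part[OF gvs(1) gvs(1) \<delta> sym_multilinear_comp[OF gvs gvs(1) \<pi> B, simplified]] .

lemma B_single: "B [a] = 0"
  by (simp add: B_def q2_def)

lemma p_single: "p [(i, x)] = \<delta> i x"
  by (simp add: p_def)

lemma p_long: "length w \<ge> 2 \<Longrightarrow> p w = \<pi> (word_degree w + 1) (B w)"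
  by (simp add: p_def)

lemmas q_props = sym_multilinearD[OF gvs(2) gvs(2) q]
  and q2_props = sym_multilinearD[OF gvs(2) gvs(2) q2]
  and f_props = sym_multilinearD[OF gvs f]
  and B_props = sym_multilinearD[OF gvs B]
  and p_props = sym_multilinearD[OF gvs(1) gvs(1) p]

lemma q_linear: "graded_linear W W 1 (\<lambda>i x. q [(i, x)])"
  using graded_linear_linear_part[OF q] unfolding linear_part_def .

lemmas q_lin = graded_linearD[OF gvs(2) gvs(2) q_linear]

lemma B_mem: "w \<in> words U \<Longrightarrow> B w \<in> homog W (word_degree w + 1)"
  using maps_wordsD[OF B_props(1)] by (simp add: words_iff)

lemma qq: "y \<in> homog W i \<Longrightarrow> q [(i + 1, q [(i, y)])] = 0"
  using q_square[of "[(i, y)]"] by (simp add: words_iff cod_def)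

text \<open>Sorting \<open>q F\<close> by the number of blocks: one block gives the differential of
  \<open>f\<close>, two or more give \<open>B\<close>.\<close>

lemma esum_q:
  assumes "w \<in> words U"
  shows "esum f q w = q [(word_degree w, f w)] + B w"
proof -
  have "esum f q w = esum f (\<lambda>t. (if length t = 1 then q t else 0) + q2 t) w"
    by (rule esum_cong'[OF f_props(1)])
      (use assms in \<open>auto simp: words_iff q2_def Suc_le_eq numeral_2_eq_2 length_Suc_conv neq_Nil_conv\<close>)
  also have "\<dots> = q [(word_degree w, f w)] + B w"
    unfolding esum_add B_def using assms by (subst esum_singleton) (simp_all add: words_iff)
  finally show ?thesis .
qed

text \<open>In the expansions \<open>cod_esum\<close> and \<open>esum_cod\<close> the sub-word
  \<open>z\<close> is all of \<open>w\<close> only if \<open>y\<close> is empty, and then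
  \<open>\<phi>\<close> meets a one-letter word. The disjunction lets one lemma serve both the
  induction step, where \<open>q2\<close> kills such words, and the final statement for other
  \<open>\<phi>\<close>.\<close>

lemma transfer_esum:
  assumes w: "w \<in> words U" and \<phi>: "head_additive (letters W) \<phi>"
    and f: "\<And>z y. z \<in> words U \<Longrightarrow> length z + length y = length w \<Longrightarrow> set y \<subseteq> letters U \<Longrightarrow>
      cod p f z = esum f q z \<or> y = [] \<and> (\<forall>x. \<phi> [x] = 0)"
  shows "cod p (esum f \<phi>) w = esum f (cod q \<phi>) w"
proof -
  have w': "set w \<subseteq> letters U" using w by (simp add: words_iff)
  have "cod p (esum f \<phi>) w =
      usum (\<lambda>z y. esum f (\<lambda>t. \<phi> ((word_degree z + 1, cod p f z) # t)) y) w"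
    by (rule cod_esum[OF f_props(1) p_props(1) \<phi> w'])
  also have "\<dots> = usum (\<lambda>z y. if z = [] then 0
      else esum f (\<lambda>t. \<phi> ((word_degree z + 1, esum f q z) # t)) y) w"
  proof (rule usum_cong')
    fix z y assume zy: "length z + length y = length w" "set z \<union> set y = set w"
    show "esum f (\<lambda>t. \<phi> ((word_degree z + 1, cod p f z) # t)) y =
      (if z = [] then 0 else esum f (\<lambda>t. \<phi> ((word_degree z + 1, esum f q z) # t)) y)"
    proof (cases "z = []")
      case True
      have "set y \<subseteq> letters U" using zy w' by auto
      from additive_onD(2)[OF head_additive_esum[OF f_props(1) this \<phi>], of "word_degree z + 1"]
      show ?thesis using True by (simp add: cod_def)
    next
      case False
      then have "z \<in> words U" using zy w' by (auto simp: words_iff)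
      moreover have "set y \<subseteq> letters U" using zy(2) w' by blast
      ultimately show ?thesis using f[of z y] zy(1) False by auto
    qed
  qed
  also have "\<dots> = esum f (cod q \<phi>) w"
    by (rule esum_cod[OF f_props(1) q_props(1) \<phi> w', symmetric])
  finally show ?thesis .
qed

text \<open>Split \<open>Q Q = 0\<close> by whether the outer operation is the differential: the
  higher operations after \<open>Q\<close> equal minus the differential of \<open>q\<close>. Along
  the coalgebra morphism this becomes minus the differential of \<open>q F\<close>, whose one-block
  part dies because the differential squares to zero.\<close>

lemma esum_cod_q2:
  assumes "w \<in> words U"
  shows "esum f (cod q q2) w = - q [(word_degree w + 1, B w)]"
proof -
  have w': "set w \<subseteq> letters U" "w \<noteq> []" using assms by (auto simp: words_iff)
  have "esum f (cod q q2) w = esum f (\<lambda>t. - q [(word_degree w + 1, q t)]) w"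
  proof (rule esum_cong'[OF f_props(1) w'(1)])
    fix t assume t: "set t \<subseteq> letters W" "word_degree t = word_degree w" "t = [] \<longleftrightarrow> w = []"
    have "0 = cod q q t"
      using t w' by (intro q_square[symmetric]) (simp add: words_iff)
    also have "\<dots> = usum (\<lambda>u v. (if u = [] then 0 else q2 ((word_degree u + 1, q u) # v))
        + (if v = [] then if u = [] then 0 else q [(word_degree u + 1, q u)] else 0)) t"
      unfolding cod_def by (intro usum_cong refl) (auto simp: q2_def Suc_le_eq numeral_2_eq_2)
    also have "\<dots> = cod q q2 t + q [(word_degree w + 1, q t)]"
      using t w' unfolding usum_add cod_def by (simp add: usum_right_unit)
    finally show "cod q q2 t = - q [(word_degree w + 1, q t)]"
      by (simp add: eq_neg_iff_add_eq_0)
  qed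
  also have "\<dots> = - q [(word_degree w + 1, esum f q w)]"
  proof (rule esum_pull[OF f_props(1) w'(1), where S="homog W (word_degree w + 1)" and
        H="\<lambda>y. - q [(word_degree w + 1, y)]", symmetric])
    show "additive_on (homog W (word_degree w + 1)) (\<lambda>y. - q [(word_degree w + 1, y)])"
      using q_lin(8) by (simp add: additive_on_def)
    show "q t \<in> homog W (word_degree w + 1)"
      if "set t \<subseteq> letters W" "word_degree t = word_degree w" "t = [] \<longleftrightarrow> w = []" for t
      using maps_wordsD[OF q_props(1) _ that(1)] that(2,3) w'(2) by simp
  qed
  also have "\<dots> = - q [(word_degree w + 1, B w)]"
    using maps_wordsD[OF f_props(1) w'(2,1)] B_mem[OF assms]
    by (simp add: esum_q[OF assms] q_lin qq)
  finally show ?thesis .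
qed

text \<open>Only the distribution with empty remainder produces a one-letter word. Separating it is
  useful because \<open>p\<close> and \<open>f\<close> are given by different formulas on single
  letters and on longer words.\<close>

lemma cod_split_single:
  "cod p \<phi> w = (if w = [] then 0 else \<phi> [(word_degree w + 1, p w)]) +
     cod p (\<lambda>t. if length t \<ge> 2 then \<phi> t else 0) w"
proof -
  have "cod p \<phi> w = usum (\<lambda>u v. (if v = [] then if u = [] then 0 else \<phi> [(word_degree u + 1, p u)] else 0)
      + (if u = [] then 0 else if length ((word_degree u + 1, p u) # v) \<ge> 2
           then \<phi> ((word_degree u + 1, p u) # v) else 0)) w"
    unfolding cod_def by (intro usum_cong refl) (auto simp: Suc_le_eq numeral_2_eq_2)
  then show ?thesis
    unfolding usum_add cod_def usum_right_unit by simp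
qed

lemma cod_pull:
  assumes "additive_on S H" "w \<in> words U"
    and "\<And>t. t \<in> words U \<Longrightarrow> word_degree t = word_degree w + 1 \<Longrightarrow> \<phi> t \<in> S"
  shows "cod p \<phi> w \<in> S \<and> cod p (\<lambda>t. H (\<phi> t)) w = H (cod p \<phi> w)"
proof -
  have "(if u = [] then 0 else \<phi> ((word_degree u + 1, p u) # v)) \<in> S"
    if uv: "word_degree u + word_degree v = word_degree w" "set u \<union> set v = set w" for u v
    using assms(3)[of "(word_degree u + 1, p u) # v"] uv maps_wordsD[OF p_props(1), of u] assms(1,2)
    by (auto simp: words_iff additive_onD)
  then have "cod p \<phi> w \<in> S \<and> H (cod p \<phi> w) =
      usum (\<lambda>u v. H (if u = [] then 0 else \<phi> ((word_degree u + 1, p u) # v))) w"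
    unfolding cod_def by (intro usum_pull'[OF assms(1)])
  moreover have "usum (\<lambda>u v. H (if u = [] then 0 else \<phi> ((word_degree u + 1, p u) # v))) w
      = cod p (\<lambda>t. H (\<phi> t)) w"
    unfolding cod_def by (intro usum_cong refl) (simp add: additive_onD[OF assms(1)])
  ultimately show ?thesis by simp
qed

lemma cod_B:
  assumes w: "w \<in> words U"
    and f: "\<And>z. z \<in> words U \<Longrightarrow> length z < length w \<Longrightarrow> cod p f z = esum f q z"
  shows "cod p B w = - q [(word_degree w + 1, B w)]"
proof -
  have "cod p B w = esum f (cod q q2) w"
    unfolding B_def
  proof (rule transfer_esum[OF w q2_props(5)])
    fix z y assume "z \<in> words U" "length z + length y = length w"
    then show "cod p f z = esum f q z \<or> y = [] \<and> (\<forall>x. q2 [x] = 0)"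
      using f[of z] by (cases y) (auto simp: q2_def)
  qed
  then show ?thesis using esum_cod_q2[OF w] by simp
qed

lemma words_cases:
  assumes "w \<in> words U"
  obtains i x where "w = [(i, x)]" "x \<in> homog U i" | "length w \<ge> 2"
  using assms by (cases w rule: list.exhaust; cases "tl w") (auto simp: words_iff)

text \<open>On words of at least two letters both \<open>f\<close> and \<open>p\<close> are a linear
  map after \<open>B\<close>, namely \<open>K\<close> or \<open>\<pi>\<close>. Hence
  \<open>B P = - q\<^sub>1 B\<close> yields all of the composite with \<open>P\<close> except the
  contribution of one-letter words.\<close>

lemma cod_p_B_eq:
  assumes w: "w \<in> words U" "length w \<ge> 2"
    and f: "\<And>z. z \<in> words U \<Longrightarrow> length z < length w \<Longrightarrow> cod p f z = esum f q z"
    and H: "graded_linear W (X :: ('c::ab_group_add, 't) graded_space_scheme) e H"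
    and X: "graded_vector_space X"
    and \<phi>: "\<And>t. length t \<ge> 2 \<Longrightarrow> \<phi> t = H (word_degree t + 1) (B t)"
  shows "cod p \<phi> w = \<phi> [(word_degree w + 1, p w)]
    - H (word_degree w + 2) (q [(word_degree w + 1, B w)])"
proof -
  note H = graded_linearD[OF gvs(2) X H]
  have w': "w \<noteq> []" using w by auto
  have "cod p (\<lambda>t. if length t \<ge> 2 then \<phi> t else 0) w =
     cod p (\<lambda>t. H (word_degree w + 2) (B t)) w"
    unfolding cod_def
  proof (rule usum_cong')
    fix u v :: "'a gword" assume uv: "word_degree u + word_degree v = word_degree w"
    show "(if u = [] then 0 else if 2 \<le> length ((word_degree u + 1, p u) # v)
        then \<phi> ((word_degree u + 1, p u) # v) else 0) =
      (if u = [] then 0 else H (word_degree w + 2) (B ((word_degree u + 1, p u) # v)))"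
    proof (cases "v = []")
      case False
      then have "length ((word_degree u + 1, p u) # v) \<ge> 2" by (cases v) auto
      moreover have "word_degree ((word_degree u + 1, p u) # v) + 1 = word_degree w + 2"
        using uv by simp
      ultimately show ?thesis using \<phi>[of "(word_degree u + 1, p u) # v"]
        by (simp add: add.commute)
    qed (simp add: B_single H)
  qed
  also have "\<dots> = H (word_degree w + 2) (cod p B w)"
    using cod_pull[OF H(8) w(1), of B "word_degree w + 2"] B_mem by (metis add.assoc one_add_one)
  also have "\<dots> = - H (word_degree w + 2) (q [(word_degree w + 1, B w)])"
    using cod_B[OF w(1) f] H(5)[OF q_lin(1)[OF B_mem[OF w(1)]]] by (simp add: add_ac)
  finally show ?thesis
    using w' by (subst cod_split_single) simp
qed

theorem cod_p_f: "w \<in> words U \<Longrightarrow> cod p f w = esum f q w"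
proof (induction "length w" arbitrary: w rule: less_induct)
  case less
  show ?case using less.prems
  proof (cases rule: words_cases)
    case (1 i x)
    then show ?thesis by (simp add: cod_def p_single f_single \<iota>_chain)
  next
    case 2
    let ?d = "word_degree w + 1"
    have "cod p f w = f [(?d, p w)] - K (word_degree w + 2) (q [(?d, B w)])"
      by (rule cod_p_B_eq[OF less.prems 2 less.hyps K gvs(2) f_long])
    also have "f [(?d, p w)] = \<iota> ?d (\<pi> ?d (B w))"
      using 2 by (simp add: f_single p_long)
    \<comment> \<open>The homotopy identity for \<open>B w\<close> replaces
      \<open>\<iota> \<pi> B w\<close>. Its term with \<open>K\<close> outside cancels the term
      coming from \<open>B P\<close>; what remains is the differential of
      \<open>K (B w) = f w\<close> plus \<open>B w\<close>, which is \<open>q F\<close>.\<close>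
    also have "\<dots> = q [(word_degree w, K ?d (B w))] + K (word_degree w + 2) (q [(?d, B w)]) + B w"
      using homotopy[OF B_mem[OF less.prems]] by (simp add: add.assoc)
    also have "\<dots> - K (word_degree w + 2) (q [(?d, B w)]) = esum f q w"
      using 2 by (simp add: esum_q[OF less.prems] f_long)
    finally show ?thesis .
  qed
qed

theorem cod_p_p: "w \<in> words U \<Longrightarrow> cod p p w = 0"
proof (cases rule: words_cases, assumption)
  fix i x assume "w \<in> words U" "w = [(i, x)]" "x \<in> homog U i"
  then show ?thesis by (simp add: cod_def p_single \<delta>\<delta>)
next
  assume w: "w \<in> words U" "length w \<ge> 2"
  let ?d = "word_degree w + 1"
  have "cod p p w = p [(?d, p w)] - \<pi> (word_degree w + 2) (q [(?d, B w)])"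
    by (rule cod_p_B_eq[OF w cod_p_f \<pi> gvs(1) p_long])
  also have "p [(?d, p w)] = \<delta> ?d (\<pi> ?d (B w))"
    using w(2) by (simp add: p_single p_long)
  \<comment> \<open>Since \<open>\<pi>\<close> is a chain map, the one-letter contribution cancels
    the contribution of longer words.\<close>
  also have "\<dots> = \<pi> (word_degree w + 2) (q [(?d, B w)])"
    using \<pi>_chain[OF B_mem[OF w(1)]] by (simp add: add.assoc)
  finally show ?thesis by simp
qed

text \<open>The corestrictions now agree on all words, so the first alternative in
  \<open>transfer_esum\<close> is always available.\<close>

theorem cod_p_esum:
  assumes "w \<in> words U" "head_additive (letters W) \<phi>"
  shows "cod p (esum f \<phi>) w = esum f (cod q \<phi>) w"
  by (rule transfer_esum[OF assms]) (simp add: cod_p_f)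

end

section \<open>Linear functionals on the symmetric coalgebra\<close>

text \<open>The field is placed in every degree, so that the degree condition in
  \<open>sym_multilinear U scalars 0\<close> holds for every functional.\<close>

definition scalars :: "complex graded_space" where
  "scalars = \<lparr>smul = (*), homog = (\<lambda>i. UNIV)\<rparr>"

lemma scalars_simps [simp]: "smul scalars = (*)" "homog scalars i = UNIV"
  by (simp_all add: scalars_def)

lemma vector_space_complex: "vector_space ((*) :: complex \<Rightarrow> complex \<Rightarrow> complex)"
  by unfold_locales (auto simp: algebra_simps)

lemma graded_vector_space_scalars: "graded_vector_space scalars"
proof -
  interpret vector_space "(*) :: complex \<Rightarrow> complex \<Rightarrow> complex" by (rule vector_space_complex)
  show ?thesis by (simp add: graded_vector_space_def vector_space_complex)
qed

definition free_eval :: "('w \<Rightarrow> complex) \<Rightarrow> ('w \<Rightarrow>\<^sub>0 complex) \<Rightarrow> complex" where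
  "free_eval \<psi> z = (\<Sum>w\<in>Poly_Mapping.keys z. Poly_Mapping.lookup z w * \<psi> w)"

lemma free_eval_superset:
  assumes "finite S" "Poly_Mapping.keys z \<subseteq> S"
  shows "free_eval \<psi> z = (\<Sum>w\<in>S. Poly_Mapping.lookup z w * \<psi> w)"
  unfolding free_eval_def using assms by (intro sum.mono_neutral_left) (auto simp: in_keys_iff)

lemma free_eval_add: "free_eval \<psi> (y + z) = free_eval \<psi> y + free_eval \<psi> z"
proof -
  let ?S = "Poly_Mapping.keys y \<union> Poly_Mapping.keys z"
  have "Poly_Mapping.keys (y + z) \<subseteq> ?S" by (rule Poly_Mapping.keys_add)
  then show ?thesis
    by (simp add: free_eval_superset[of ?S] lookup_add sum.distrib algebra_simps)
qed

lemma free_eval_scale: "free_eval \<psi> (free_scale c z) = c * free_eval \<psi> z"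
proof -
  have "Poly_Mapping.keys (free_scale c z) \<subseteq> Poly_Mapping.keys z"
    by (auto simp: in_keys_iff lookup_free_scale)
  then show ?thesis
    by (simp add: free_eval_superset[of "Poly_Mapping.keys z"] lookup_free_scale
        sum_distrib_left mult.assoc)
qed

lemma free_eval_zero [simp]: "free_eval \<psi> 0 = 0"
  by (simp add: free_eval_def)

lemma free_eval_diff: "free_eval \<psi> (y - z) = free_eval \<psi> y - free_eval \<psi> z"
  using free_eval_add[of \<psi> "y - z" z] by simp

lemma free_eval_sum: "free_eval \<psi> (\<Sum>i\<in>I. z i) = (\<Sum>i\<in>I. free_eval \<psi> (z i))"
  by (induction I rule: infinite_finite_induct) (auto simp: free_eval_add)

lemma free_eval_single [simp]: "free_eval \<psi> (Poly_Mapping.single w c) = c * \<psi> w"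
  by (cases "c = 0") (auto simp: free_eval_def)

text \<open>Composites such as \<open>Q Q\<close> or \<open>Q F\<close> are evaluated by letting the
  functional travel inwards, one map at a time.\<close>

lemma free_eval_linear_extension:
  "free_eval \<psi> (linear_extension \<phi> z) = free_eval (\<lambda>w. free_eval \<psi> (\<phi> w)) z"
  by (simp add: linear_extension_def free_eval_sum free_eval_scale) (simp add: free_eval_def)

lemma functional_eq_free_eval:
  fixes \<Lambda> :: "('w \<Rightarrow>\<^sub>0 complex) \<Rightarrow> complex"
  assumes add: "\<And>y z. \<Lambda> (y + z) = \<Lambda> y + \<Lambda> z" and scale: "\<And>c z. \<Lambda> (free_scale c z) = c * \<Lambda> z"
  shows "\<Lambda> z = free_eval (\<lambda>w. \<Lambda> (Poly_Mapping.single w 1)) z"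
proof -
  have zero: "\<Lambda> 0 = 0" using add[of 0 0] by simp
  have single: "\<Lambda> (Poly_Mapping.single w c) = c * \<Lambda> (Poly_Mapping.single w 1)" for w c
  proof -
    have "Poly_Mapping.single w c = free_scale c (Poly_Mapping.single w 1)"
      by (rule poly_mapping_eqI) (simp add: lookup_free_scale lookup_single when_def)
    then show ?thesis by (simp add: scale)
  qed
  have sum: "\<Lambda> (\<Sum>i\<in>I. y i) = (\<Sum>i\<in>I. \<Lambda> (y i))" for I and y :: "_ \<Rightarrow> ('w \<Rightarrow>\<^sub>0 complex)"
    by (induction I rule: infinite_finite_induct) (auto simp: zero add)
  have "z = (\<Sum>w\<in>Poly_Mapping.keys z. Poly_Mapping.single w (Poly_Mapping.lookup z w))"
    by (rule poly_mapping_eqI)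
      (auto simp: lookup_sum lookup_single when_def in_keys_iff)
  then have "\<Lambda> z = (\<Sum>w\<in>Poly_Mapping.keys z. \<Lambda> (Poly_Mapping.single w (Poly_Mapping.lookup z w)))"
    using sum by metis
  then show ?thesis by (simp add: single[of _ "Poly_Mapping.lookup z _"] free_eval_def)
qed

text \<open>Otherwise \<open>x\<close> together with a basis of the span is independent, and some
  functional is 1 at \<open>x\<close> and 0 on that basis.\<close>

lemma (in vector_space) in_span_if_functionals_vanish:
  assumes "\<And>\<Lambda>. Vector_Spaces.linear scale (*) \<Lambda> \<Longrightarrow> (\<And>s. s \<in> S \<Longrightarrow> \<Lambda> s = 0) \<Longrightarrow> \<Lambda> x = 0"
  shows "x \<in> span S"
proof (rule ccontr)
  assume x: "x \<notin> span S"
  interpret F: vector_space "(*) :: 'a \<Rightarrow> 'a \<Rightarrow> 'a" by unfold_locales (auto simp: algebra_simps)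
  interpret P: vector_space_pair scale "(*) :: 'a \<Rightarrow> 'a \<Rightarrow> 'a" ..
  obtain B where B: "B \<subseteq> S" "independent B" "S \<subseteq> span B"
    by (rule maximal_independent_subset)
  have xB: "x \<notin> span B" using x B(1) span_mono by blast
  then have "independent (insert x B)" using B(2) by (simp add: independent_insert)
  then obtain \<Lambda> where \<Lambda>: "Vector_Spaces.linear scale (*) \<Lambda>" "\<forall>y\<in>insert x B. \<Lambda> y = (if y = x then 1 else 0)"
    using P.linear_independent_extend[of "insert x B" "\<lambda>y. if y = x then 1 else 0"] by blast
  have "\<Lambda> s = 0" if "s \<in> S" for s
  proof (rule P.linear_eq_0_on_span[OF \<Lambda>(1), of B])
    show "s \<in> span B" using that B(3) by blast
    show "\<Lambda> b = 0" if "b \<in> B" for b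
      using \<Lambda>(2) that xB span_base by auto
  qed
  from assms[OF \<Lambda>(1) this] \<Lambda>(2) show False by simp
qed

text \<open>The three families of generators of \<open>sym_relations\<close> match the additivity,
  scaling and symmetry clauses of \<open>sym_multilinear\<close>. A functional that kills the
  generators is therefore symmetric multilinear on words.\<close>

lemma sym_relationsI:
  assumes gvs: "graded_vector_space U"
    and z: "\<And>\<psi>. sym_multilinear U scalars 0 \<psi> \<Longrightarrow> free_eval \<psi> z = 0"
  shows "z \<in> sym_relations U"
  unfolding sym_relations_def
proof (rule vector_space.in_span_if_functionals_vanish[OF vector_space_free_scale], goal_cases)
  case (1 \<Lambda>)
  let ?s = "Poly_Mapping.single :: _ \<Rightarrow> complex \<Rightarrow> 'a free_sym"
  interpret Vector_Spaces.linear free_scale "(*)" \<Lambda> by (rule 1(1))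
  define \<psi> where "\<psi> w = \<Lambda> (?s w 1)" for w
  have \<Lambda>: "\<Lambda> z = free_eval \<psi> z" for z
    unfolding \<psi>_def by (rule functional_eq_free_eval) (simp_all add: add scale)
  have "sym_multilinear U scalars 0 \<psi>"
    unfolding sym_multilinear_def
  proof (intro conjI allI impI ballI, goal_cases)
    case (2 u v i x y)
    have "\<Lambda> (?s (u @ (i, x + y) # v) 1 - ?s (u @ (i, x) # v) 1 - ?s (u @ (i, y) # v) 1) = 0"
      by (rule 1(2)) (use 2 in blast)
    then show ?case unfolding \<Lambda> free_eval_diff free_eval_single by (simp add: algebra_simps)
  next
    case (3 u v i x c)
    have "\<Lambda> (?s (u @ (i, smul U c x) # v) 1 - ?s (u @ (i, x) # v) c) = 0"
      by (rule 1(2)) (use 3 in blast)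
    then show ?case by (simp add: \<Lambda> free_eval_diff)
  next
    case (4 u v i x j y)
    have "\<Lambda> (?s (u @ (i, x) # (j, y) # v) 1 - ?s (u @ (j, y) # (i, x) # v) ((-1) powi (i * j))) = 0"
      by (rule 1(2)) (use 4 in blast)
    then show ?case by (simp add: \<Lambda> free_eval_diff)
  qed simp
  from z[OF this] show ?case by (simp add: \<Lambda>)
qed

section \<open>Unshuffles as colourings\<close>

text \<open>The coproduct iterated to \<open>s\<close> blocks. A letter that joins block
  \<open>b\<close> passes everything in the blocks before \<open>b\<close>.\<close>

primrec csum :: "nat \<Rightarrow> ('a gword list \<Rightarrow> 'b::ab_group_add) \<Rightarrow> 'a gword \<Rightarrow> 'b" where
  "csum s \<Phi> [] = \<Phi> (replicate s [])"
| "csum s \<Phi> (a # w) =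
     (\<Sum>b<s. csum s (\<lambda>us. sg (fst a * (\<Sum>c<b. word_degree (us ! c))) (\<Phi> (us[b := a # us ! b]))) w)"

lemma sg_sum: "sg k (\<Sum>i\<in>I. x i) = (\<Sum>i\<in>I. sg k (x i))"
  by (induction I rule: infinite_finite_induct) (auto simp: sg_add)

lemma csum_sg: "csum s (\<lambda>us. sg k (\<Phi> us)) w = sg k (csum s \<Phi> w)"
proof (induction w arbitrary: \<Phi>)
  case (Cons a w)
  show ?case
    unfolding csum.simps sg_sum Cons.IH[symmetric] by (simp add: add.commute)
qed simp

lemma usum_sum: "usum (\<lambda>u v. \<Sum>i\<in>I. \<phi> i u v) w = (\<Sum>i\<in>I. usum (\<phi> i) w)"
  by (induction I rule: infinite_finite_induct) (auto simp: usum_add)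

lemma csum_Suc: "csum (Suc s) \<Phi> w = usum (\<lambda>u v. csum s (\<lambda>us. \<Phi> (u # us)) v) w"
proof (induction w arbitrary: \<Phi>)
  case (Cons a w)
  show ?case
    unfolding csum.simps usum.simps sum.lessThan_Suc_shift Cons.IH sg_sum usum_sum csum_sg[symmetric]
    by (simp add: sum.lessThan_Suc_shift distrib_left del: sum.lessThan_Suc)
qed simp

definition colourings :: "nat \<Rightarrow> nat \<Rightarrow> nat list set" where
  "colourings n s = {cs. set cs \<subseteq> {..<s} \<and> length cs = n}"

definition block :: "nat list \<Rightarrow> 'a list \<Rightarrow> nat \<Rightarrow> 'a list" where
  "block cs w b = map snd (filter (\<lambda>(c, x). c = b) (zip cs w))"

text \<open>The exponent of the sign for sorting \<open>w\<close> stably by colour: each letter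
  passes the later letters of smaller colour.\<close>

fun colour_sign :: "nat list \<Rightarrow> 'a gword \<Rightarrow> int" where
  "colour_sign (b # cs) (a # w) =
     fst a * (\<Sum>c<b. word_degree (block cs w c)) + colour_sign cs w"
| "colour_sign _ _ = 0"

lemma csum_colourings:
  "csum s \<Phi> w = (\<Sum>cs\<in>colourings (length w) s.
     sg (colour_sign cs w) (\<Phi> (map (block cs w) [0..<s])))"
proof (induction w arbitrary: \<Phi>)
  case Nil
  have "colourings 0 s = {[]}" by (auto simp: colourings_def)
  then show ?case by (simp add: block_def map_replicate_const)
next
  case (Cons a w)
  let ?g = "\<lambda>cs. sg (colour_sign cs (a # w)) (\<Phi> (map (block cs (a # w)) [0..<s]))"
  have block: "(map (block cs w) [0..<s])[b := a # map (block cs w) [0..<s] ! b]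
      = map (block (b # cs) (a # w)) [0..<s]" if "b < s" for b cs
    by (rule nth_equalityI) (use that in \<open>auto simp: block_def nth_list_update\<close>)
  have "csum s \<Phi> (a # w) = (\<Sum>b<s. \<Sum>cs\<in>colourings (length w) s. ?g (b # cs))"
    unfolding csum.simps Cons.IH by (intro sum.cong refl) (use block in \<open>simp add: add.commute\<close>)
  also have "\<dots> = (\<Sum>(b, cs)\<in>{..<s} \<times> colourings (length w) s. ?g (b # cs))"
    by (simp add: sum.cartesian_product)
  also have "\<dots> = (\<Sum>cs\<in>colourings (length (a # w)) s. ?g cs)"
    by (rule sum.reindex_bij_witness[where i="\<lambda>cs. (hd cs, tl cs)" and j="\<lambda>(b, cs). b # cs"])
      (auto simp: colourings_def length_Suc_conv)
  finally show ?case .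
qed

section \<open>The unshuffle attached to a colouring\<close>

definition positions :: "nat list \<Rightarrow> nat \<Rightarrow> nat list" where
  "positions cs b = filter (\<lambda>i. cs ! i = b) [0..<length cs]"

definition arrangement :: "nat list \<Rightarrow> nat \<Rightarrow> nat list" where
  "arrangement cs s = concat (map (positions cs) [0..<s])"

text \<open>Beyond the length it is the identity, as \<open>permutes\<close> requires.\<close>

definition arrangement_fun :: "nat list \<Rightarrow> nat \<Rightarrow> nat \<Rightarrow> nat" where
  "arrangement_fun cs s i = (if i < length cs then arrangement cs s ! i else i)"

lemma set_arrangement: "cs \<in> colourings n s \<Longrightarrow> set (arrangement cs s) = {..<n}"
  by (auto simp: arrangement_def positions_def colourings_def subset_iff)

text \<open>The arrangement is a stable sort of the positions by colour. This gives both its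
  distinctness and the description of its inversions.\<close>

lemma arrangement_sorted:
  "sorted_wrt (\<lambda>i j. cs ! i < cs ! j \<or> cs ! i = cs ! j \<and> i < j) (arrangement cs s)"
proof -
  have "sorted_wrt (<) (positions cs b)" for b
    unfolding positions_def by (rule sorted_wrt_filter) simp
  then have "sorted_wrt (\<lambda>i j. cs ! i < cs ! j \<or> cs ! i = cs ! j \<and> i < j) (positions cs b)" for b
    by (rule sorted_wrt_mono_rel[rotated]) (auto simp: positions_def)
  then show ?thesis
    unfolding arrangement_def
    by (induction s) (auto simp: sorted_wrt_append positions_def)
qed

lemma distinct_arrangement: "distinct (arrangement cs s)"
proof -
  have "arrangement cs s ! i \<noteq> arrangement cs s ! j" if "i < j" "j < length (arrangement cs s)" for i j
    using sorted_wrt_nth_less[OF arrangement_sorted that] by auto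
  then show ?thesis
    unfolding distinct_conv_nth by (metis linorder_neqE_nat)
qed

lemma length_arrangement: "cs \<in> colourings n s \<Longrightarrow> length (arrangement cs s) = n"
  using distinct_card[OF distinct_arrangement, of cs s] by (simp add: set_arrangement)

lemma arrangement_fun_permutes:
  assumes "cs \<in> colourings n s"
  shows "arrangement_fun cs s permutes {..<n}"
proof (rule bij_imp_permutes)
  have len: "length cs = n" using assms by (simp add: colourings_def)
  have "bij_betw ((!) (arrangement cs s)) {..<length (arrangement cs s)} (set (arrangement cs s))"
    by (rule bij_betw_nth[OF distinct_arrangement]) auto
  then have "bij_betw ((!) (arrangement cs s)) {..<n} {..<n}"
    by (simp add: set_arrangement[OF assms] length_arrangement[OF assms])
  then show "bij_betw (arrangement_fun cs s) {..<n} {..<n}"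
    by (rule bij_betw_cong[THEN iffD1, rotated]) (simp add: arrangement_fun_def len)
  show "arrangement_fun cs s x = x" if "x \<notin> {..<n}" for x
    using that by (simp add: arrangement_fun_def len)
qed

lemma split_blocks_concat: "split_blocks (map length xss) (concat xss) = xss"
  by (induction xss) auto

lemma length_split_blocks [simp]: "length (split_blocks ns w) = length ns"
  by (induction ns arbitrary: w) auto

lemma concat_split_blocks: "sum_list ns = length w \<Longrightarrow> concat (split_blocks ns w) = w"
  by (induction ns arbitrary: w) auto

lemma length_nth_split_blocks:
  "sum_list ns = length w \<Longrightarrow> map length (split_blocks ns w) = ns"
  by (induction ns arbitrary: w) auto

lemma nth_split_blocks:
  "b < length ns \<Longrightarrow> split_blocks ns w ! b = take (ns ! b) (drop (sum_list (take b ns)) w)"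
  by (induction ns arbitrary: w b) (auto simp: nth_Cons' take_Cons' add.commute)

lemma block_eq_positions:
  "length cs = length w \<Longrightarrow> block cs w b = map ((!) w) (positions cs b)"
proof -
  assume len: "length cs = length w"
  have "zip cs w = map (\<lambda>i. (cs ! i, w ! i)) [0..<length cs]"
    by (rule nth_equalityI) (use len in auto)
  then show ?thesis
    by (simp add: block_def positions_def filter_map o_def)
qed

lemma take_drop_upt: "a + k \<le> n \<Longrightarrow> take k (drop a [0..<n]) = [a..<a + k]"
  by (simp add: take_upt)

lemma unshuffle_block:
  assumes \<sigma>: "\<sigma> \<in> unshuffles ns" and b: "b < length ns"
  shows "sorted_wrt (<) (split_blocks ns (map \<sigma> [0..<sum_list ns]) ! b)"
proof -
  let ?a = "sum_list (take b ns)"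
  have ab: "sum_list (take (Suc b) ns) = ?a + ns ! b"
    using b by (simp add: take_Suc_conv_app_nth)
  have "?a + ns ! b \<le> sum_list ns"
    unfolding ab[symmetric] by (metis append_take_drop_id le_add1 sum_list_append)
  then have eq: "split_blocks ns (map \<sigma> [0..<sum_list ns]) ! b = map \<sigma> [?a..<?a + ns ! b]"
    using b by (simp add: nth_split_blocks drop_map take_map take_drop_upt)
  have mono: "strict_mono_on {?a..<?a + ns ! b} \<sigma>"
    using \<sigma> b unfolding ab[symmetric] by (simp add: unshuffles_def)
  show ?thesis
    unfolding eq sorted_wrt_map
    by (rule sorted_wrt_mono_rel[of _ "(<)"]) (auto intro: strict_mono_onD[OF mono])
qed

lemma arrangement_fun_unshuffle:
  assumes "cs \<in> colourings n s"
  shows "arrangement_fun cs s \<in> unshuffles (map (length \<circ> positions cs) [0..<s])"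
proof -
  let ?ns = "map (length \<circ> positions cs) [0..<s]"
  have len: "length cs = n" using assms by (simp add: colourings_def)
  have sum: "sum_list ?ns = n"
    using length_arrangement[OF assms] by (simp add: arrangement_def length_concat)
  have "strict_mono_on {sum_list (take b ?ns)..<sum_list (take (Suc b) ?ns)} (arrangement_fun cs s)"
    if b: "b < s" for b
  proof (rule strict_mono_onI)
    let ?a = "sum_list (take b ?ns)"
    fix i j assume ij: "i \<in> {?a..<sum_list (take (Suc b) ?ns)}" "j \<in> {?a..<sum_list (take (Suc b) ?ns)}" "i < j"
    have ab: "sum_list (take (Suc b) ?ns) = ?a + ?ns ! b"
      using b by (simp add: take_Suc_conv_app_nth)
    have le: "?a + ?ns ! b \<le> n"
      unfolding ab[symmetric] sum[symmetric] by (metis append_take_drop_id le_add1 sum_list_append)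
    have nth: "arrangement_fun cs s k = positions cs b ! (k - ?a)" if "?a \<le> k" "k < ?a + ?ns ! b" for k
    proof -
      have "split_blocks ?ns (arrangement cs s) ! b = positions cs b"
        using b split_blocks_concat[of "map (positions cs) [0..<s]"] by (simp add: arrangement_def)
      then have "positions cs b = take (?ns ! b) (drop ?a (arrangement cs s))"
        using nth_split_blocks[of b ?ns "arrangement cs s"] b by simp
      then have "positions cs b ! (k - ?a) = take (?ns ! b) (drop ?a (arrangement cs s)) ! (k - ?a)"
        by (rule arg_cong)
      also have "\<dots> = arrangement cs s ! k"
        using that le length_arrangement[OF assms] by (subst nth_take) (auto simp: nth_drop)
      finally show ?thesis using that le len by (simp add: arrangement_fun_def)
    qed
    have "sorted_wrt (<) (positions cs b)"
      unfolding positions_def by (rule sorted_wrt_filter) simp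
    then show "arrangement_fun cs s i < arrangement_fun cs s j"
      using ij b unfolding ab by (simp add: nth sorted_wrt_iff_nth_less)
  qed
  then show ?thesis
    using arrangement_fun_permutes[OF assms] by (simp add: unshuffles_def sum del: take_map)
qed

lemma finite_block_lengths: "finite {ns :: nat list. length ns = s \<and> sum_list ns = n}"
  by (rule finite_subset[OF _ finite_lists_length_eq[of "{..n}" s]]) (auto simp: member_le_sum_list)

text \<open>An unshuffle with \<open>s\<close> blocks, empty ones allowed, amounts to saying to
  which block each position belongs. The order within a block carries no information since
  unshuffles increase there.\<close>

lemma sum_unshuffles_eq_sum_colourings:
  "(\<Sum>ns | length ns = s \<and> sum_list ns = n. \<Sum>\<sigma>\<in>unshuffles ns. F ns \<sigma>) =
   (\<Sum>cs\<in>colourings n s. F (map (length \<circ> positions cs) [0..<s]) (arrangement_fun cs s))"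
proof -
  let ?NS = "{ns. length ns = s \<and> sum_list ns = n}"
  let ?G = "\<lambda>cs. (map (length \<circ> positions cs) [0..<s], arrangement_fun cs s)"
  note fin = finite_block_lengths[of s n]
  have "inj_on ?G (colourings n s)"
  proof (rule inj_onI)
    fix cs cs' assume cs: "cs \<in> colourings n s" "cs' \<in> colourings n s" and G: "?G cs = ?G cs'"
    have len: "length cs = n" "length cs' = n" using cs by (auto simp: colourings_def)
    have "arrangement cs s = arrangement cs' s"
    proof (rule nth_equalityI)
      fix i assume "i < length (arrangement cs s)"
      moreover have "arrangement_fun cs s i = arrangement_fun cs' s i" using G by simp
      ultimately show "arrangement cs s ! i = arrangement cs' s ! i"
        using len cs by (simp add: arrangement_fun_def length_arrangement)
    qed (use cs in \<open>simp add: length_arrangement\<close>)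
    \<comment> \<open>Equal block lengths cut the common arrangement into the same lists of
      positions, and these determine the colours.\<close>
    then have "concat (map (positions cs) [0..<s]) = concat (map (positions cs') [0..<s])"
      by (simp only: arrangement_def)
    moreover have "map length (map (positions cs) [0..<s]) = map length (map (positions cs') [0..<s])"
      using G by (simp only: prod.inject map_map)
    ultimately have "map (positions cs) [0..<s] = map (positions cs') [0..<s]"
      by (metis split_blocks_concat)
    then have pos: "positions cs b = positions cs' b" if "b < s" for b
      using that by simp
    show "cs = cs'"
    proof (rule nth_equalityI)
      fix i assume i: "i < length cs"
      then have "cs ! i < s"
        using cs(1) nth_mem[OF i] unfolding colourings_def by blast
      moreover have "i \<in> set (positions cs (cs ! i))" using i by (simp add: positions_def)
      ultimately have "i \<in> set (positions cs' (cs ! i))" using pos by simp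
      then show "cs ! i = cs' ! i" by (simp add: positions_def)
    qed (simp add: len)
  qed
  moreover have "?G ` colourings n s = Sigma ?NS unshuffles"
  proof (intro equalityI subsetI)
    fix x assume "x \<in> ?G ` colourings n s"
    then obtain cs where cs: "cs \<in> colourings n s" "x = ?G cs" by auto
    have "sum_list (map (length \<circ> positions cs) [0..<s]) = n"
      using length_arrangement[OF cs(1)] by (simp add: arrangement_def length_concat)
    then show "x \<in> Sigma ?NS unshuffles"
      using arrangement_fun_unshuffle[OF cs(1)] cs(2) by auto
  next
    fix x assume "x \<in> Sigma ?NS unshuffles"
    then obtain ns \<sigma> where x: "x = (ns, \<sigma>)" "length ns = s" "sum_list ns = n" "\<sigma> \<in> unshuffles ns"
      by auto
    define P where "P = map \<sigma> [0..<n]"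
    define xss where "xss = split_blocks ns P"
    have \<sigma>: "\<sigma> permutes {..<n}" using x by (auto simp: unshuffles_def)
    have P: "set P = {..<n}" "distinct P" "length P = n"
      unfolding P_def using permutes_image[OF \<sigma>] permutes_inj_on[OF \<sigma>]
      by (auto simp: distinct_map atLeast0LessThan)
    have concat: "concat xss = P" "map length xss = ns" "length xss = s"
      unfolding xss_def using x P by (simp_all add: concat_split_blocks length_nth_split_blocks)
    have sorted: "sorted_wrt (<) (xss ! b)" if "b < s" for b
      unfolding xss_def P_def using unshuffle_block[OF x(4)] x that by simp
    have ex: "\<exists>b<s. i \<in> set (xss ! b)" if "i < n" for i
    proof -
      have "i \<in> set (concat xss)" using P that by (simp add: concat)
      then obtain xs where "xs \<in> set xss" "i \<in> set xs" unfolding set_concat by blast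
      moreover obtain b where "b < length xss" "xss ! b = xs"
        using \<open>xs \<in> set xss\<close> unfolding in_set_conv_nth by blast
      ultimately show ?thesis using concat(3) by blast
    qed
    \<comment> \<open>The colour of \<open>i\<close> is the block whose list of values contains
      \<open>i\<close>; it is unique because the concatenated list \<open>P\<close> is
      distinct.\<close>
    define col where "col i = (SOME b. b < s \<and> i \<in> set (xss ! b))" for i
    then have col: "col i < s \<and> i \<in> set (xss ! col i)" if "i < n" for i
      using someI_ex[OF ex[OF that]] by simp
    have uniq: "b = b'" if "b < s" "b' < s" "i \<in> set (xss ! b)" "i \<in> set (xss ! b')" for i b b'
    proof -
      have split: "False" if bb: "b < b'" "b' < s" "i \<in> set (xss ! b)" "i \<in> set (xss ! b')" for b b'
      proof -
        have "xss = take b' xss @ drop b' xss" by simp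
        then have "concat xss = concat (take b' xss) @ concat (drop b' xss)"
          by (metis concat_append)
        moreover have "xss ! b \<in> set (take b' xss)" "xss ! b' \<in> set (drop b' xss)"
          using bb concat(3) nth_mem[of b "take b' xss"] nth_mem[of 0 "drop b' xss"] by simp_all
        then have "i \<in> set (concat (take b' xss)) \<inter> set (concat (drop b' xss))"
          using bb by auto
        ultimately show False using P(2) concat(1) by (metis distinct_append empty_iff)
      qed
      show ?thesis using split[of b b'] split[of b' b] that by (metis linorder_neqE_nat)
    qed
    define cs where "cs = map col [0..<n]"
    have cs: "cs \<in> colourings n s"
      using col by (auto simp: cs_def colourings_def)
    \<comment> \<open>Both are sorted lists without repetition, so equality of their sets
      suffices.\<close>
    have pos: "positions cs b = xss ! b" if "b < s" for b
    proof (rule sorted_distinct_set_unique)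
      show "sorted (xss ! b)" "distinct (xss ! b)"
        using sorted[OF that] by (simp_all add: strict_sorted_iff)
      have "set (xss ! b) \<subseteq> set (concat xss)"
        unfolding set_concat using that concat(3) by (intro UN_upper nth_mem) simp
      then have "set (xss ! b) \<subseteq> {..<n}" using P by (simp add: concat)
      then have "i \<in> set (positions cs b) \<longleftrightarrow> i \<in> set (xss ! b)" for i
        using col[of i] uniq[of "col i" b i] that by (cases "i < n") (auto simp: positions_def cs_def)
      then show "set (positions cs b) = set (xss ! b)" by blast
    qed (auto simp: positions_def intro: sorted_wrt_filter)
    have xss: "map (positions cs) [0..<s] = xss"
      by (rule nth_equalityI) (simp_all add: concat pos)
    have "map (length \<circ> positions cs) [0..<s] = ns"
      using concat(2) unfolding xss[symmetric] by simp
    moreover have "arrangement_fun cs s i = \<sigma> i" for i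
    proof (cases "i < n")
      case True
      then show ?thesis
        unfolding arrangement_fun_def arrangement_def xss concat by (simp add: cs_def P_def)
    qed (use permutes_not_in[OF \<sigma>] in \<open>simp add: arrangement_fun_def cs_def\<close>)
    ultimately have "x = ?G cs" using x by (auto simp: fun_eq_iff)
    then show "x \<in> ?G ` colourings n s" using cs by blast
  qed
  ultimately have "bij_betw ?G (colourings n s) (Sigma ?NS unshuffles)"
    by (simp add: bij_betw_def)
  from sum.reindex_bij_betw[OF this, of "\<lambda>(ns, \<sigma>). F ns \<sigma>"]
  show ?thesis
    by (simp add: sum.Sigma[OF fin] finite_unshuffles)
qed

section \<open>Koszul signs as products over inversions\<close>

lemma minus_one_powi: "(-1 :: complex) powi k = sg k 1"
  by (simp add: sg_def power_int_minus_left)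

lemma minus_one_powi_mult: "(-1) powi k * (x :: complex) = sg k x"
  by (simp add: minus_one_powi sg_def)

lemma minus_one_powi_sum:
  "(-1 :: complex) powi (\<Sum>i\<in>I. k i) = (\<Prod>i\<in>I. (-1) powi k i)"
  by (induction I rule: infinite_finite_induct) (auto simp: power_int_add)

lemma sum_word_degree_block:
  "length cs = length w \<Longrightarrow>
   (\<Sum>c<b. word_degree (block cs w c)) = (\<Sum>j | j < length w \<and> cs ! j < b. fst (w ! j))"
proof (induction cs w rule: list_induct2)
  case Nil
  then show ?case by (simp add: block_def)
next
  case (Cons c cs x w)
  have "word_degree (block (c # cs) (x # w) d) = (if d = c then fst x else 0) + word_degree (block cs w d)" for d
    by (simp add: block_def)
  then have "(\<Sum>d<b. word_degree (block (c # cs) (x # w) d)) =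
      (\<Sum>d<b. if d = c then fst x else 0) + (\<Sum>d<b. word_degree (block cs w d))"
    by (simp add: sum.distrib)
  also have "(\<Sum>d<b. if d = c then fst x else 0) = (if c < b then fst x else 0)"
    by (simp add: sum.delta)
  also have "(\<Sum>d<b. word_degree (block cs w d)) = (\<Sum>j | j < length w \<and> cs ! j < b. fst (w ! j))"
    by (rule Cons.IH)
  also have "(if c < b then fst x else 0) + \<dots>
      = (\<Sum>j | j < length (x # w) \<and> (c # cs) ! j < b. fst ((x # w) ! j))"
  proof -
    have "{j. j < length (x # w) \<and> (c # cs) ! j < b} =
      (if c < b then {0} else {}) \<union> Suc ` {j. j < length w \<and> cs ! j < b}"
      by (auto simp: less_Suc_eq_0_disj)
    then show ?thesis by (auto simp: sum.reindex)
  qed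
  finally show ?case .
qed

text \<open>Inversions involving the first position pair it with later letters of smaller colour,
  and their signs multiply to the first summand of \<open>colour_sign\<close>. All others are
  inversions of the tail.\<close>

lemma prod_inversions:
  "length cs = length w \<Longrightarrow>
   (\<Prod>(i, j) \<in> {(i, j). i < j \<and> j < length w \<and> cs ! j < cs ! i}.
      (-1 :: complex) powi (fst (w ! i) * fst (w ! j))) = (-1) powi (colour_sign cs w)"
proof (induction cs w rule: list_induct2)
  case (Cons c cs x w)
  let ?f = "\<lambda>w (i, j). (-1 :: complex) powi (fst (w ! i) * fst (w ! j))"
  let ?I = "\<lambda>cs w. {(i, j). i < j \<and> j < length w \<and> cs ! j < cs ! i}"
  let ?A = "(\<lambda>j. (0, Suc j)) ` {j. j < length w \<and> cs ! j < c}"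
  let ?B = "(\<lambda>(i, j). (Suc i, Suc j)) ` ?I cs w"
  have I: "?I (c # cs) (x # w) = ?A \<union> ?B"
  proof (intro equalityI subsetI)
    fix p assume "p \<in> ?I (c # cs) (x # w)"
    then obtain i j where p: "p = (i, j)" "i < j" "j < length (x # w)" "(c # cs) ! j < (c # cs) ! i"
      by auto
    then show "p \<in> ?A \<union> ?B" by (cases i; cases j) auto
  qed auto
  have fin: "finite (?I cs w)"
    by (rule finite_subset[of _ "{..<length w} \<times> {..<length w}"]) auto
  have "prod (?f (x # w)) (?I (c # cs) (x # w)) = prod (?f (x # w)) ?A * prod (?f (x # w)) ?B"
    unfolding I using fin by (intro prod.union_disjoint) auto
  also have "prod (?f (x # w)) ?A = (\<Prod>j | j < length w \<and> cs ! j < c. (-1) powi (fst x * fst (w ! j)))"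
    by (simp add: prod.reindex inj_on_def)
  also have "\<dots> = (-1) powi (fst x * (\<Sum>d<c. word_degree (block cs w d)))"
    by (simp add: sum_word_degree_block[OF Cons.hyps] minus_one_powi_sum sum_distrib_left)
  also have "prod (?f (x # w)) ?B = prod (?f w) (?I cs w)"
    by (subst prod.reindex) (auto simp: inj_on_def intro!: prod.cong)
  finally show ?case by (simp add: Cons.IH power_int_add)
qed simp

text \<open>Positions of equal colour keep their order, so the inversions of the unshuffle
  \<open>\<sigma>\<close> correspond to pairs of positions \<open>i < j\<close> with decreasing
  colours. A pair of places \<open>a < b\<close> is matched with \<open>\<sigma> b\<close>,
  \<open>\<sigma> a\<close>.\<close>

lemma koszul_sign_arrangement:
  assumes cs: "cs \<in> colourings n s" and w: "length w = n"
  shows "koszul_sign (arrangement_fun cs s) w = (-1) powi (colour_sign cs w)"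
proof -
  let ?\<sigma> = "arrangement_fun cs s"
  let ?J = "{(a, b). a < b \<and> b < length w \<and> ?\<sigma> b < ?\<sigma> a}"
  let ?I = "{(i, j). i < j \<and> j < length w \<and> cs ! j < cs ! i}"
  have perm: "?\<sigma> permutes {..<n}" by (rule arrangement_fun_permutes[OF cs])
  have len: "length cs = n" using cs by (simp add: colourings_def)
  have range: "?\<sigma> a < n \<longleftrightarrow> a < n" for a using permutes_in_image[OF perm, of a] by simp
  have range': "inv ?\<sigma> a < n \<longleftrightarrow> a < n" for a
    using permutes_in_image[OF permutes_inv[OF perm], of a] by simp
  have ordered: "cs ! ?\<sigma> a < cs ! ?\<sigma> b \<or> cs ! ?\<sigma> a = cs ! ?\<sigma> b \<and> ?\<sigma> a < ?\<sigma> b" if "a < b" "b < n" for a b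
    using sorted_wrt_nth_less[OF arrangement_sorted[of cs s] that(1)] that length_arrangement[OF cs] len
    by (simp add: arrangement_fun_def)
  note inv = permutes_inverses[OF perm]
  have "koszul_sign ?\<sigma> w = (\<Prod>(i, j)\<in>?I. (-1) powi (fst (w ! i) * fst (w ! j)))"
    unfolding koszul_sign_def
  proof (rule prod.reindex_bij_witness[where i="\<lambda>(i, j). (inv ?\<sigma> j, inv ?\<sigma> i)" and
        j="\<lambda>(a, b). (?\<sigma> b, ?\<sigma> a)"])
    fix p assume "p \<in> ?J"
    then obtain a b where p: "p = (a, b)" "a < b" "b < n" "?\<sigma> b < ?\<sigma> a" using w by auto
    show "(\<lambda>(a, b). (?\<sigma> b, ?\<sigma> a)) p \<in> ?I"
      using p ordered[of a b] range w by auto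
    show "(\<lambda>(i, j). (inv ?\<sigma> j, inv ?\<sigma> i)) ((\<lambda>(a, b). (?\<sigma> b, ?\<sigma> a)) p) = p"
      using p inv by simp
    show "(case (\<lambda>(a, b). (?\<sigma> b, ?\<sigma> a)) p of (i, j) \<Rightarrow> (-1 :: complex) powi (fst (w ! i) * fst (w ! j)))
      = (case p of (a, b) \<Rightarrow> (-1) powi (fst (w ! ?\<sigma> a) * fst (w ! ?\<sigma> b)))"
      using p by (simp add: mult.commute)
  next
    fix p assume "p \<in> ?I"
    then obtain i j where p: "p = (i, j)" "i < j" "j < n" "cs ! j < cs ! i" using w by auto
    have "\<not> inv ?\<sigma> i < inv ?\<sigma> j" "inv ?\<sigma> i \<noteq> inv ?\<sigma> j"
      using ordered[of "inv ?\<sigma> i" "inv ?\<sigma> j"] p range' inv by (auto, metis less_irrefl inv(1))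
    then show "(\<lambda>(i, j). (inv ?\<sigma> j, inv ?\<sigma> i)) p \<in> ?J"
      using p range' inv w by auto
    show "(\<lambda>(a, b). (?\<sigma> b, ?\<sigma> a)) ((\<lambda>(i, j). (inv ?\<sigma> j, inv ?\<sigma> i)) p) = p"
      using p inv by simp
  qed
  then show ?thesis using prod_inversions[of cs w] len w by simp
qed

lemma sum_unshuffles_eq_csum:
  fixes \<Phi> :: "'a gword list \<Rightarrow> complex"
  shows "(\<Sum>ns | length ns = s \<and> sum_list ns = length w. \<Sum>\<sigma>\<in>unshuffles ns.
     koszul_sign \<sigma> w * \<Phi> (split_blocks ns (permute_list \<sigma> w))) = csum s \<Phi> w"
  unfolding sum_unshuffles_eq_sum_colourings[where F="\<lambda>ns \<sigma>. koszul_sign \<sigma> w * \<Phi> (split_blocks ns (permute_list \<sigma> w))"]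
    csum_colourings
proof (intro sum.cong refl)
  fix cs assume cs: "cs \<in> colourings (length w) s"
  have len: "length cs = length w" using cs by (simp add: colourings_def)
  have "permute_list (arrangement_fun cs s) w = map ((!) w) (arrangement cs s)"
    by (rule nth_equalityI)
      (simp_all add: permute_list_def arrangement_fun_def length_arrangement[OF cs] len)
  also have "\<dots> = concat (map (block cs w) [0..<s])"
    by (simp add: arrangement_def map_concat block_eq_positions[OF len, abs_def] comp_def)
  moreover have "map (length \<circ> positions cs) [0..<s] = map length (map (block cs w) [0..<s])"
    by (simp add: block_eq_positions[OF len])
  ultimately have "split_blocks (map (length \<circ> positions cs) [0..<s]) (permute_list (arrangement_fun cs s) w)
    = map (block cs w) [0..<s]"
    by (simp only: split_blocks_concat)
  then show "koszul_sign (arrangement_fun cs s) w *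
      \<Phi> (split_blocks (map (length \<circ> positions cs) [0..<s]) (permute_list (arrangement_fun cs s) w))
    = sg (colour_sign cs w) (\<Phi> (map (block cs w) [0..<s]))"
    by (simp add: koszul_sign_arrangement[OF cs refl] minus_one_powi_mult)
qed

section \<open>Functionals evaluated on coderivations and coalgebra morphisms\<close>

lemma csum_0: "csum 0 \<Phi> w = (if w = [] then \<Phi> [] else 0)"
  by (cases w) simp_all

lemma csum_2: "csum 2 \<Phi> w = usum (\<lambda>u v. \<Phi> [u, v]) w"
  by (simp add: numeral_2_eq_2 csum_Suc csum_0 usum_right_unit del: csum.simps)

lemma free_eval_coderivation: "free_eval \<phi> (coderivation q w) = cod q \<phi> w"
proof -
  define \<Phi> where "\<Phi> us = (if us ! 0 = [] then 0 else \<phi> ((word_degree (us ! 0) + 1, q (us ! 0)) # us ! 1))"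
    for us
  let ?n = "length w"
  let ?F = "\<lambda>ns. \<Sum>\<sigma>\<in>unshuffles ns. koszul_sign \<sigma> w * \<Phi> (split_blocks ns (permute_list \<sigma> w))"
  have nonempty: "permute_list \<sigma> w = [] \<longleftrightarrow> w = []" for \<sigma>
    by (simp add: permute_list_def)
  have "free_eval \<phi> (coderivation q w) = (\<Sum>k = 1..?n. ?F [k, ?n - k])"
    unfolding coderivation_def Let_def free_eval_sum free_eval_single
    by (intro sum.cong refl) (auto simp: \<Phi>_def nonempty)
  \<comment> \<open>The term \<open>k = 0\<close> can be added because \<open>\<Phi>\<close>
    vanishes on an empty first block; now all types with two blocks occur.\<close>
  also have "\<dots> = (\<Sum>k = 0..?n. ?F [k, ?n - k])"
    by (rule sum.mono_neutral_left) (auto simp: \<Phi>_def not_less_eq_eq)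
  also have "\<dots> = (\<Sum>ns | length ns = 2 \<and> sum_list ns = ?n. ?F ns)"
    by (rule sum.reindex_bij_witness[where i="\<lambda>ns. ns ! 0" and j="\<lambda>k. [k, ?n - k]"])
      (auto simp: numeral_2_eq_2 length_Suc_conv)
  also have "\<dots> = csum 2 \<Phi> w"
    by (rule sum_unshuffles_eq_csum)
  also have "\<dots> = cod q \<phi> w"
    unfolding csum_2 cod_def by (intro usum_cong refl) (simp add: \<Phi>_def)
  finally show ?thesis .
qed

text \<open>
  \<open>tsum f s \<phi>\<close> sums over ordered distributions into \<open>s\<close> blocks; each unordered one is
  counted \<open>s!\<close> times.
\<close>

primrec tsum :: "('a gword \<Rightarrow> 'b) \<Rightarrow> nat \<Rightarrow> ('b gword \<Rightarrow> 'c::ab_group_add) \<Rightarrow> 'a gword \<Rightarrow> 'c" where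
  "tsum f 0 = (\<lambda>\<phi> w. if w = [] then \<phi> [] else 0)"
| "tsum f (Suc s) = (\<lambda>\<phi>. usum (\<lambda>u v. if u = [] then 0
     else tsum f s (\<lambda>t. \<phi> ((word_degree u, f u) # t)) v))"

lemma csum_eq_tsum:
  fixes f :: "'a gword \<Rightarrow> 'b" and \<phi> :: "'b gword \<Rightarrow> 'c::ab_group_add"
  shows "csum s (\<lambda>us. if [] \<in> set us then 0 else \<phi> (map (\<lambda>v. (word_degree v, f v)) us)) w = tsum f s \<phi> w"
proof (induction s arbitrary: \<phi> w)
  case (Suc s)
  have zero: "csum s (\<lambda>us. 0 :: 'c) v = 0" for s and v :: "'a gword"
    by (induction v) auto
  have "csum s (\<lambda>us. if [] \<in> set (u # us) then 0 else \<phi> (map (\<lambda>v. (word_degree v, f v)) (u # us))) v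
    = (if u = [] then 0 else tsum f s (\<lambda>t. \<phi> ((word_degree u, f u) # t)) v)" for u v
    by (cases "u = []") (simp_all add: zero Suc.IH[symmetric] cong: if_cong)
  then show ?case by (simp add: csum_Suc del: csum.simps set_simps)
qed (simp add: csum_0)

lemma tsum_sg: "tsum f s (\<lambda>t. sg k (\<phi> t)) w = sg k (tsum f s \<phi> w)"
proof (induction s arbitrary: \<phi> w)
  case (Suc s)
  show ?case by (simp add: Suc usum_sg[symmetric] if_distrib cong: if_cong)
qed simp

lemma tsum_long: "length w < s \<Longrightarrow> tsum f s \<phi> w = 0"
proof (induction s arbitrary: \<phi> w)
  case (Suc s)
  have "tsum f (Suc s) \<phi> w = usum (\<lambda>u v. 0) w"
    unfolding tsum.simps
  proof (intro usum_cong refl)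
    fix u v :: "'a gword" assume "length u + length v = length w"
    then show "(if u = [] then 0 else tsum f s (\<lambda>t. \<phi> ((word_degree u, f u) # t)) v) = 0"
      using Suc by (cases u) auto
  qed
  then show ?case by simp
qed simp

lemma tsum_cong:
  assumes f: "maps_words A B 0 f" and "set w \<subseteq> A" "\<And>t. set t \<subseteq> B \<Longrightarrow> \<phi> t = \<psi> t"
  shows "tsum f s \<phi> w = tsum f s \<psi> w"
  using assms(2,3)
proof (induction s arbitrary: \<phi> \<psi> w)
  case (Suc s)
  show ?case
    unfolding tsum.simps
  proof (intro usum_cong')
    fix u v assume "set u \<union> set v = set w"
    then have "set u \<subseteq> A" "set v \<subseteq> A" using Suc.prems by auto
    then show "(if u = [] then 0 else tsum f s (\<lambda>t. \<phi> ((word_degree u, f u) # t)) v) =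
       (if u = [] then 0 else tsum f s (\<lambda>t. \<psi> ((word_degree u, f u) # t)) v)"
      using Suc.prems(2) maps_wordsD[OF f, of u] by (auto intro!: Suc.IH)
  qed
qed simp

definition symmetric_on :: "(int \<times> 'b) set \<Rightarrow> ('b gword \<Rightarrow> 'c::ab_group_add) \<Rightarrow> bool" where
  "symmetric_on B \<phi> \<longleftrightarrow> (\<forall>p q x y. set p \<union> set q \<subseteq> B \<longrightarrow> x \<in> B \<longrightarrow> y \<in> B \<longrightarrow>
     \<phi> (p @ x # y # q) = sg (fst x * fst y) (\<phi> (p @ y # x # q)))"

lemma symmetric_on_Cons: "symmetric_on B \<phi> \<Longrightarrow> z \<in> B \<Longrightarrow> symmetric_on B (\<lambda>t. \<phi> (z # t))"
  unfolding symmetric_on_def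
  by (intro allI impI) (metis append_Cons insert_subset list.simps(15) Un_insert_left)

text \<open>The block containing the first letter may stand at any of \<open>s + 1\<close> places.
  Since \<open>\<phi>\<close> is symmetric, it can be moved to the front, and every place
  contributes the same.\<close>

lemma tsum_Suc_Cons:
  fixes \<phi> :: "'b gword \<Rightarrow> complex"
  assumes f: "maps_words A B 0 f" and "set (a # w) \<subseteq> A" and "symmetric_on B \<phi>"
  shows "tsum f (Suc s) \<phi> (a # w) =
    of_nat (Suc s) * usum (\<lambda>u v. tsum f s (\<lambda>t. \<phi> ((word_degree (a # u), f (a # u)) # t)) v) w"
  using assms(2,3)
proof (induction s arbitrary: a w \<phi>)
  case 0
  then show ?case by (simp add: usum_right_unit cong: if_cong)
next
  case (Suc s)
  define F where "F u = (word_degree u, f u)" for u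
  have F: "F u \<in> B" if "u \<noteq> []" "set u \<subseteq> A" for u
    using maps_wordsD[OF f that] by (simp add: F_def)
  have mult: "of_nat k * usum \<psi> v = usum (\<lambda>x y. of_nat k * \<psi> x y) v" for k and \<psi> :: "_ \<Rightarrow> _ \<Rightarrow> complex" and v
    by (rule usum_pull_UNIV) (simp add: distrib_left)
  have mult_sg: "sg k (c * x) = c * sg k x" for k and c x :: complex
    by (simp add: sg_def)
  have "usum (\<lambda>u v. sg (fst a * word_degree u) (if u = [] then 0 else tsum f (Suc s) (\<lambda>t. \<phi> (F u # t)) (a # v))) w
    = of_nat (Suc s) * usum (\<lambda>u v. usum (\<lambda>x y. sg (fst a * word_degree u)
         (if u = [] then 0 else tsum f s (\<lambda>t. \<phi> (F u # F (a # x) # t)) y)) v) w"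
    unfolding mult usum_sg
  proof (rule usum_cong')
    fix u v assume "set u \<union> set v = set w"
    then have uv: "set u \<subseteq> A" "set (a # v) \<subseteq> A" using Suc.prems(1) by auto
    show "sg (fst a * word_degree u) (if u = [] then 0 else tsum f (Suc s) (\<lambda>t. \<phi> (F u # t)) (a # v))
      = of_nat (Suc s) * sg (fst a * word_degree u) (usum (\<lambda>x y. if u = [] then 0
           else tsum f s (\<lambda>t. \<phi> (F u # F (a # x) # t)) y) v)"
      using Suc.IH[OF uv(2) symmetric_on_Cons[OF Suc.prems(2) F[OF _ uv(1)]]]
      by (cases "u = []") (simp_all add: mult_sg F_def del: tsum.simps)
  qed
  \<comment> \<open>Here the block \<open>u\<close> stands before the block of \<open>a\<close>. The
    sign of swapping the two and the sign from the symmetry of \<open>\<phi>\<close> together cancel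
    the sign for moving \<open>a\<close> past \<open>u\<close>.\<close>
  also have "usum (\<lambda>u v. usum (\<lambda>x y. sg (fst a * word_degree u)
         (if u = [] then 0 else tsum f s (\<lambda>t. \<phi> (F u # F (a # x) # t)) y)) v) w
    = usum (\<lambda>x v. usum (\<lambda>u y. sg (word_degree u * word_degree x) (sg (fst a * word_degree u)
         (if u = [] then 0 else tsum f s (\<lambda>t. \<phi> (F u # F (a # x) # t)) y))) v) w"
    by (rule usum_swap)
  also have "\<dots> = usum (\<lambda>x v. usum (\<lambda>u y. if u = [] then 0
      else tsum f s (\<lambda>t. \<phi> (F (a # x) # F u # t)) y) v) w"
  proof (intro usum_cong')
    fix x v u y assume xv: "set x \<union> set v = set w" "set u \<union> set y = set v"
    then have A: "set (a # x) \<subseteq> A" "set u \<subseteq> A" "set y \<subseteq> A" using Suc.prems(1) by auto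
    have "tsum f s (\<lambda>t. \<phi> (F u # F (a # x) # t)) y =
      sg (word_degree u * word_degree (a # x)) (tsum f s (\<lambda>t. \<phi> (F (a # x) # F u # t)) y)" if "u \<noteq> []"
      unfolding tsum_sg[symmetric]
    proof (rule tsum_cong[OF f A(3)])
      fix t assume "set t \<subseteq> B"
      then show "\<phi> (F u # F (a # x) # t) = sg (word_degree u * word_degree (a # x)) (\<phi> (F (a # x) # F u # t))"
        using Suc.prems(2)[unfolded symmetric_on_def, rule_format, of "[]" t "F u" "F (a # x)"]
          F[OF that A(2)] F[OF _ A(1)] by (simp add: F_def)
    qed
    then show "sg (word_degree u * word_degree x) (sg (fst a * word_degree u)
         (if u = [] then 0 else tsum f s (\<lambda>t. \<phi> (F u # F (a # x) # t)) y)) =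
      (if u = [] then 0 else tsum f s (\<lambda>t. \<phi> (F (a # x) # F u # t)) y)"
      by (auto simp: algebra_simps sg_def)
  qed
  finally have "usum (\<lambda>u v. sg (fst a * word_degree u) (if u = [] then 0 else tsum f (Suc s) (\<lambda>t. \<phi> (F u # t)) (a # v))) w
    = of_nat (Suc s) * usum (\<lambda>x. tsum f (Suc s) (\<lambda>t. \<phi> (F (a # x) # t))) w"
    unfolding tsum.simps F_def .
  moreover have "tsum f (Suc (Suc s)) \<phi> (a # w) = usum (\<lambda>u. tsum f (Suc s) (\<lambda>t. \<phi> (F (a # u) # t))) w
    + usum (\<lambda>u v. sg (fst a * word_degree u) (if u = [] then 0 else tsum f (Suc s) (\<lambda>t. \<phi> (F u # t)) (a # v))) w"
    unfolding tsum.simps(2)[of f "Suc s"] F_def by (simp del: tsum.simps)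
  ultimately show ?case
    by (simp add: F_def distrib_right del: tsum.simps)
qed

text \<open>The factor from \<open>tsum_Suc_Cons\<close> turns \<open>1/(s+1)!\<close> into
  \<open>1/s!\<close>. What is left is the recursion of \<open>esum\<close>, which always lists the
  block of the first letter first.\<close>

lemma sum_tsum_eq_esum:
  fixes \<phi> :: "'b gword \<Rightarrow> complex"
  assumes f: "maps_words A B 0 f" and "set w \<subseteq> A" and "symmetric_on B \<phi>"
  shows "(\<Sum>s\<le>length w. tsum f s \<phi> w / fact s) = esum f \<phi> w"
  using assms(2,3)
proof (induction "length w" arbitrary: w \<phi> rule: less_induct)
  case less
  show ?case
  proof (cases w)
    case (Cons a w')
    define \<psi> where "\<psi> u t = \<phi> ((word_degree (a # u), f (a # u)) # t)" for u t
    have div: "usum \<chi> v / c = usum (\<lambda>x y. \<chi> x y / c) v" for \<chi> :: "_ \<Rightarrow> _ \<Rightarrow> complex" and v c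
      by (rule usum_pull_UNIV) (simp add: add_divide_distrib)
    have "(\<Sum>s\<le>length w. tsum f s \<phi> w / fact s) = (\<Sum>s\<le>length w'. tsum f (Suc s) \<phi> (a # w') / fact (Suc s))"
      unfolding Cons by (simp add: sum.atMost_Suc_shift del: tsum.simps(2) sum.atMost_Suc)
    also have "\<dots> = (\<Sum>s\<le>length w'. usum (\<lambda>u v. tsum f s (\<psi> u) v / fact s) w')"
    proof (intro sum.cong refl)
      fix s
      have "tsum f (Suc s) \<phi> (a # w') = of_nat (Suc s) * usum (\<lambda>u v. tsum f s (\<psi> u) v) w'"
        unfolding \<psi>_def using less.prems by (intro tsum_Suc_Cons[OF f]) (simp_all add: Cons)
      moreover have "(of_nat (Suc s) :: complex) \<noteq> 0" by (rule of_nat_neq_0)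
      ultimately show "tsum f (Suc s) \<phi> (a # w') / fact (Suc s) = usum (\<lambda>u v. tsum f s (\<psi> u) v / fact s) w'"
        unfolding div[symmetric] fact_Suc of_nat_mult[symmetric] by (simp del: of_nat_Suc tsum.simps)
    qed
    also have "\<dots> = usum (\<lambda>u v. \<Sum>s\<le>length w'. tsum f s (\<psi> u) v / fact s) w'"
      by (rule usum_sum[symmetric])
    also have "\<dots> = usum (\<lambda>u v. esum f (\<psi> u) v) w'"
    proof (rule usum_cong')
      fix u v assume uv: "length u + length v = length w'" "set u \<union> set v = set w'"
      then have A: "set (a # u) \<subseteq> A" "set v \<subseteq> A" using less.prems(1) Cons by auto
      have "(word_degree (a # u), f (a # u)) \<in> B" using maps_wordsD[OF f _ A(1)] by simp
      then have sym: "symmetric_on B (\<psi> u)"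
        unfolding \<psi>_def by (rule symmetric_on_Cons[OF less.prems(2)])
      \<comment> \<open>More nonempty blocks than letters are impossible, so the range of
        \<open>s\<close> can shrink to the one in the induction hypothesis.\<close>
      have "(\<Sum>s\<le>length w'. tsum f s (\<psi> u) v / fact s) = (\<Sum>s\<le>length v. tsum f s (\<psi> u) v / fact s)"
        using uv(1) by (intro sum.mono_neutral_right) (auto simp: tsum_long)
      also have "\<dots> = esum f (\<psi> u) v"
        using uv(1) by (intro less.hyps A(2) sym) (simp add: Cons)
      finally show "(\<Sum>s\<le>length w'. tsum f s (\<psi> u) v / fact s) = esum f (\<psi> u) v" .
    qed
    also have "\<dots> = esum f \<phi> w" by (simp add: Cons \<psi>_def[abs_def])
    finally show ?thesis .
  qed simp
qed

text \<open>By the symmetry of \<open>\<phi>\<close>, ordered distributions weighted by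
  \<open>1/s!\<close> amount to the unordered ones summed by \<open>esum\<close>.\<close>

lemma free_eval_coalgebra_morphism:
  assumes f: "maps_words A B 0 f" and w: "set w \<subseteq> A" and \<phi>: "symmetric_on B \<phi>"
  shows "free_eval \<phi> (coalgebra_morphism f w) = esum f \<phi> w"
proof -
  let ?n = "length w"
  define \<Phi> where "\<Phi> us = (if [] \<in> set us then 0 else \<phi> (map (\<lambda>v. (word_degree v, f v)) us))" for us
  let ?F = "\<lambda>ns. \<Sum>\<sigma>\<in>unshuffles ns. koszul_sign \<sigma> w * \<Phi> (split_blocks ns (permute_list \<sigma> w))"
  have lens: "map length (split_blocks ns (permute_list \<sigma> w)) = ns" if "sum_list ns = ?n" for ns \<sigma>
    using length_nth_split_blocks[of ns "permute_list \<sigma> w"] that by simp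
  have empty: "[] \<in> set (split_blocks ns (permute_list \<sigma> w)) \<longleftrightarrow> 0 \<in> set ns" if "sum_list ns = ?n" for ns \<sigma>
    by (subst (2) lens[OF that, of \<sigma>, symmetric]) auto
  have "free_eval \<phi> (coalgebra_morphism f w) = (\<Sum>ns\<in>compositions ?n. ?F ns / fact (length ns))"
    unfolding coalgebra_morphism_def free_eval_sum free_eval_single sum_divide_distrib
    by (intro sum.cong refl) (auto simp: \<Phi>_def empty compositions_def)
  \<comment> \<open>Group by the number \<open>s\<close> of blocks. Lists of lengths containing zero
    may be added, since \<open>\<Phi>\<close> vanishes as soon as one block is empty.\<close>
  also have "\<dots> = (\<Sum>(s, ns)\<in>(SIGMA s:{..?n}. {ns. length ns = s \<and> sum_list ns = ?n}). ?F ns / fact s)"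
  proof -
    have le: "length ns \<le> sum_list ns" if "0 \<notin> set ns" for ns :: "nat list"
      using that by (induction ns) auto
    have fin: "finite (SIGMA s:{..?n}. {ns. length ns = s \<and> sum_list ns = ?n})"
      by (intro finite_SigmaI finite_block_lengths) simp
    have "(\<Sum>ns\<in>compositions ?n. ?F ns / fact (length ns)) =
      (\<Sum>(s, ns)\<in>(\<lambda>ns. (length ns, ns)) ` compositions ?n. ?F ns / fact s)"
      by (subst sum.reindex) (auto simp: inj_on_def)
    also have "\<dots> = (\<Sum>(s, ns)\<in>(SIGMA s:{..?n}. {ns. length ns = s \<and> sum_list ns = ?n}). ?F ns / fact s)"
    proof (rule sum.mono_neutral_left[OF fin])
      show "(\<lambda>ns. (length ns, ns)) ` compositions ?n \<subseteq> (SIGMA s:{..?n}. {ns. length ns = s \<and> sum_list ns = ?n})"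
        by (auto simp: compositions_def dest: le)
      show "\<forall>x\<in>(SIGMA s:{..?n}. {ns. length ns = s \<and> sum_list ns = ?n}) - (\<lambda>ns. (length ns, ns)) ` compositions ?n.
          (case x of (s, ns) \<Rightarrow> ?F ns / fact s) = 0"
        by (auto simp: compositions_def \<Phi>_def empty intro!: sum.neutral)
    qed
    finally show ?thesis .
  qed
  also have "\<dots> = (\<Sum>s\<le>?n. \<Sum>ns | length ns = s \<and> sum_list ns = ?n. ?F ns / fact s)"
    by (rule sum.Sigma[symmetric]) (simp_all add: finite_block_lengths)
  also have "\<dots> = (\<Sum>s\<le>?n. tsum f s \<phi> w / fact s)"
    unfolding sum_divide_distrib[symmetric] sum_unshuffles_eq_csum
    by (simp add: \<Phi>_def[abs_def] csum_eq_tsum)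
  also have "\<dots> = esum f \<phi> w"
    by (rule sum_tsum_eq_esum[OF assms])
  finally show ?thesis .
qed

section \<open>\<open>L\<^sub>\<infinity>\<close>-algebras and quasi-isomorphisms\<close>

lemma graded_vector_space_shift:
  "graded_vector_space V \<Longrightarrow> graded_vector_space (shift V)"
  by (simp add: graded_vector_space_def shift_def)

lemma shift_simps [simp]: "smul (shift V) = smul V" "homog (shift V) i = homog V (i + 1)"
  by (simp_all add: shift_def)

lemma sym_multilinear_symmetric_on:
  "graded_vector_space U \<Longrightarrow> graded_vector_space W \<Longrightarrow> sym_multilinear U W e \<phi> \<Longrightarrow>
   symmetric_on (letters U) \<phi>"
  unfolding symmetric_on_def using sym_multilinearD(4) by blast

lemma head_additive_sg:
  assumes "head_additive B \<phi>" "set t \<subseteq> B" "(d, x) \<in> B"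
  shows "\<phi> ((d, sg k x) # t) = sg k (\<phi> ((d, x) # t))"
  using additive_onD(8)[of "{x. (d, x) \<in> B}" "\<lambda>x. \<phi> ((d, x) # t)" x k] assms
  by (simp add: head_additive_def)

text \<open>Evaluating \<open>\<psi>\<close> on \<open>Q F\<close> means evaluating
  \<open>cod q \<psi>\<close> on \<open>F\<close>, and \<open>free_eval_coalgebra_morphism\<close>
  asks for a symmetric function there.\<close>

lemma symmetric_on_cod:
  assumes gvs: "graded_vector_space U" "graded_vector_space X"
    and q: "sym_multilinear U U 1 q" and \<psi>: "sym_multilinear U X e \<psi>"
  shows "symmetric_on (letters U) (cod q \<psi>)"
  unfolding symmetric_on_def cod_def
proof (intro allI impI)
  note q = sym_multilinearD[OF gvs(1,1) q] and \<psi> = sym_multilinearD[OF gvs \<psi>]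
  fix u v a b
  assume uv: "set u \<union> set v \<subseteq> letters U" and ab: "a \<in> letters U" "b \<in> letters U"
  show "usum (\<lambda>u v. if u = [] then 0 else \<psi> ((word_degree u + 1, q u) # v)) (u @ a # b # v) =
    sg (fst a * fst b) (usum (\<lambda>u v. if u = [] then 0 else \<psi> ((word_degree u + 1, q u) # v)) (u @ b # a # v))"
  proof (rule usum_symmetric, goal_cases)
    case (1 p r s)
    then have pr: "set p \<union> set r \<subseteq> letters U" "set s \<subseteq> letters U" using uv by auto
    have "(word_degree (p @ b # a # r) + 1, q (p @ b # a # r)) \<in> letters U"
      using pr ab by (intro maps_wordsD[OF q(1)]) auto
    from head_additive_sg[OF \<psi>(5) pr(2) this]
    show ?case using q(4)[OF pr(1) ab] by (simp add: algebra_simps)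
  next
    case (2 p r s)
    then have pr: "set p \<union> set r \<subseteq> letters U" "set s \<subseteq> letters U" using uv by auto
    show ?case
    proof (cases "s = []")
      case False
      have "(word_degree s + 1, q s) \<in> letters U"
        by (rule maps_wordsD[OF q(1) False pr(2)])
      then show ?thesis
        using \<psi>(4)[of "(word_degree s + 1, q s) # p" r a b] pr ab False by simp
    qed simp
  qed
qed

text \<open>
  A coderivation \<open>Q\<close> of odd degree has as square the coderivation with corestriction \<open>q \<circ> Q\<close>:
  the terms where both copies of \<open>q\<close> act on disjoint sets of letters cancel in pairs.
\<close>

lemma cod_cod_zero:
  assumes U: "graded_vector_space U" and q: "sym_multilinear U U 1 q"
    and jacobi: "\<And>w. w \<in> words U \<Longrightarrow> cod q q w = 0"
    and \<psi>: "sym_multilinear U scalars 0 \<psi>" and w: "w \<in> words U"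
  shows "cod q (cod q \<psi>) w = 0"
proof -
  note q = sym_multilinearD[OF U U q]
    and \<psi> = sym_multilinearD[OF U graded_vector_space_scalars \<psi>]
  have w': "set w \<subseteq> letters U" using w by (simp add: words_iff)
  define Q where "Q u = (word_degree u + 1, q u)" for u
  have Q: "Q u \<in> letters U" if "u \<noteq> []" "set u \<subseteq> letters U" for u
    using maps_wordsD[OF q(1) that] by (simp add: Q_def)
  define X where "X u v = usum (\<lambda>x y. if u = [] \<or> x = [] then 0
      else sg (fst (Q u) * word_degree x) (\<psi> (Q x # Q u # y))) v" for u v
  have "cod q (cod q \<psi>) w =
      usum (\<lambda>u v. usum (\<lambda>x y. if u = [] then 0 else \<psi> (Q (Q u # x) # y)) v + X u v) w"
    unfolding cod_def Q_def[symmetric]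
  proof (intro usum_cong refl)
    fix u v :: "'a gword"
    show "(if u = [] then 0 else usum (\<lambda>u v. if u = [] then 0 else \<psi> (Q u # v)) (Q u # v)) =
      usum (\<lambda>x y. if u = [] then 0 else \<psi> (Q (Q u # x) # y)) v + X u v"
      unfolding X_def by (cases "u = []") (simp_all add: if_distrib[of "sg _"] cong: if_cong)
  qed
  also have "\<dots> = usum (\<lambda>u v. usum (\<lambda>x y. if u = [] then 0 else \<psi> (Q (Q u # x) # y)) v) w + usum X w"
    by (rule usum_add)
  also have "usum (\<lambda>u v. usum (\<lambda>x y. if u = [] then 0 else \<psi> (Q (Q u # x) # y)) v) w
    = usum (\<lambda>z y. usum (\<lambda>u x. if u = [] then 0 else \<psi> (Q (Q u # x) # y)) z) w"
    by (rule usum_coassoc[symmetric])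
  also have "\<dots> = usum (\<lambda>z y. 0) w"
  proof (rule usum_cong')
    fix z y assume zy: "set z \<union> set y = set w"
    then have z: "set z \<subseteq> letters U" and y: "set y \<subseteq> letters U" using w' by auto
    have H: "additive_on {x. (word_degree z + 2, x) \<in> letters U} (\<lambda>x. \<psi> ((word_degree z + 2, x) # y))"
      using \<psi>(5) y by (simp add: head_additive_def)
    have "\<psi> ((word_degree z + 2, cod q q z) # y) = usum (\<lambda>u x. \<psi> ((word_degree z + 2,
        if u = [] then 0 else q (Q u # x)) # y)) z"
      unfolding cod_def Q_def[symmetric]
    proof (rule usum_pull[OF H])
      fix u x assume ux: "word_degree u + word_degree x = word_degree z" "set u \<union> set x = set z"
      have "Q (Q u # x) \<in> letters U" if "u \<noteq> []"
        using Q[OF that] ux z by (intro Q) auto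
      moreover have "Q (Q u # x) = (word_degree z + 2, q (Q u # x))"
        using ux by (simp add: Q_def)
      ultimately show "(if u = [] then 0 else q (Q u # x)) \<in> {x. (word_degree z + 2, x) \<in> letters U}"
        using additive_onD(1)[OF H] by auto
    qed
    also have "\<dots> = usum (\<lambda>u x. if u = [] then 0 else \<psi> (Q (Q u # x) # y)) z"
      by (rule usum_cong') (auto simp: Q_def additive_onD(2)[OF H] add.commute[of 2])
    finally have "usum (\<lambda>u x. if u = [] then 0 else \<psi> (Q (Q u # x) # y)) z =
      \<psi> ((word_degree z + 2, cod q q z) # y)" ..
    also have "cod q q z = 0"
      using jacobi[of z] z by (cases "z = []") (auto simp: words_iff cod_def)
    finally show "usum (\<lambda>u x. if u = [] then 0 else \<psi> (Q (Q u # x) # y)) z = 0"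
      using additive_onD(2)[OF H] by simp
  qed
  finally have eq: "cod q (cod q \<psi>) w = usum X w" by simp
  \<comment> \<open>Exchanging the blocks \<open>u\<close> and \<open>x\<close> reproduces each term
    up to sign. Both letters \<open>Q u\<close> and \<open>Q x\<close> have their degree raised by
    one, and these shifts leave a total factor of -1, so the sum is its own negative.\<close>
  have "usum X w = usum (\<lambda>x v. usum (\<lambda>u y. sg (word_degree u * word_degree x) (if u = [] \<or> x = [] then 0
      else sg (fst (Q u) * word_degree x) (\<psi> (Q x # Q u # y)))) v) w"
    unfolding X_def[abs_def] by (rule usum_swap)
  also have "\<dots> = usum (\<lambda>x v. - X x v) w"
    unfolding X_def usum_minus[symmetric]
  proof (intro usum_cong')
    fix x v u y assume xv: "set x \<union> set v = set w" "set u \<union> set y = set v"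
    then have A: "set x \<subseteq> letters U" "set u \<subseteq> letters U" "set y \<subseteq> letters U" using w' by auto
    show "sg (word_degree u * word_degree x) (if u = [] \<or> x = [] then 0
        else sg (fst (Q u) * word_degree x) (\<psi> (Q x # Q u # y))) =
      - (if x = [] \<or> u = [] then 0 else sg (fst (Q x) * word_degree u) (\<psi> (Q u # Q x # y)))"
    proof (cases "u = [] \<or> x = []")
      case False
      have "\<psi> (Q x # Q u # y) = sg (fst (Q x) * fst (Q u)) (\<psi> (Q u # Q x # y))"
        using \<psi>(4)[of "[]" y "Q x" "Q u"] Q False A by simp
      then show ?thesis using False by (simp add: Q_def sg_def)
    qed auto
  qed
  finally have "usum X w = - usum X w" by (simp add: usum_minus)
  then show ?thesis unfolding eq by (simp add: eq_neg_iff_add_eq_0)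
qed

text \<open>Membership in the relations is tested on symmetric functionals, where
  \<open>cod_cod_zero\<close> reduces the square of the coderivation to its corestriction.\<close>

lemma Linf_algebraI:
  assumes "graded_vector_space V" "sym_multilinear (shift V) (shift V) 1 q"
    and "\<And>w. w \<in> words (shift V) \<Longrightarrow> cod q q w = 0"
  shows "Linf_algebra V q"
  unfolding Linf_algebra_def
proof (intro conjI ballI)
  note U = graded_vector_space_shift[OF assms(1)]
  fix w assume w: "w \<in> words (shift V)"
  show "linear_extension (coderivation q) (coderivation q w) \<in> sym_relations (shift V)"
  proof (rule sym_relationsI[OF U])
    fix \<psi> assume \<psi>: "sym_multilinear (shift V) scalars 0 \<psi>"
    have "free_eval \<psi> (linear_extension (coderivation q) (coderivation q w)) = cod q (cod q \<psi>) w"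
      unfolding free_eval_linear_extension free_eval_coderivation ..
    then show "free_eval \<psi> (linear_extension (coderivation q) (coderivation q w)) = 0"
      using cod_cod_zero[OF U assms(2,3) \<psi> w] by simp
  qed
qed (use assms in auto)

text \<open>In cohomology \<open>\<pi> f = id\<close> gives injectivity. For a cocycle
  \<open>y\<close> the homotopy identity makes \<open>f (\<pi> y)\<close> differ from
  \<open>y\<close> by a coboundary, which gives surjectivity.\<close>

lemma quasi_isomorphismI:
  assumes V: "graded_vector_space V" and W: "graded_vector_space W"
    and d: "graded_linear V V 1 d" and d': "graded_linear W W 1 d'"
    and f: "graded_linear V W 0 f" and \<pi>: "graded_linear W V 0 \<pi>" and K: "graded_linear W W (-1) K"
    and f_chain: "\<And>i x. x \<in> homog V i \<Longrightarrow> f (i + 1) (d i x) = d' i (f i x)"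
    and \<pi>_chain: "\<And>i y. y \<in> homog W i \<Longrightarrow> \<pi> (i + 1) (d' i y) = d i (\<pi> i y)"
    and \<pi>f: "\<And>i x. x \<in> homog V i \<Longrightarrow> \<pi> i (f i x) = x"
    and homotopy: "\<And>i y. y \<in> homog W i \<Longrightarrow> d' (i - 1) (K i y) + K (i + 1) (d' i y) = f i (\<pi> i y) - y"
  shows "quasi_isomorphism V d W d' f"
  unfolding quasi_isomorphism_def
proof (intro conjI allI ballI)
  show "graded_linear V W 0 f" by (rule f)
  show "f (i + 1) (d i x) = d' i (f i x)" if "x \<in> homog V i" for i x by (rule f_chain[OF that])
  have equiv: "equiv (cocycles X e i) (cohomologous X e i)"
    if X: "graded_vector_space X" and e: "graded_linear X X 1 e"
    for X :: "('x::ab_group_add, 'y) graded_space_scheme" and e i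
  proof -
    note e = graded_linearD[OF X X e] and X = graded_vector_spaceD[OF X]
    show ?thesis
    proof (rule equivI)
      show "cohomologous X e i \<subseteq> cocycles X e i \<times> cocycles X e i"
        by (auto simp: cohomologous_def)
      show "refl_on (cocycles X e i) (cohomologous X e i)"
        using X(2)[of "i - 1"] e(4)[of "i - 1"] by (auto simp: refl_on_def cohomologous_def image_iff intro!: bexI[of _ 0])
      show "sym (cohomologous X e i)"
      proof (rule symI)
        fix x y assume "(x, y) \<in> cohomologous X e i"
        then obtain z where z: "x \<in> cocycles X e i" "y \<in> cocycles X e i" "z \<in> homog X (i - 1)"
            "x - y = e (i - 1) z"
          by (auto simp: cohomologous_def)
        have "y - x = - e (i - 1) z" unfolding z(4)[symmetric] by simp
        also have "\<dots> = e (i - 1) (- z)" using e(5)[OF z(3)] by simp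
        finally show "(y, x) \<in> cohomologous X e i"
          using z X(5)[OF z(3)] by (auto simp: cohomologous_def)
      qed
      show "trans (cohomologous X e i)"
      proof (rule transI)
        fix x y z assume "(x, y) \<in> cohomologous X e i" "(y, z) \<in> cohomologous X e i"
        then obtain a b where "x \<in> cocycles X e i" "z \<in> cocycles X e i" "a \<in> homog X (i - 1)"
           "b \<in> homog X (i - 1)" "x - y = e (i - 1) a" "y - z = e (i - 1) b"
          by (auto simp: cohomologous_def)
        moreover from this have "x - z = e (i - 1) (a + b)"
          by (simp add: e(2)) (metis add_diff_cancel_left' diff_add_cancel diff_add_eq)
        ultimately show "(x, z) \<in> cohomologous X e i"
          using X(3)[of a "i - 1" b] by (auto simp: cohomologous_def)
      qed
    qed
  qed
  fix i
  note eqV = equiv[OF V d, of i] and eqW = equiv[OF W d', of i]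
  have f_cocycle: "f i x \<in> cocycles W d' i" if "x \<in> cocycles V d i" for x
    using that f_chain[of x i] graded_linearD(1)[OF V W f, of x i] graded_linearD(4)[OF V W f]
    by (auto simp: cocycles_def)
  have \<pi>_cocycle: "\<pi> i y \<in> cocycles V d i" if "y \<in> cocycles W d' i" for y
    using that \<pi>_chain[of y i] graded_linearD(1)[OF W V \<pi>, of y i] graded_linearD(4)[OF W V \<pi>]
    by (auto simp: cocycles_def)
  have f_cohom: "(f i x, f i y) \<in> cohomologous W d' i" if xy: "(x, y) \<in> cohomologous V d i" for x y
  proof -
    obtain z where z: "x \<in> cocycles V d i" "y \<in> cocycles V d i" "z \<in> homog V (i - 1)" "x - y = d (i - 1) z"
      using xy by (auto simp: cohomologous_def)
    have "f i x - f i y = f i (x - y)"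
      using z graded_linearD(6)[OF V W f, of x i y] unfolding cocycles_def by simp
    also have "\<dots> = d' (i - 1) (f (i - 1) z)"
      using f_chain[OF z(3)] z(4) by simp
    finally show ?thesis
      using z f_cocycle graded_linearD(1)[OF V W f z(3)] by (auto simp: cohomologous_def)
  qed
  have image: "cohomologous W d' i `` (f i ` (cohomologous V d i `` {x})) = cohomologous W d' i `` {f i x}"
    if x: "x \<in> cocycles V d i" for x
  proof -
    have "(x, x) \<in> cohomologous V d i" using eqV x by (meson equiv_class_self Image_singleton_iff)
    moreover have "cohomologous W d' i `` {f i y} = cohomologous W d' i `` {f i x}"
      if "(x, y) \<in> cohomologous V d i" for y
      using equiv_class_eq[OF eqW f_cohom[OF that]] ..
    ultimately show ?thesis by blast
  qed
  show "bij_betw (\<lambda>X. cohomologous W d' i `` (f i ` X)) (cohomology V d i) (cohomology W d' i)"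
    unfolding bij_betw_def
  proof
    show "inj_on (\<lambda>X. cohomologous W d' i `` (f i ` X)) (cohomology V d i)"
    proof (rule inj_onI)
      fix X Y assume XY: "X \<in> cohomology V d i" "Y \<in> cohomology V d i"
        "cohomologous W d' i `` (f i ` X) = cohomologous W d' i `` (f i ` Y)"
      then obtain x y where x: "x \<in> cocycles V d i" "X = cohomologous V d i `` {x}"
        and y: "y \<in> cocycles V d i" "Y = cohomologous V d i `` {y}"
        by (auto simp: cohomology_def elim!: quotientE)
      have "cohomologous W d' i `` {f i x} = cohomologous W d' i `` {f i y}"
        using XY(3) image x y by simp
      then have "(f i x, f i y) \<in> cohomologous W d' i"
        using eq_equiv_class[OF _ eqW f_cocycle[OF y(1)]] by blast
      then obtain z where z: "z \<in> homog W (i - 1)" "f i x - f i y = d' (i - 1) z"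
        by (auto simp: cohomologous_def)
      have h: "x \<in> homog V i" "y \<in> homog V i" using x y by (auto simp: cocycles_def)
      have "x - y = \<pi> i (f i x) - \<pi> i (f i y)" by (simp add: \<pi>f h)
      also have "\<dots> = \<pi> i (d' (i - 1) z)"
        using graded_linearD(6)[OF W V \<pi>] graded_linearD(1)[OF V W f] h by (simp flip: z(2))
      also have "\<dots> = d (i - 1) (\<pi> (i - 1) z)"
        using \<pi>_chain[OF z(1)] by simp
      finally have "(x, y) \<in> cohomologous V d i"
        using x y graded_linearD(1)[OF W V \<pi> z(1)] by (auto simp: cohomologous_def)
      then show "X = Y" using equiv_class_eq[OF eqV] x y by simp
    qed
    show "(\<lambda>X. cohomologous W d' i `` (f i ` X)) ` cohomology V d i = cohomology W d' i"
    proof (intro equalityI subsetI)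
      fix Y assume "Y \<in> (\<lambda>X. cohomologous W d' i `` (f i ` X)) ` cohomology V d i"
      then obtain x where "x \<in> cocycles V d i" "Y = cohomologous W d' i `` (f i ` (cohomologous V d i `` {x}))"
        by (auto simp: cohomology_def elim!: quotientE)
      then show "Y \<in> cohomology W d' i"
        using image f_cocycle by (auto simp: cohomology_def quotientI)
    next
      fix Y assume "Y \<in> cohomology W d' i"
      then obtain y where y: "y \<in> cocycles W d' i" "Y = cohomologous W d' i `` {y}"
        by (auto simp: cohomology_def elim!: quotientE)
      then have h: "y \<in> homog W i" "d' i y = 0" by (auto simp: cocycles_def)
      have "f i (\<pi> i y) - y = d' (i - 1) (K i y)"
        using homotopy[OF h(1)] h(2) graded_linearD(4)[OF W W K] by simp
      then have "(f i (\<pi> i y), y) \<in> cohomologous W d' i"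
        using y(1) f_cocycle[OF \<pi>_cocycle] graded_linearD(1)[OF W W K h(1)]
        by (auto simp: cohomologous_def)
      then have "Y = cohomologous W d' i `` (f i ` (cohomologous V d i `` {\<pi> i y}))"
        using image[OF \<pi>_cocycle[OF y(1)]] y(2) equiv_class_eq[OF eqW] by simp
      then show "Y \<in> (\<lambda>X. cohomologous W d' i `` (f i ` X)) ` cohomology V d i"
        using \<pi>_cocycle[OF y(1)] by (auto simp: cohomology_def quotientI)
    qed
  qed
qed

lemma Linf_quasi_isomorphism_transfer:
  assumes V: "graded_vector_space V" and D: "Linf_algebra D q"
    and T: "homotopy_transfer (shift V) (shift D) q \<delta> \<iota> \<pi> K"
    and \<pi>\<iota>: "\<And>i x. x \<in> homog (shift V) i \<Longrightarrow> \<pi> i (\<iota> i x) = x"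
  shows "\<exists>p f. Linf_algebra V p \<and> Linf_quasi_isomorphism V p D q f \<and>
    linear_part p = \<delta> \<and> linear_part f = \<iota>"
proof -
  interpret homotopy_transfer "shift V" "shift D" q \<delta> \<iota> \<pi> K by (rule T)
  have p_alg: "Linf_algebra V p"
    by (rule Linf_algebraI[OF V p cod_p_p])
  have lin: "linear_part p = \<delta>" "linear_part f = \<iota>"
    by (simp_all add: fun_eq_iff linear_part_def p_single f_single)
  have "Linf_morphism V p D q f"
    unfolding Linf_morphism_def
  proof (intro conjI ballI p_alg D f)
    fix w assume w: "w \<in> words (shift V)"
    show "linear_extension (coalgebra_morphism f) (coderivation p w)
      - linear_extension (coderivation q) (coalgebra_morphism f w) \<in> sym_relations (shift D)"
    proof (rule sym_relationsI[OF gvs(2)])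
      fix \<psi> assume \<psi>: "sym_multilinear (shift D) scalars 0 \<psi>"
      note \<psi>_props = sym_multilinearD[OF gvs(2) graded_vector_space_scalars \<psi>]
      note sym = sym_multilinear_symmetric_on[OF gvs(2) graded_vector_space_scalars \<psi>]
      have w': "set w \<subseteq> letters (shift V)" using w by (simp add: words_iff)
      have "free_eval \<psi> (linear_extension (coalgebra_morphism f) (coderivation p w)) =
          cod p (\<lambda>v. free_eval \<psi> (coalgebra_morphism f v)) w"
        unfolding free_eval_linear_extension free_eval_coderivation ..
      also have "\<dots> = cod p (esum f \<psi>) w"
        unfolding cod_def
      proof (rule usum_cong')
        fix u v assume "set u \<union> set v = set w"
        then have uv: "set u \<subseteq> letters (shift V)" "set v \<subseteq> letters (shift V)" using w' by auto
        show "(if u = [] then 0 else free_eval \<psi> (coalgebra_morphism f ((word_degree u + 1, p u) # v))) =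
          (if u = [] then 0 else esum f \<psi> ((word_degree u + 1, p u) # v))"
        proof (cases "u = []")
          case False
          then have "set ((word_degree u + 1, p u) # v) \<subseteq> letters (shift V)"
            using maps_wordsD[OF p_props(1) False uv(1)] uv(2) by simp
          from free_eval_coalgebra_morphism[OF f_props(1) this sym] show ?thesis by simp
        qed simp
      qed
      also have "\<dots> = esum f (cod q \<psi>) w"
        by (rule cod_p_esum[OF w \<psi>_props(5)])
      also have "\<dots> = free_eval (cod q \<psi>) (coalgebra_morphism f w)"
        by (rule free_eval_coalgebra_morphism[OF f_props(1) w'
              symmetric_on_cod[OF gvs(2) graded_vector_space_scalars q \<psi>], symmetric])
      also have "\<dots> = free_eval \<psi> (linear_extension (coderivation q) (coalgebra_morphism f w))"
        unfolding free_eval_linear_extension free_eval_coderivation ..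
      finally show "free_eval \<psi> (linear_extension (coalgebra_morphism f) (coderivation p w)
          - linear_extension (coderivation q) (coalgebra_morphism f w)) = 0"
        by (simp add: free_eval_diff)
    qed
  qed
  moreover have "quasi_isomorphism (shift V) \<delta> (shift D) (linear_part q) \<iota>"
    by (rule quasi_isomorphismI[OF gvs \<delta> graded_linear_linear_part[OF q] \<iota> \<pi> K])
      (use \<iota>_chain \<pi>_chain homotopy \<pi>\<iota> in \<open>simp_all add: linear_part_def\<close>)
  ultimately show ?thesis
    using p_alg lin by (intro exI[of _ p] exI[of _ f]) (simp add: Linf_quasi_isomorphism_def)
qed

section \<open>DGLAs as \<open>L\<^sub>\<infinity>\<close>-algebras\<close>

lemma graded_linearI:
  assumes "graded_vector_space V" "graded_vector_space W"
    and mem: "\<And>i x. x \<in> homog V i \<Longrightarrow> f i x \<in> homog W (i + e)"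
    and lin: "\<And>i c x y. x \<in> homog V i \<Longrightarrow> y \<in> homog V i \<Longrightarrow>
      f i (smul V c x + y) = smul W c (f i x) + f i y"
  shows "graded_linear V W e f"
proof -
  note V = graded_vector_spaceD[OF assms(1)] and W = graded_vector_spaceD[OF assms(2)]
  have zero: "f i 0 = 0" for i
    using lin[OF V(2)[of i] V(2)[of i], of "-1"] by (simp add: V W)
  show ?thesis
    unfolding graded_linear_def
    using mem lin[of _ _ _ 1] lin[OF _ V(2)] by (simp add: V W zero)
qed

lemma is_dglaD:
  assumes "is_dgla D"
  shows "graded_vector_space D" "graded_linear D D 1 (diff D)"
    "x \<in> homog D i \<Longrightarrow> diff D (i + 1) (diff D i x) = 0"
    "x \<in> homog D i \<Longrightarrow> graded_linear D D i (\<lambda>j. bracket D i j x)"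
    "y \<in> homog D j \<Longrightarrow> graded_linear D D j (\<lambda>i x. bracket D i j x y)"
    "x \<in> homog D i \<Longrightarrow> y \<in> homog D j \<Longrightarrow> bracket D i j x y \<in> homog D (i + j)"
    "x \<in> homog D i \<Longrightarrow> y \<in> homog D j \<Longrightarrow> bracket D i j x y = - sg (i * j) (bracket D j i y x)"
    "x \<in> homog D i \<Longrightarrow> y \<in> homog D j \<Longrightarrow> z \<in> homog D k \<Longrightarrow>
      bracket D i (j + k) x (bracket D j k y z) =
        bracket D (i + j) k (bracket D i j x y) z + sg (i * j) (bracket D j (i + k) y (bracket D i k x z))"
    "x \<in> homog D i \<Longrightarrow> y \<in> homog D j \<Longrightarrow>
      diff D (i + j) (bracket D i j x y) =
        bracket D (i + 1) j (diff D i x) y + sg i (bracket D i (j + 1) x (diff D j y))"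
proof -
  note d = assms[unfolded is_dgla_def]
  show gvs: "graded_vector_space D" using d by (elim conjE)
  note V = graded_vector_spaceD[OF gvs]
  show "graded_linear D D 1 (diff D)" using d by (elim conjE)
  show "x \<in> homog D i \<Longrightarrow> diff D (i + 1) (diff D i x) = 0" using d by blast
  show right: "x \<in> homog D i \<Longrightarrow> graded_linear D D i (\<lambda>j. bracket D i j x)" using d by blast
  show "y \<in> homog D j \<Longrightarrow> graded_linear D D j (\<lambda>i x. bracket D i j x y)" using d by blast
  show "x \<in> homog D i \<Longrightarrow> y \<in> homog D j \<Longrightarrow> bracket D i j x y \<in> homog D (i + j)"
    by (subst add.commute) (rule graded_linearD(1)[OF gvs gvs right])
  show "x \<in> homog D i \<Longrightarrow> y \<in> homog D j \<Longrightarrow> bracket D i j x y = - sg (i * j) (bracket D j i y x)"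
    using d unfolding V(14) by blast
  show "x \<in> homog D i \<Longrightarrow> y \<in> homog D j \<Longrightarrow> z \<in> homog D k \<Longrightarrow>
      bracket D i (j + k) x (bracket D j k y z) =
        bracket D (i + j) k (bracket D i j x y) z + sg (i * j) (bracket D j (i + k) y (bracket D i k x z))"
    using d unfolding V(14) by blast
  show "x \<in> homog D i \<Longrightarrow> y \<in> homog D j \<Longrightarrow>
      diff D (i + j) (bracket D i j x y) =
        bracket D (i + 1) j (diff D i x) y + sg i (bracket D i (j + 1) x (diff D j y))"
    using d unfolding V(14) by blast
qed

text \<open>Linearity is asked for in the second argument; antisymmetry carries it over to the
  first.\<close>

lemma is_dglaI:
  assumes gvs: "graded_vector_space D" and d: "graded_linear D D 1 (diff D)"
    and dd: "\<And>i x. x \<in> homog D i \<Longrightarrow> diff D (i + 1) (diff D i x) = 0"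
    and mem: "\<And>i j x y. x \<in> homog D i \<Longrightarrow> y \<in> homog D j \<Longrightarrow> bracket D i j x y \<in> homog D (i + j)"
    and lin: "\<And>i j x y y' c. x \<in> homog D i \<Longrightarrow> y \<in> homog D j \<Longrightarrow> y' \<in> homog D j \<Longrightarrow>
      bracket D i j x (smul D c y + y') = smul D c (bracket D i j x y) + bracket D i j x y'"
    and anti: "\<And>i j x y. x \<in> homog D i \<Longrightarrow> y \<in> homog D j \<Longrightarrow>
      bracket D i j x y = - sg (i * j) (bracket D j i y x)"
    and jacobi: "\<And>i j k x y z. x \<in> homog D i \<Longrightarrow> y \<in> homog D j \<Longrightarrow> z \<in> homog D k \<Longrightarrow>
      bracket D i (j + k) x (bracket D j k y z) =
        bracket D (i + j) k (bracket D i j x y) z + sg (i * j) (bracket D j (i + k) y (bracket D i k x z))"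
    and leibniz: "\<And>i j x y. x \<in> homog D i \<Longrightarrow> y \<in> homog D j \<Longrightarrow>
      diff D (i + j) (bracket D i j x y) =
        bracket D (i + 1) j (diff D i x) y + sg i (bracket D i (j + 1) x (diff D j y))"
  shows "is_dgla D"
  unfolding is_dgla_def
proof (intro conjI allI ballI gvs d)
  note V = graded_vector_spaceD[OF gvs]
  show "graded_linear D D i (\<lambda>j. bracket D i j x)" if x: "x \<in> homog D i" for i x
    by (rule graded_linearI[OF gvs gvs]) (use mem[OF x] lin[OF x] in \<open>auto simp: add.commute\<close>)
  show "graded_linear D D j (\<lambda>i x. bracket D i j x y)" if y: "y \<in> homog D j" for j y
  proof (rule graded_linearI[OF gvs gvs])
    fix i x x' c assume x: "x \<in> homog D i" "x' \<in> homog D i"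
    have "bracket D i j (smul D c x + x') y = - sg (i * j) (bracket D j i y (smul D c x + x'))"
      using x y V by (intro anti) auto
    also have "\<dots> = smul D c (- sg (i * j) (bracket D j i y x)) + - sg (i * j) (bracket D j i y x')"
      unfolding lin[OF y x] by (simp add: V(12,15) sg_add)
    also have "\<dots> = smul D c (bracket D i j x y) + bracket D i j x' y"
      using anti[OF x(1) y] anti[OF x(2) y] by simp
    finally show "bracket D i j (smul D c x + x') y = smul D c (bracket D i j x y) + bracket D i j x' y" .
  qed (use mem y in auto)
  show "bracket D i j x y = - smul D ((-1) powi (i * j)) (bracket D j i y x)"
    if "x \<in> homog D i" "y \<in> homog D j" for i j x y
    unfolding V(14) by (rule anti[OF that])
  show "bracket D i (j + k) x (bracket D j k y z) =
        bracket D (i + j) k (bracket D i j x y) z +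
        smul D ((-1) powi (i * j)) (bracket D j (i + k) y (bracket D i k x z))"
    if "x \<in> homog D i" "y \<in> homog D j" "z \<in> homog D k" for i j k x y z
    unfolding V(14) by (rule jacobi[OF that])
  show "diff D (i + j) (bracket D i j x y) = bracket D (i + 1) j (diff D i x) y +
        smul D ((-1) powi i) (bracket D i (j + 1) x (diff D j y))"
    if "x \<in> homog D i" "y \<in> homog D j" for i j x y
    unfolding V(14) by (rule leibniz[OF that])
qed (rule dd)

lemma dgla_Linf_long: "length w \<ge> 3 \<Longrightarrow> dgla_Linf D w = 0"
  by (cases "(D, w)" rule: dgla_Linf.cases) auto

text \<open>This is decalage: for elements of degrees \<open>i + 1\<close> and \<open>j + 1\<close>
  the antisymmetry sign of the bracket, combined with the factors \<open>(-1)^(i+1)\<close> and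
  \<open>(-1)^(j+1)\<close>, leaves the symmetry sign \<open>(-1)^(i*j)\<close> of the shifted
  degrees.\<close>

lemma sym_multilinear_dgla_Linf:
  assumes "is_dgla D"
  shows "sym_multilinear (shift D) (shift D) 1 (dgla_Linf D)"
proof -
  note D = is_dglaD[OF assms]
  note V = graded_vector_spaceD[OF D(1)] and d = graded_linearD[OF D(1,1) D(2)]
    and r = graded_linearD[OF D(1,1) D(4)] and l = graded_linearD[OF D(1,1) D(5)]
  show ?thesis
  proof (rule sym_multilinearI)
    show gvs: "graded_vector_space (shift D)" "graded_vector_space (shift D)"
      using D(1) by (simp_all add: graded_vector_space_shift)
    fix w assume w: "w \<in> words (shift D)"
    show "dgla_Linf D w \<in> homog (shift D) (word_degree w + 1)"
    proof (cases "length w \<ge> 3")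
      case True
      then show ?thesis by (simp add: dgla_Linf_long V)
    next
      case False
      then consider i x where "w = [(i, x)]" | i x j y where "w = [(i, x), (j, y)]"
        using w by (cases w rule: list.exhaust; cases "tl w"; cases "tl (tl w)") (auto simp: words_iff)
      then show ?thesis
      proof cases
        case (1 i x)
        then show ?thesis using w d(1)[of x "i + 1"] by (auto simp: words_iff V add_ac)
      next
        case (2 i x j y)
        then show ?thesis
          using w D(6)[of x "i + 1" y "j + 1"] by (auto simp: words_iff V(6) add_ac)
      qed
    qed
  next
    fix p q i x y c
    assume pq: "set p \<union> set q \<subseteq> letters (shift D)" and x: "x \<in> homog (shift D) i" "y \<in> homog (shift D) i"
    show "dgla_Linf D (p @ (i, smul (shift D) c x + y) # q) =
      smul (shift D) c (dgla_Linf D (p @ (i, x) # q)) + dgla_Linf D (p @ (i, y) # q)"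
    proof (cases "length p + length q \<ge> 2")
      case True
      then have "dgla_Linf D (p @ (i, z) # q) = 0" for z by (intro dgla_Linf_long) simp
      then show ?thesis by (simp add: V)
    next
      case False
      then consider "p = []" "q = []" | j z where "p = []" "q = [(j, z)]" | j z where "p = [(j, z)]" "q = []"
        by (cases p; cases q; cases "tl p"; cases "tl q") auto
      then show ?thesis
      proof cases
        case 1
        then show ?thesis using x by (simp add: d V)
      next
        case (2 j z)
        then have "z \<in> homog D (j + 1)" using pq by simp
        then show ?thesis using x 2 by (simp add: l(2,3)[of z] V(6,8,14,15) sg_add)
      next
        case (3 j z)
        then have "z \<in> homog D (j + 1)" using pq by simp
        then show ?thesis using x 3 by (simp add: r(2,3)[of z] V(6,8,14,15) sg_add)
      qed
    qed
  next
    fix p q a b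
    assume pq: "set p \<union> set q \<subseteq> letters (shift D)" and ab: "a \<in> letters (shift D)" "b \<in> letters (shift D)"
    show "dgla_Linf D (p @ a # b # q) = sg (fst a * fst b) (dgla_Linf D (p @ b # a # q))"
    proof (cases "length p + length q \<ge> 1")
      case True
      then have "dgla_Linf D (p @ c # e # q) = 0" for c e by (intro dgla_Linf_long) simp
      then show ?thesis by simp
    next
      case False
      obtain i x j y where ab': "a = (i, x)" "b = (j, y)" by (cases a, cases b)
      then have "x \<in> homog D (i + 1)" "y \<in> homog D (j + 1)" using ab by auto
      moreover have "p = []" "q = []" using False by (cases p; cases q; simp)+
      ultimately show ?thesis
        using D(7)[of x "i + 1" y "j + 1"] by (simp add: ab' V(14) sg_def)
    qed
  qed
qed

text \<open>Words of one, two and three letters give that the differential squares to zero, the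
  Leibniz rule and the Jacobi identity. Longer words leave no nonzero composite of two
  operations.\<close>

lemma cod_dgla_Linf:
  assumes "is_dgla D" "w \<in> words (shift D)"
  shows "cod (dgla_Linf D) (dgla_Linf D) w = 0"
proof -
  note D = is_dglaD[OF assms(1)]
  note V = graded_vector_spaceD[OF D(1)] and d = graded_linearD[OF D(1,1) D(2)]
    and r = graded_linearD[OF D(1,1) D(4)] and l = graded_linearD[OF D(1,1) D(5)]
  let ?q = "dgla_Linf D"
  have gvs: "graded_vector_space (shift D)" using D(1) by (rule graded_vector_space_shift)
  note q = sym_multilinearD[OF gvs gvs sym_multilinear_dgla_Linf[OF assms(1)]]
  have zero: "?q ((e, 0) # v) = 0" if "set v \<subseteq> letters (shift D)" for e v
    using additive_onD(2) q(5) that unfolding head_additive_def by blast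
  have w: "set w \<subseteq> letters (shift D)" "w \<noteq> []" using assms(2) by (auto simp: words_iff)
  consider a where "w = [a]" | a b where "w = [a, b]" | a b c where "w = [a, b, c]" | "length w \<ge> 4"
    using w(2) by (cases w; cases "tl w"; cases "tl (tl w)"; cases "tl (tl (tl w))") auto
  then show ?thesis
  proof cases
    case (1 a)
    obtain i x where a: "a = (i, x)" by (cases a)
    then have "x \<in> homog D (i + 1)" using w 1 by simp
    then show ?thesis
      using D(3)[of x "i + 1"] d(1)[of x "i + 1"] by (simp add: cod_def 1 a d(5) add_ac)
  next
    case (2 a b)
    \<comment> \<open>Shifted degrees are written as \<open>i - 1\<close>, so that \<open>i\<close>
      is the degree in \<open>D\<close> itself.\<close>
    obtain i x j y where ab: "a = (i - 1, x)" "b = (j - 1, y)"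
      by (cases a, cases b) (metis add_diff_cancel_right')
    then have xy: "x \<in> homog D i" "y \<in> homog D j" using w 2 by auto
    note dxy = d(1)[OF xy(1)] d(1)[OF xy(2)]
    have "bracket D (i + 1) j (- diff D i x) y = - bracket D (i + 1) j (diff D i x) y"
      using l(5)[OF xy(2) dxy(1)] .
    moreover have "bracket D (j + 1) i (- diff D j y) x = - bracket D (j + 1) i (diff D j y) x"
      using l(5)[OF xy(1) dxy(2)] .
    moreover have "diff D (i + j) (sg i (bracket D i j x y)) = sg i (bracket D (i + 1) j (diff D i x) y
        + sg i (bracket D i (j + 1) x (diff D j y)))"
      using d(7)[OF D(6)[OF xy]] D(9)[OF xy] by simp
    moreover have "bracket D i (j + 1) x (diff D j y) = - sg (i * (j + 1)) (bracket D (j + 1) i (diff D j y) x)"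
      by (rule D(7)[OF xy(1) dxy(2)])
    ultimately show ?thesis
      by (simp add: cod_def 2 ab V(14) add_ac) (simp add: sg_def)
  next
    case (3 a b c)
    obtain i x j y k z where abc: "a = (i - 1, x)" "b = (j - 1, y)" "c = (k - 1, z)"
      by (cases a, cases b, cases c) (metis add_diff_cancel_right')
    then have xyz: "x \<in> homog D i" "y \<in> homog D j" "z \<in> homog D k" using w 3 by auto
    note xy = D(6)[OF xyz(1,2)] and xz = D(6)[OF xyz(1,3)] and yz = D(6)[OF xyz(2,3)]
    have "cod ?q ?q w =
      sg (i + j) (bracket D (i + j) k (sg i (bracket D i j x y)) z)
      + sg ((k - 1) * (j - 1)) (sg (i + k) (bracket D (i + k) j (sg i (bracket D i k x z)) y))
      + sg ((i - 1) * (j - 1 + (k - 1))) (sg (j + k) (bracket D (j + k) i (sg j (bracket D j k y z)) x))"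
      using zero w by (simp add: cod_def 3 abc V(14) d(4) algebra_simps)
    also have "\<dots> = sg j (bracket D (i + j) k (bracket D i j x y) z)
      + sg ((k - 1) * (j - 1) + k) (bracket D (i + k) j (bracket D i k x z) y)
      + sg ((i - 1) * (j + k) + k) (bracket D (j + k) i (bracket D j k y z) x)"
      unfolding l(7)[OF xyz(3) xy] l(7)[OF xyz(2) xz] l(7)[OF xyz(1) yz] by (simp add: sg_def)
    \<comment> \<open>The Jacobi identity, with antisymmetry applied to the outer brackets,
      expresses this double bracket by the other two that occur in the sum.\<close>
    also have "bracket D (i + j) k (bracket D i j x y) z =
        - sg (i * (j + k)) (bracket D (j + k) i (bracket D j k y z) x)
        + sg (i * j) (sg (j * (i + k)) (bracket D (i + k) j (bracket D i k x z) y))"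
      using D(8)[OF xyz] unfolding D(7)[OF xyz(1) yz] D(7)[OF xyz(2) xz]
      by (metis add_diff_cancel_right' sg_simps(4) diff_minus_eq_add)
    also have "sg j (\<dots>) + sg ((k - 1) * (j - 1) + k) (bracket D (i + k) j (bracket D i k x z) y)
      + sg ((i - 1) * (j + k) + k) (bracket D (j + k) i (bracket D j k y z) x) = 0"
      by (simp add: sg_def)
    finally show ?thesis .
  next
    case 4
    have "cod ?q ?q w = usum (\<lambda>u v. 0) w"
      unfolding cod_def
    proof (rule usum_cong')
      fix u v assume uv: "length u + length v = length w" "set u \<union> set v = set w"
      then have v: "set v \<subseteq> letters (shift D)" using w by auto
      \<comment> \<open>With at least four letters, either the inner operation gets three or more of
        them, or at least two remain beside its value; one of the two operations then
        vanishes.\<close>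
      show "(if u = [] then 0 else ?q ((word_degree u + 1, ?q u) # v)) = 0"
        using zero[OF v] uv 4 dgla_Linf_long[of u D] dgla_Linf_long[of "(word_degree u + 1, ?q u) # v" D]
        by (cases "length u \<ge> 3") auto
    qed
    then show ?thesis by simp
  qed
qed

lemma Linf_algebra_dgla_Linf: "is_dgla D \<Longrightarrow> Linf_algebra D (dgla_Linf D)"
  by (rule Linf_algebraI[OF is_dglaD(1) sym_multilinear_dgla_Linf cod_dgla_Linf])

section \<open>Polynomial forms\<close>

lemma graded_linear_sum:
  assumes "graded_vector_space V" "graded_vector_space W" "graded_linear V W e f"
    and "\<And>k. k \<in> A \<Longrightarrow> x k \<in> homog V i"
  shows "(\<Sum>k\<in>A. x k) \<in> homog V i \<and> f i (\<Sum>k\<in>A. x k) = (\<Sum>k\<in>A. f i (x k))"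
  using assms(4)
  by (induction A rule: infinite_finite_induct)
    (auto simp: graded_vector_spaceD[OF assms(1)] graded_linearD[OF assms(1-3)])

definition polys :: "('a::ab_group_add, 'r) graded_space_scheme \<Rightarrow> int \<Rightarrow> 'a poly set" where
  "polys M i = {p. \<forall>k. coeff p k \<in> homog M i}"

definition poly_eval :: "('a::ab_group_add, 'r) graded_space_scheme \<Rightarrow> complex \<Rightarrow> 'a poly \<Rightarrow> 'a" where
  "poly_eval M t p = (\<Sum>k\<le>degree p. smul M (t ^ k) (coeff p k))"

lemma form_eval_eq: "form_eval M t (p, r) = poly_eval M t p"
  by (simp add: form_eval_def poly_eval_def)

lemma coeff_sg [simp]: "coeff (sg k p) n = sg k (coeff p n)"
  by (simp add: sg_def)

lemma coeff_poly_bilinear: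
  assumes "\<And>x. b x 0 = 0" "\<And>y. b 0 y = 0"
  shows "coeff (poly_bilinear b p q) n = (\<Sum>k\<le>n. b (coeff p k) (coeff q (n - k)))"
proof -
  have "coeff (poly_bilinear b p q) n =
      (\<Sum>k\<le>degree p. \<Sum>l\<le>degree q. if k + l = n then b (coeff p k) (coeff q l) else 0)"
    by (simp add: poly_bilinear_def coeff_sum coeff_monom)
  also have "\<dots> = (\<Sum>k\<le>degree p. if k \<le> n then b (coeff p k) (coeff q (n - k)) else 0)"
  proof (intro sum.cong refl)
    fix k
    have "(\<Sum>l\<le>degree q. if k + l = n then b (coeff p k) (coeff q l) else 0) =
      (\<Sum>l\<le>degree q. if l = n - k then if k \<le> n then b (coeff p k) (coeff q (n - k)) else 0 else 0)"
      by (intro sum.cong refl) auto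
    then show "(\<Sum>l\<le>degree q. if k + l = n then b (coeff p k) (coeff q l) else 0) =
      (if k \<le> n then b (coeff p k) (coeff q (n - k)) else 0)"
      by (auto simp: sum.delta coeff_eq_0 assms)
  qed
  also have "\<dots> = (\<Sum>k\<in>{..max n (degree p)}. if k \<le> n then b (coeff p k) (coeff q (n - k)) else 0)"
    by (rule sum.mono_neutral_left) (auto simp: coeff_eq_0 assms)
  also have "\<dots> = (\<Sum>k\<le>n. b (coeff p k) (coeff q (n - k)))"
    by (rule sum.mono_neutral_cong_right) auto
  finally show ?thesis .
qed

locale graded_polys =
  fixes M :: "('m::ab_group_add, 'r) graded_space_scheme"
  assumes gvs: "graded_vector_space M"
begin

lemmas V = graded_vector_spaceD[OF gvs]

lemma smul_diff: "smul M c (x - y) = smul M c x - smul M c y"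
  using V(8)[of c x "- y"] V(12)[of c y] by simp

lemma smul_sum: "smul M c (\<Sum>k\<in>A. x k) = (\<Sum>k\<in>A. smul M c (x k))"
  by (induction A rule: infinite_finite_induct) (auto simp: V)

lemma coeff_map_smul [simp]: "coeff (map_poly (smul M c) p) k = smul M c (coeff p k)"
  by (simp add: coeff_map_poly V)

lemma map_poly_sign [simp]: "map_poly (smul M ((-1) powi k)) p = sg k p"
  by (rule poly_eqI) (simp add: V(14))

lemma polys_add: "p \<in> polys M i \<Longrightarrow> q \<in> polys M i \<Longrightarrow> p + q \<in> polys M i"
  and polys_diff: "p \<in> polys M i \<Longrightarrow> q \<in> polys M i \<Longrightarrow> p - q \<in> polys M i"
  and polys_minus: "p \<in> polys M i \<Longrightarrow> - p \<in> polys M i"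
  and polys_zero: "0 \<in> polys M i"
  and polys_sg: "p \<in> polys M i \<Longrightarrow> sg k p \<in> polys M i"
  and polys_smul: "p \<in> polys M i \<Longrightarrow> map_poly (smul M c) p \<in> polys M i"
  and polys_monom: "x \<in> homog M i \<Longrightarrow> monom x n \<in> polys M i"
  by (auto simp: polys_def V)

lemmas polys_intros = polys_add polys_diff polys_minus polys_zero polys_sg polys_smul polys_monom

lemma poly_eval_eq_sum:
  assumes "degree p \<le> n"
  shows "poly_eval M t p = (\<Sum>k\<le>n. smul M (t ^ k) (coeff p k))"
  unfolding poly_eval_def using assms
  by (intro sum.mono_neutral_left) (auto simp: coeff_eq_0 V)

lemma poly_eval_add [simp]: "poly_eval M t (p + q) = poly_eval M t p + poly_eval M t q"
proof -
  let ?n = "max (degree p) (degree q)"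
  have "degree (p + q) \<le> ?n" by (rule degree_add_le) auto
  then show ?thesis
    by (simp add: poly_eval_eq_sum[of _ ?n] V sum.distrib)
qed

lemma poly_eval_zero [simp]: "poly_eval M t 0 = 0"
  by (simp add: poly_eval_def V)

lemma poly_eval_minus [simp]: "poly_eval M t (- p) = - poly_eval M t p"
  by (simp add: poly_eval_def V sum_negf)

lemma poly_eval_diff [simp]: "poly_eval M t (p - q) = poly_eval M t p - poly_eval M t q"
  using poly_eval_add[of t p "- q"] by simp

lemma poly_eval_sg [simp]: "poly_eval M t (sg k p) = sg k (poly_eval M t p)"
  by (simp add: sg_def)

lemma poly_eval_sum: "poly_eval M t (\<Sum>k\<in>A. p k) = (\<Sum>k\<in>A. poly_eval M t (p k))"
  by (induction A rule: infinite_finite_induct) auto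

lemma poly_eval_monom [simp]: "poly_eval M t (monom x k) = smul M (t ^ k) x"
proof -
  have "poly_eval M t (monom x k) = (\<Sum>j\<le>k. if j = k then smul M (t ^ k) x else 0)"
    by (subst poly_eval_eq_sum[OF degree_monom_le], intro sum.cong) (auto simp: coeff_monom V)
  then show ?thesis by simp
qed

lemma poly_eval_smul [simp]: "poly_eval M t (map_poly (smul M c) p) = smul M c (poly_eval M t p)"
  by (subst poly_eval_eq_sum[OF map_poly_degree_leq])
    (simp add: poly_eval_def smul_sum V mult.commute)

lemma poly_eval_mem: "p \<in> polys M i \<Longrightarrow> poly_eval M t p \<in> homog M i"
  unfolding poly_eval_def
  using graded_linear_sum[OF gvs gvs, of 0 "\<lambda>i x. x" "{..degree p}" "\<lambda>k. smul M (t ^ k) (coeff p k)" i]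
  by (simp add: graded_linear_def polys_def V)

lemma poly_eval_map:
  assumes "graded_linear M M e F" "p \<in> polys M i"
  shows "poly_eval M t (map_poly (F i) p) = F i (poly_eval M t p)"
proof -
  note F = graded_linearD[OF gvs gvs assms(1)]
  have "poly_eval M t (map_poly (F i) p) = (\<Sum>k\<le>degree p. smul M (t ^ k) (F i (coeff p k)))"
    by (subst poly_eval_eq_sum[OF map_poly_degree_leq]) (simp add: coeff_map_poly F)
  also have "\<dots> = (\<Sum>k\<le>degree p. F i (smul M (t ^ k) (coeff p k)))"
    using assms(2) by (intro sum.cong refl F(3)[symmetric]) (simp add: polys_def)
  also have "\<dots> = F i (poly_eval M t p)"
    unfolding poly_eval_def
    by (rule graded_linear_sum[OF gvs gvs assms(1), THEN conjunct2, symmetric])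
      (use assms(2) in \<open>simp add: polys_def V\<close>)
  finally show ?thesis .
qed

lemma polys_map: "graded_linear M M e F \<Longrightarrow> p \<in> polys M i \<Longrightarrow> i + e = j \<Longrightarrow> map_poly (F i) p \<in> polys M j"
  using graded_linearD[OF gvs gvs] by (auto simp: polys_def coeff_map_poly)

text \<open>Linear functionals on the coefficient space reduce this to complex polynomials.\<close>

lemma poly_eval_inject:
  assumes "\<And>t. poly_eval M t p = poly_eval M t q"
  shows "p = q"
proof (rule ccontr)
  assume "p \<noteq> q"
  then obtain k where k: "coeff (p - q) k \<noteq> 0" by (auto simp: poly_eq_iff)
  interpret M: vector_space "smul M" by (rule V(1))
  have "coeff (p - q) k \<in> M.span {}"
  proof (rule M.in_span_if_functionals_vanish)
    fix \<Lambda> assume "Vector_Spaces.linear (smul M) (*) \<Lambda>"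
    then interpret Vector_Spaces.linear "smul M" "(*)" \<Lambda> .
    have "poly (map_poly \<Lambda> (p - q)) t = \<Lambda> (poly_eval M t (p - q))" for t
    proof -
      have "poly (map_poly \<Lambda> (p - q)) t = (\<Sum>i\<le>degree (p - q). coeff (map_poly \<Lambda> (p - q)) i * t ^ i)"
        unfolding poly_altdef using map_poly_degree_leq[of \<Lambda> "p - q"]
        by (intro sum.mono_neutral_left) (auto simp: coeff_eq_0)
      then show ?thesis
        unfolding poly_eval_def sum scale by (simp add: coeff_map_poly zero mult.commute)
    qed
    then have "poly (map_poly \<Lambda> (p - q)) t = 0" for t
      using assms by (simp add: zero)
    then have "map_poly \<Lambda> (p - q) = 0"
      using poly_all_0_iff_0 by blast
    then have "coeff (map_poly \<Lambda> (p - q)) k = 0" by simp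
    then show "\<Lambda> (coeff (p - q) k) = 0"
      unfolding coeff_map_poly[of \<Lambda>, OF zero] .
  qed
  then show False using k by simp
qed

lemma coeff_poly_derivative [simp]:
  "coeff (poly_derivative M p) n = smul M (of_nat (Suc n)) (coeff p (Suc n))"
proof -
  have "coeff (poly_derivative M p) n =
      (\<Sum>k\<le>degree p. if k = Suc n then smul M (of_nat (Suc n)) (coeff p (Suc n)) else 0)"
    unfolding poly_derivative_def coeff_sum coeff_monom
  proof (intro sum.cong refl)
    fix k show "(if k - 1 = n then smul M (of_nat k) (coeff p k) else 0) =
       (if k = Suc n then smul M (of_nat (Suc n)) (coeff p (Suc n)) else 0)"
      by (cases k) (auto simp: V(11))
  qed
  also have "\<dots> = smul M (of_nat (Suc n)) (coeff p (Suc n))"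
    by (simp add: sum.delta coeff_eq_0 V(10) not_le)
  finally show ?thesis .
qed

lemma polys_derivative: "p \<in> polys M i \<Longrightarrow> poly_derivative M p \<in> polys M i"
  by (simp add: polys_def V)

lemma poly_derivative_add: "poly_derivative M (p + q) = poly_derivative M p + poly_derivative M q"
  by (rule poly_eqI) (simp add: V)

end

locale dgla_polys =
  fixes M :: "('m::ab_group_add, 'r) dgla_scheme"
  assumes dgla: "is_dgla M"
begin

lemmas D = is_dglaD[OF dgla]

sublocale graded_polys M
  by unfold_locales (rule D(1))

lemmas d = graded_linearD[OF gvs gvs D(2)]
  and br = graded_linearD[OF gvs gvs D(4)]
  and bl = graded_linearD[OF gvs gvs D(5)]

text \<open>Together with \<open>poly_eval_inject\<close> this reduces bracket identities between
  polynomials to the same identities in \<open>M\<close>, checked at every point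
  \<open>t\<close>.\<close>

lemma poly_eval_bracket:
  assumes p: "p \<in> polys M i" and q: "q \<in> polys M j"
  shows "poly_eval M t (poly_bilinear (bracket M i j) p q) =
    bracket M i j (poly_eval M t p) (poly_eval M t q)"
proof -
  have mem: "coeff p k \<in> homog M i" "coeff q k \<in> homog M j" for k
    using assms by (auto simp: polys_def)
  have "bracket M i j (poly_eval M t p) (poly_eval M t q) =
     (\<Sum>k\<le>degree p. bracket M i j (smul M (t ^ k) (coeff p k)) (poly_eval M t q))"
    unfolding poly_eval_def[of M t p]
    by (rule graded_linear_sum[OF gvs gvs D(5), THEN conjunct2])
      (auto simp: mem V poly_eval_mem[OF q])
  also have "\<dots> = (\<Sum>k\<le>degree p. \<Sum>l\<le>degree q. smul M (t ^ (k + l)) (bracket M i j (coeff p k) (coeff q l)))"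
  proof (intro sum.cong refl)
    fix k
    have "bracket M i j (smul M (t ^ k) (coeff p k)) (poly_eval M t q) =
      (\<Sum>l\<le>degree q. bracket M i j (smul M (t ^ k) (coeff p k)) (smul M (t ^ l) (coeff q l)))"
      unfolding poly_eval_def
      by (rule graded_linear_sum[OF gvs gvs D(4), THEN conjunct2]) (auto simp: mem V)
    also have "\<dots> = (\<Sum>l\<le>degree q. smul M (t ^ (k + l)) (bracket M i j (coeff p k) (coeff q l)))"
      using mem by (intro sum.cong refl) (simp add: br(3) bl(3) V power_add mult.commute)
    finally show "bracket M i j (smul M (t ^ k) (coeff p k)) (poly_eval M t q) =
      (\<Sum>l\<le>degree q. smul M (t ^ (k + l)) (bracket M i j (coeff p k) (coeff q l)))" .
  qed
  also have "\<dots> = poly_eval M t (poly_bilinear (bracket M i j) p q)"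
    by (simp add: poly_bilinear_def poly_eval_sum)
  finally show ?thesis ..
qed

lemma polys_bracket:
  assumes p: "p \<in> polys M i" and q: "q \<in> polys M j" and l: "i + j = l"
  shows "poly_bilinear (bracket M i j) p q \<in> polys M l"
proof -
  have "bracket M i j (coeff p k) (coeff q m) \<in> homog M l" for k m
    using D(6)[of "coeff p k" i "coeff q m" j] assms by (simp add: polys_def)
  then have monom: "monom (bracket M i j (coeff p k) (coeff q m)) (k + m) \<in> polys M l" for k m
    by (rule polys_monom)
  have sum: "(\<Sum>k\<in>A. f k) \<in> polys M l" if "\<And>k. f k \<in> polys M l" for A :: "nat set" and f
    using that by (induction A rule: infinite_finite_induct) (auto simp: polys_zero polys_add)
  show ?thesis unfolding poly_bilinear_def by (intro sum monom)
qed

lemma poly_derivative_bracket: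
  assumes p: "p \<in> polys M i" and q: "q \<in> polys M j"
  shows "poly_derivative M (poly_bilinear (bracket M i j) p q) =
    poly_bilinear (bracket M i j) (poly_derivative M p) q + poly_bilinear (bracket M i j) p (poly_derivative M q)"
proof (rule poly_eqI)
  fix n
  let ?b = "\<lambda>x y. bracket M i j x y"
  have mem: "coeff p k \<in> homog M i" "coeff q k \<in> homog M j" for k
    using assms by (auto simp: polys_def)
  \<comment> \<open>The rule \<open>coeff_poly_bilinear\<close> asks that the operation vanish
    whenever one argument is zero, but the bracket is controlled on homogeneous arguments only;
    \<open>b\<close> extends it by zero.\<close>
  define b where "b x y = (if x \<in> homog M i \<and> y \<in> homog M j then bracket M i j x y else 0)" for x y
  have b: "poly_bilinear (bracket M i j) p' q' = poly_bilinear b p' q'" if "p' \<in> polys M i" "q' \<in> polys M j" for p' q'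
    unfolding poly_bilinear_def b_def using that by (simp add: polys_def)
  have coeff_b: "coeff (poly_bilinear (bracket M i j) p' q') n = (\<Sum>k\<le>n. ?b (coeff p' k) (coeff q' (n - k)))"
    if "p' \<in> polys M i" "q' \<in> polys M j" for p' q' n
    unfolding b[OF that]
    by (subst coeff_poly_bilinear) (use that in \<open>auto simp: b_def polys_def br(4) bl(4)\<close>)
  let ?t = "\<lambda>k. ?b (coeff p k) (coeff q (Suc n - k))"
  have "coeff (poly_derivative M (poly_bilinear (bracket M i j) p q)) n =
      (\<Sum>k\<le>Suc n. smul M (of_nat (Suc n)) (?t k))"
    unfolding coeff_poly_derivative coeff_b[OF p q] smul_sum ..
  \<comment> \<open>Write \<open>n + 1\<close> as \<open>k + (n + 1 - k)\<close>: the first part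
    leads to the derivative of \<open>p\<close>, the second to that of \<open>q\<close>.\<close>
  also have "\<dots> = (\<Sum>k\<le>Suc n. smul M (of_nat k) (?t k) + smul M (of_nat (Suc n - k)) (?t k))"
    by (intro sum.cong refl) (simp only: V(17)[symmetric] of_nat_add[symmetric] atMost_iff le_add_diff_inverse)
  also have "\<dots> = (\<Sum>k\<le>Suc n. smul M (of_nat k) (?t k)) + (\<Sum>k\<le>Suc n. smul M (of_nat (Suc n - k)) (?t k))"
    by (rule sum.distrib)
  also have "(\<Sum>k\<le>Suc n. smul M (of_nat k) (?t k)) = (\<Sum>k\<le>n. smul M (of_nat (Suc k)) (?t (Suc k)))"
    by (subst sum.atMost_Suc_shift) (simp add: V(11))
  also have "\<dots> = coeff (poly_bilinear (bracket M i j) (poly_derivative M p) q) n"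
    unfolding coeff_b[OF polys_derivative[OF p] q] coeff_poly_derivative
    by (intro sum.cong refl) (simp only: bl(3)[OF mem(2) mem(1)] diff_Suc_Suc)
  also have "(\<Sum>k\<le>Suc n. smul M (of_nat (Suc n - k)) (?t k)) = (\<Sum>k\<le>n. smul M (of_nat (Suc n - k)) (?t k))"
    by (simp add: V(11))
  also have "\<dots> = coeff (poly_bilinear (bracket M i j) p (poly_derivative M q)) n"
    unfolding coeff_b[OF p polys_derivative[OF q]] coeff_poly_derivative
    by (intro sum.cong refl) (simp only: br(3)[OF mem(1) mem(2)] atMost_iff Suc_diff_le)
  finally show "coeff (poly_derivative M (poly_bilinear (bracket M i j) p q)) n =
    coeff (poly_bilinear (bracket M i j) (poly_derivative M p) q
      + poly_bilinear (bracket M i j) p (poly_derivative M q)) n" by simp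
qed

end

section \<open>The DGLA of polynomial forms\<close>

context dgla_polys
begin

lemma poly_forms_simps:
  "smul (poly_forms M) c (p, r) = (map_poly (smul M c) p, map_poly (smul M c) r)"
  "(p, r) \<in> homog (poly_forms M) i \<longleftrightarrow> p \<in> polys M i \<and> r \<in> polys M (i - 1)"
  "diff (poly_forms M) i (p, r) =
     (map_poly (diff M i) p, map_poly (diff M (i - 1)) r + sg i (poly_derivative M p))"
  "bracket (poly_forms M) i j (p, r) (p', r') =
     (poly_bilinear (bracket M i j) p p',
      poly_bilinear (bracket M i (j - 1)) p r' + sg j (poly_bilinear (bracket M (i - 1) j) r p'))"
  by (simp_all add: poly_forms_def polys_def)

lemma graded_vector_space_poly_forms: "graded_vector_space (poly_forms M)"
proof -
  have vs: "vector_space (smul (poly_forms M))"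
    unfolding vector_space_def
    by (auto simp: poly_forms_simps poly_eq_iff V)
  then interpret F: vector_space "smul (poly_forms M)" .
  have "F.subspace (homog (poly_forms M) i)" for i
    unfolding F.subspace_def
    by (auto simp: poly_forms_simps polys_intros zero_prod_def)
  then show ?thesis by (simp add: graded_vector_space_def vs)
qed

lemmas polys_closed = polys_intros polys_bracket polys_map[OF D(2)] polys_derivative poly_eval_mem

lemmas evals = poly_eval_bracket poly_eval_map[OF D(2)]

lemma linear_expand:
  "x \<in> homog M i \<Longrightarrow> y \<in> homog M j \<Longrightarrow> y' \<in> homog M j \<Longrightarrow>
     bracket M i j x (y + y') = bracket M i j x y + bracket M i j x y'"
  "x \<in> homog M i \<Longrightarrow> y \<in> homog M j \<Longrightarrow> bracket M i j x (sg k y) = sg k (bracket M i j x y)"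
  "x \<in> homog M i \<Longrightarrow> y \<in> homog M j \<Longrightarrow> bracket M i j x (smul M c y) = smul M c (bracket M i j x y)"
  "x \<in> homog M i \<Longrightarrow> x' \<in> homog M i \<Longrightarrow> y \<in> homog M j \<Longrightarrow>
     bracket M i j (x + x') y = bracket M i j x y + bracket M i j x' y"
  "x \<in> homog M i \<Longrightarrow> y \<in> homog M j \<Longrightarrow> bracket M i j (sg k x) y = sg k (bracket M i j x y)"
  using br(2,3,7) bl(2,7) by auto

text \<open>The bracket axioms are checked separately on the part without \<open>dt\<close> and the
  part with \<open>dt\<close>, in each for the values at every \<open>t\<close>.\<close>

lemma is_dgla_poly_forms: "is_dgla (poly_forms M)"
proof (rule is_dglaI)
  show gvsF: "graded_vector_space (poly_forms M)" by (rule graded_vector_space_poly_forms)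
  show "graded_linear (poly_forms M) (poly_forms M) 1 (diff (poly_forms M))"
  proof (rule graded_linearI[OF gvsF gvsF])
    fix i x y c assume "x \<in> homog (poly_forms M) i" "y \<in> homog (poly_forms M) i"
    then show "diff (poly_forms M) i (smul (poly_forms M) c x + y) =
        smul (poly_forms M) c (diff (poly_forms M) i x) + diff (poly_forms M) i y"
      by (cases x, cases y)
        (auto simp: poly_forms_simps poly_eq_iff coeff_map_poly polys_def d V sg_add algebra_simps)
  next
    fix i x assume "x \<in> homog (poly_forms M) i"
    then show "diff (poly_forms M) i x \<in> homog (poly_forms M) (i + 1)"
      by (cases x) (auto simp: poly_forms_simps intro!: polys_closed)
  qed
  fix i x assume x: "x \<in> homog (poly_forms M) i"
  then obtain p r where pr: "x = (p, r)" "p \<in> polys M i" "r \<in> polys M (i - 1)"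
    by (cases x) (auto simp: poly_forms_simps)
  have mem: "coeff p k \<in> homog M i" "coeff r k \<in> homog M (i - 1)" for k
    using pr by (auto simp: polys_def)
  have "diff M i (diff M (i - 1) (coeff r k)) = 0" for k
    using D(3)[OF mem(2)[of k]] by simp
  moreover have "diff M (i - 1) (coeff r k) \<in> homog M i" for k
    using d(1)[OF mem(2)[of k]] by simp
  ultimately show "diff (poly_forms M) (i + 1) (diff (poly_forms M) i x) = 0"
    using mem by (auto simp: pr(1) poly_forms_simps poly_eq_iff coeff_map_poly zero_prod_def d D(3) V)
       (simp add: sg_def)
next
  fix i j x y
  assume x: "x \<in> homog (poly_forms M) i" and y: "y \<in> homog (poly_forms M) j"
  obtain p r where pr: "x = (p, r)" "p \<in> polys M i" "r \<in> polys M (i - 1)"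
    using x by (cases x) (auto simp: poly_forms_simps)
  obtain p' r' where pr': "y = (p', r')" "p' \<in> polys M j" "r' \<in> polys M (j - 1)"
    using y by (cases y) (auto simp: poly_forms_simps)
  show "bracket (poly_forms M) i j x y \<in> homog (poly_forms M) (i + j)"
    using pr pr' by (auto simp: poly_forms_simps intro!: polys_closed)
  show "bracket (poly_forms M) i j x (smul (poly_forms M) c y + y') =
      smul (poly_forms M) c (bracket (poly_forms M) i j x y) + bracket (poly_forms M) i j x y'"
    if y': "y' \<in> homog (poly_forms M) j" for y' c
  proof -
    obtain p2 r2 where pr2: "y' = (p2, r2)" "p2 \<in> polys M j" "r2 \<in> polys M (j - 1)"
      using y' by (cases y') (auto simp: poly_forms_simps)
    have "poly_bilinear (bracket M i j) p (map_poly (smul M c) p' + p2) =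
        map_poly (smul M c) (poly_bilinear (bracket M i j) p p') + poly_bilinear (bracket M i j) p p2"
      by (rule poly_eval_inject) (use pr pr' pr2 in \<open>simp add: evals polys_closed linear_expand V\<close>)
    moreover have "poly_bilinear (bracket M i (j - 1)) p (map_poly (smul M c) r' + r2)
         + sg j (poly_bilinear (bracket M (i - 1) j) r (map_poly (smul M c) p' + p2)) =
        map_poly (smul M c) (poly_bilinear (bracket M i (j - 1)) p r' + sg j (poly_bilinear (bracket M (i - 1) j) r p'))
        + (poly_bilinear (bracket M i (j - 1)) p r2 + sg j (poly_bilinear (bracket M (i - 1) j) r p2))"
      by (rule poly_eval_inject)
        (use pr pr' pr2 in \<open>simp add: evals polys_closed linear_expand V sg_add add_ac\<close>)
    ultimately show ?thesis
      by (simp add: pr(1) pr'(1) pr2(1) poly_forms_simps)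
  qed
  show "bracket (poly_forms M) i j x y = - sg (i * j) (bracket (poly_forms M) j i y x)"
  proof -
    have "poly_bilinear (bracket M i j) p p' = - sg (i * j) (poly_bilinear (bracket M j i) p' p)"
      by (rule poly_eval_inject)
        (use pr pr' in \<open>simp add: evals polys_closed D(7)[of "poly_eval M _ p" i "poly_eval M _ p'" j]\<close>)
    moreover have "poly_bilinear (bracket M i (j - 1)) p r' + sg j (poly_bilinear (bracket M (i - 1) j) r p') =
      - sg (i * j) (poly_bilinear (bracket M j (i - 1)) p' r + sg i (poly_bilinear (bracket M (j - 1) i) r' p))"
    proof (rule poly_eval_inject)
      fix t
      show "poly_eval M t (poly_bilinear (bracket M i (j - 1)) p r' + sg j (poly_bilinear (bracket M (i - 1) j) r p')) =
        poly_eval M t (- sg (i * j) (poly_bilinear (bracket M j (i - 1)) p' r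
          + sg i (poly_bilinear (bracket M (j - 1) i) r' p)))"
        using pr pr' D(7)[of "poly_eval M t p" i "poly_eval M t r'" "j - 1"]
          D(7)[of "poly_eval M t r" "i - 1" "poly_eval M t p'" j]
        by (simp add: evals polys_closed) (simp add: sg_def)
    qed
    ultimately show ?thesis
      by (simp add: pr(1) pr'(1) poly_forms_simps)
  qed
  show "diff (poly_forms M) (i + j) (bracket (poly_forms M) i j x y) =
      bracket (poly_forms M) (i + 1) j (diff (poly_forms M) i x) y +
      sg i (bracket (poly_forms M) i (j + 1) x (diff (poly_forms M) j y))"
  proof -
    have "map_poly (diff M (i + j)) (poly_bilinear (bracket M i j) p p') =
      poly_bilinear (bracket M (i + 1) j) (map_poly (diff M i) p) p'
      + sg i (poly_bilinear (bracket M i (j + 1)) p (map_poly (diff M j) p'))"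
      by (rule poly_eval_inject) (use pr pr' in \<open>simp add: evals polys_closed D(9)\<close>)
    \<comment> \<open>In the \<open>dt\<close> part the differential of \<open>M\<close> contributes
      two Leibniz rules, for \<open>p\<close>, \<open>r'\<close> and for \<open>r\<close>,
      \<open>p'\<close>, and the derivative in \<open>t\<close> contributes the product rule for
      \<open>p\<close>, \<open>p'\<close>.\<close>
    moreover have "map_poly (diff M (i + j - 1))
         (poly_bilinear (bracket M i (j - 1)) p r' + sg j (poly_bilinear (bracket M (i - 1) j) r p'))
       + sg (i + j) (poly_derivative M (poly_bilinear (bracket M i j) p p')) =
      poly_bilinear (bracket M (i + 1) (j - 1)) (map_poly (diff M i) p) r'
      + sg j (poly_bilinear (bracket M i j) (map_poly (diff M (i - 1)) r + sg i (poly_derivative M p)) p')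
      + sg i (poly_bilinear (bracket M i j) p (map_poly (diff M (j - 1)) r' + sg j (poly_derivative M p'))
        + sg (j + 1) (poly_bilinear (bracket M (i - 1) (j + 1)) r (map_poly (diff M j) p')))"
    proof (rule poly_eval_inject)
      fix t
      have mem: "poly_eval M t p \<in> homog M i" "poly_eval M t r \<in> homog M (i - 1)"
        "poly_eval M t p' \<in> homog M j" "poly_eval M t r' \<in> homog M (j - 1)"
        "poly_eval M t (poly_derivative M p) \<in> homog M i" "poly_eval M t (poly_derivative M p') \<in> homog M j"
        using pr pr' by (auto intro!: polys_closed)
      have closed: "poly_bilinear (bracket M i (j - 1)) p r' \<in> polys M (i + j - 1)"
        "poly_bilinear (bracket M (i - 1) j) r p' \<in> polys M (i + j - 1)"
        "map_poly (diff M (i - 1)) r \<in> polys M i" "map_poly (diff M (j - 1)) r' \<in> polys M j"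
        using pr pr' by (auto intro!: polys_closed)
      have dmem: "diff M (i - 1) (poly_eval M t r) \<in> homog M i" "diff M (j - 1) (poly_eval M t r') \<in> homog M j"
        "diff M i (poly_eval M t p) \<in> homog M (i + 1)" "diff M j (poly_eval M t p') \<in> homog M (j + 1)"
        using d(1)[OF mem(2)] d(1)[OF mem(4)] d(1)[OF mem(1)] d(1)[OF mem(3)] by simp_all
      have bmem: "bracket M i (j - 1) (poly_eval M t p) (poly_eval M t r') \<in> homog M (i + j - 1)"
        "bracket M (i - 1) j (poly_eval M t r) (poly_eval M t p') \<in> homog M (i + j - 1)"
        using D(6)[OF mem(1,4)] D(6)[OF mem(2,3)] by (simp_all add: algebra_simps)
      show "poly_eval M t (map_poly (diff M (i + j - 1))
          (poly_bilinear (bracket M i (j - 1)) p r' + sg j (poly_bilinear (bracket M (i - 1) j) r p'))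
        + sg (i + j) (poly_derivative M (poly_bilinear (bracket M i j) p p'))) =
        poly_eval M t (poly_bilinear (bracket M (i + 1) (j - 1)) (map_poly (diff M i) p) r'
        + sg j (poly_bilinear (bracket M i j) (map_poly (diff M (i - 1)) r + sg i (poly_derivative M p)) p')
        + sg i (poly_bilinear (bracket M i j) p (map_poly (diff M (j - 1)) r' + sg j (poly_derivative M p'))
          + sg (j + 1) (poly_bilinear (bracket M (i - 1) (j + 1)) r (map_poly (diff M j) p'))))"
        using pr pr' mem closed dmem bmem D(9)[OF mem(1,4)] D(9)[OF mem(2,3)]
        by (simp add: evals polys_closed poly_derivative_bracket linear_expand d V(3,7) sg_add algebra_simps)
           (simp add: sg_def)
    qed
    ultimately show ?thesis
      by (simp add: pr(1) pr'(1) poly_forms_simps)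
  qed
  fix k z assume z: "z \<in> homog (poly_forms M) k"
  obtain p2 r2 where pr2: "z = (p2, r2)" "p2 \<in> polys M k" "r2 \<in> polys M (k - 1)"
    using z by (cases z) (auto simp: poly_forms_simps)
  show "bracket (poly_forms M) i (j + k) x (bracket (poly_forms M) j k y z) =
      bracket (poly_forms M) (i + j) k (bracket (poly_forms M) i j x y) z +
      sg (i * j) (bracket (poly_forms M) j (i + k) y (bracket (poly_forms M) i k x z))"
  proof -
    have "poly_bilinear (bracket M i (j + k)) p (poly_bilinear (bracket M j k) p' p2) =
      poly_bilinear (bracket M (i + j) k) (poly_bilinear (bracket M i j) p p') p2 +
      sg (i * j) (poly_bilinear (bracket M j (i + k)) p' (poly_bilinear (bracket M i k) p p2))"
    proof (rule poly_eval_inject)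
      fix t
      have mem: "poly_eval M t p \<in> homog M i" "poly_eval M t p' \<in> homog M j" "poly_eval M t p2 \<in> homog M k"
        using pr pr' pr2 by (auto intro!: polys_closed)
      show "poly_eval M t (poly_bilinear (bracket M i (j + k)) p (poly_bilinear (bracket M j k) p' p2)) =
        poly_eval M t (poly_bilinear (bracket M (i + j) k) (poly_bilinear (bracket M i j) p p') p2 +
        sg (i * j) (poly_bilinear (bracket M j (i + k)) p' (poly_bilinear (bracket M i k) p p2)))"
        using pr pr' pr2 D(8)[OF mem] by (simp add: evals polys_closed)
    qed
    moreover have "poly_bilinear (bracket M i (j + k - 1)) p (poly_bilinear (bracket M j (k - 1)) p' r2
          + sg k (poly_bilinear (bracket M (j - 1) k) r' p2))
        + sg (j + k) (poly_bilinear (bracket M (i - 1) (j + k)) r (poly_bilinear (bracket M j k) p' p2)) =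
      poly_bilinear (bracket M (i + j) (k - 1)) (poly_bilinear (bracket M i j) p p') r2
        + sg k (poly_bilinear (bracket M (i + j - 1) k) (poly_bilinear (bracket M i (j - 1)) p r'
          + sg j (poly_bilinear (bracket M (i - 1) j) r p')) p2)
      + sg (i * j) (poly_bilinear (bracket M j (i + k - 1)) p' (poly_bilinear (bracket M i (k - 1)) p r2
          + sg k (poly_bilinear (bracket M (i - 1) k) r p2))
        + sg (i + k) (poly_bilinear (bracket M (j - 1) (i + k)) r' (poly_bilinear (bracket M i k) p p2)))"
    proof (rule poly_eval_inject)
      fix t
      have mem: "poly_eval M t p \<in> homog M i" "poly_eval M t r \<in> homog M (i - 1)"
        "poly_eval M t p' \<in> homog M j" "poly_eval M t r' \<in> homog M (j - 1)"
        "poly_eval M t p2 \<in> homog M k" "poly_eval M t r2 \<in> homog M (k - 1)"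
        using pr pr' pr2 by (auto intro!: polys_closed)
      have closed: "poly_bilinear (bracket M i (j - 1)) p r' \<in> polys M (i + j - 1)"
        "poly_bilinear (bracket M (i - 1) j) r p' \<in> polys M (i + j - 1)"
        "poly_bilinear (bracket M j (k - 1)) p' r2 \<in> polys M (j + k - 1)"
        "poly_bilinear (bracket M (j - 1) k) r' p2 \<in> polys M (j + k - 1)"
        "poly_bilinear (bracket M i (k - 1)) p r2 \<in> polys M (i + k - 1)"
        "poly_bilinear (bracket M (i - 1) k) r p2 \<in> polys M (i + k - 1)"
        using pr pr' pr2 by (auto intro!: polys_closed)
      have bmem: "bracket M i (j - 1) (poly_eval M t p) (poly_eval M t r') \<in> homog M (i + j - 1)"
        "bracket M (i - 1) j (poly_eval M t r) (poly_eval M t p') \<in> homog M (i + j - 1)"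
        "bracket M j (k - 1) (poly_eval M t p') (poly_eval M t r2) \<in> homog M (j + k - 1)"
        "bracket M (j - 1) k (poly_eval M t r') (poly_eval M t p2) \<in> homog M (j + k - 1)"
        "bracket M i (k - 1) (poly_eval M t p) (poly_eval M t r2) \<in> homog M (i + k - 1)"
        "bracket M (i - 1) k (poly_eval M t r) (poly_eval M t p2) \<in> homog M (i + k - 1)"
        using D(6)[OF mem(1,4)] D(6)[OF mem(2,3)] D(6)[OF mem(3,6)] D(6)[OF mem(4,5)]
          D(6)[OF mem(1,6)] D(6)[OF mem(2,5)] by (simp_all add: algebra_simps)
      \<comment> \<open>The \<open>dt\<close> part of the Jacobi identity is the sum of three Jacobi
        identities in \<open>M\<close>, one for each of the three arguments that can supply
        \<open>dt\<close>.\<close>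
      note jacobi = D(8)[OF mem(1,3,6)] D(8)[OF mem(1,4,5)] D(8)[OF mem(2,3,5)]
      show "poly_eval M t (poly_bilinear (bracket M i (j + k - 1)) p (poly_bilinear (bracket M j (k - 1)) p' r2
          + sg k (poly_bilinear (bracket M (j - 1) k) r' p2))
        + sg (j + k) (poly_bilinear (bracket M (i - 1) (j + k)) r (poly_bilinear (bracket M j k) p' p2))) =
        poly_eval M t (poly_bilinear (bracket M (i + j) (k - 1)) (poly_bilinear (bracket M i j) p p') r2
        + sg k (poly_bilinear (bracket M (i + j - 1) k) (poly_bilinear (bracket M i (j - 1)) p r'
          + sg j (poly_bilinear (bracket M (i - 1) j) r p')) p2)
        + sg (i * j) (poly_bilinear (bracket M j (i + k - 1)) p' (poly_bilinear (bracket M i (k - 1)) p r2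
          + sg k (poly_bilinear (bracket M (i - 1) k) r p2))
        + sg (i + k) (poly_bilinear (bracket M (j - 1) (i + k)) r' (poly_bilinear (bracket M i k) p p2))))"
        using pr pr' pr2 mem closed bmem jacobi
        by (simp add: evals polys_closed linear_expand V(3,7) sg_add algebra_simps)
           (cases "even i"; cases "even j"; cases "even k"; simp add: sg_def)
    qed
    ultimately show ?thesis
      by (simp add: pr(1) pr'(1) pr2(1) poly_forms_simps algebra_simps)
  qed
qed

end

section \<open>The contraction of \<open>H\<close> onto the cone\<close>

context graded_polys
begin

definition primitive :: "'m poly \<Rightarrow> 'm poly" where
  "primitive r = (\<Sum>k\<le>degree r. monom (smul M (1 / of_nat (Suc k)) (coeff r k)) (Suc k))"

definition integral :: "'m poly \<Rightarrow> 'm" where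
  "integral r = poly_eval M 1 (primitive r)"

lemma coeff_primitive [simp]:
  "coeff (primitive r) 0 = 0"
  "coeff (primitive r) (Suc n) = smul M (1 / of_nat (Suc n)) (coeff r n)"
proof -
  show "coeff (primitive r) 0 = 0"
    by (simp add: primitive_def coeff_sum)
  have "coeff (primitive r) (Suc n) =
      (\<Sum>k\<le>degree r. if k = n then smul M (1 / of_nat (Suc n)) (coeff r n) else 0)"
    unfolding primitive_def coeff_sum coeff_monom by (intro sum.cong refl) auto
  then show "coeff (primitive r) (Suc n) = smul M (1 / of_nat (Suc n)) (coeff r n)"
    by (simp add: sum.delta coeff_eq_0 V(10) not_le)
qed

lemma poly_eqI_Suc: "coeff p 0 = coeff q 0 \<Longrightarrow> (\<And>n. coeff p (Suc n) = coeff q (Suc n)) \<Longrightarrow> p = q"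
  by (rule poly_eqI) (metis not0_implies_Suc)

lemma primitive_add: "primitive (p + q) = primitive p + primitive q"
  and primitive_smul: "primitive (map_poly (smul M c) p) = map_poly (smul M c) (primitive p)"
  and primitive_sg: "primitive (sg k p) = sg k (primitive p)"
  and primitive_minus: "primitive (- p) = - primitive p"
  and primitive_diff: "primitive (p - q) = primitive p - primitive q"
  and primitive_zero [simp]: "primitive 0 = 0"
  by (rule poly_eqI_Suc; simp add: V smul_diff mult.commute)+

lemma primitive_map:
  assumes "graded_linear M M e F" "p \<in> polys M i"
  shows "primitive (map_poly (F i) p) = map_poly (F i) (primitive p)"
  using assms(2) graded_linearD[OF gvs gvs assms(1)]
  by (intro poly_eqI_Suc) (simp_all add: coeff_map_poly polys_def)

lemma polys_primitive: "p \<in> polys M i \<Longrightarrow> primitive p \<in> polys M i"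
  unfolding polys_def mem_Collect_eq
proof
  fix k assume "\<forall>k. coeff p k \<in> homog M i"
  then show "coeff (primitive p) k \<in> homog M i" by (cases k) (simp_all add: V)
qed

lemma poly_eval_0: "poly_eval M 0 p = coeff p 0"
proof -
  have "poly_eval M 0 p = (\<Sum>k\<le>degree p. if k = 0 then coeff p 0 else 0)"
    unfolding poly_eval_def by (intro sum.cong refl) (auto simp: V power_0_left)
  then show ?thesis by simp
qed

lemma integral_add: "integral (p + q) = integral p + integral q"
  and integral_smul: "integral (map_poly (smul M c) p) = smul M c (integral p)"
  and integral_sg: "integral (sg k p) = sg k (integral p)"
  and integral_minus: "integral (- p) = - integral p"
  and integral_diff: "integral (p - q) = integral p - integral q"
  by (simp_all add: integral_def primitive_add primitive_smul primitive_sg primitive_minus primitive_diff)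

lemma integral_mem: "p \<in> polys M i \<Longrightarrow> integral p \<in> homog M i"
  by (simp add: integral_def poly_eval_mem polys_primitive)

lemma integral_map:
  assumes "graded_linear M M e F" "p \<in> polys M i"
  shows "integral (map_poly (F i) p) = F i (integral p)"
  using assms by (simp add: integral_def primitive_map poly_eval_map polys_primitive)

lemma poly_derivative_primitive: "poly_derivative M (primitive r) = r"
  by (rule poly_eqI) (simp add: V(9,16) del: of_nat_Suc)

lemma primitive_poly_derivative: "primitive (poly_derivative M p) = p - monom (poly_eval M 0 p) 0"
  by (rule poly_eqI_Suc) (simp_all add: V(9,16) poly_eval_0 del: of_nat_Suc)

lemma integral_poly_derivative: "integral (poly_derivative M p) = poly_eval M 1 p - poly_eval M 0 p"
  by (simp add: integral_def primitive_poly_derivative V)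

lemma integral_monom_0: "integral (monom x 0) = x"
proof -
  have "primitive (monom x 0) = monom x 1"
    by (rule poly_eqI_Suc) (auto simp: V coeff_monom)
  then show ?thesis by (simp add: integral_def V)
qed

lemma poly_derivative_monom_1: "poly_derivative M (monom x 1) = monom x 0"
  and poly_derivative_monom_0: "poly_derivative M (monom x 0) = 0"
  by (rule poly_eqI; auto simp: V coeff_monom)+

lemma poly_derivative_diff: "poly_derivative M (p - q) = poly_derivative M p - poly_derivative M q"
  and poly_derivative_sg: "poly_derivative M (sg k p) = sg k (poly_derivative M p)"
  by (rule poly_eqI; simp add: smul_diff V)+

end

section \<open>The cone and the DGLA of paths for a pair of morphisms\<close>

locale dgla_cospan =
  fixes L :: "('l::ab_group_add) dgla" and N :: "('n::ab_group_add) dgla"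
    and M :: "('m::ab_group_add) dgla"
    and h :: "int \<Rightarrow> 'l \<Rightarrow> 'm" and g :: "int \<Rightarrow> 'n \<Rightarrow> 'm"
  assumes L: "is_dgla L" and N: "is_dgla N" and M: "is_dgla M"
    and h: "dgla_morphism L M h" and g: "dgla_morphism N M g"
begin

sublocale dgla_polys M by unfold_locales (rule M)

abbreviation F :: "('m poly \<times> 'm poly) dgla" where "F \<equiv> poly_forms M"
abbreviation H :: "('l \<times> 'n \<times> 'm poly \<times> 'm poly) dgla" where "H \<equiv> H_dgla L N M h g"
abbreviation C :: "('l \<times> 'n \<times> 'm) graded_space" where "C \<equiv> mapping_cone L N M"

lemmas LD = is_dglaD[OF L] and ND = is_dglaD[OF N] and FD = is_dglaD[OF is_dgla_poly_forms]
lemmas LV = graded_vector_spaceD[OF LD(1)] and NV = graded_vector_spaceD[OF ND(1)]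
  and FV = graded_vector_spaceD[OF FD(1)]
lemmas Ld = graded_linearD[OF LD(1,1,2)] and Nd = graded_linearD[OF ND(1,1,2)]
  and Fd = graded_linearD[OF FD(1,1,2)]
lemmas Lb = graded_linearD[OF LD(1,1,4)] and Nb = graded_linearD[OF ND(1,1,4)]
  and Fb = graded_linearD[OF FD(1,1,4)]

lemma h_linear: "graded_linear L M 0 h" and g_linear: "graded_linear N M 0 g"
  and h_diff: "x \<in> homog L i \<Longrightarrow> h (i + 1) (diff L i x) = diff M i (h i x)"
  and g_diff: "y \<in> homog N i \<Longrightarrow> g (i + 1) (diff N i y) = diff M i (g i y)"
  and h_bracket: "x \<in> homog L i \<Longrightarrow> x' \<in> homog L j \<Longrightarrow>
    h (i + j) (bracket L i j x x') = bracket M i j (h i x) (h j x')"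
  and g_bracket: "y \<in> homog N i \<Longrightarrow> y' \<in> homog N j \<Longrightarrow>
    g (i + j) (bracket N i j y y') = bracket M i j (g i y) (g j y')"
  using h g by (simp_all add: dgla_morphism_def)

lemmas hl = graded_linearD[OF LD(1) gvs h_linear, simplified]
  and gl = graded_linearD[OF ND(1) gvs g_linear, simplified]

lemma form_eval_diff: "x \<in> homog F i \<Longrightarrow> form_eval M t (diff F i x) = diff M i (form_eval M t x)"
  by (cases x) (simp add: form_eval_eq poly_forms_simps evals)

lemma form_eval_bracket: "x \<in> homog F i \<Longrightarrow> y \<in> homog F j \<Longrightarrow>
    form_eval M t (bracket F i j x y) = bracket M i j (form_eval M t x) (form_eval M t y)"
  by (cases x, cases y) (simp add: form_eval_eq poly_forms_simps evals)

lemma H_simps: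
  "smul H c (l, n, \<omega>) = (smul L c l, smul N c n, smul F c \<omega>)"
  "(l, n, \<omega>) \<in> homog H i \<longleftrightarrow> l \<in> homog L i \<and> n \<in> homog N i \<and> \<omega> \<in> homog F i \<and>
     h i l = form_eval M 1 \<omega> \<and> g i n = form_eval M 0 \<omega>"
  "diff H i (l, n, \<omega>) = (diff L i l, diff N i n, diff F i \<omega>)"
  "bracket H i j (l, n, \<omega>) (l', n', \<omega>') = (bracket L i j l l', bracket N i j n n', bracket F i j \<omega> \<omega>')"
  by (simp_all add: H_dgla_def)

lemma C_simps:
  "smul C c (l, n, m) = (smul L c l, smul N c n, smul M c m)"
  "(l, n, m) \<in> homog C i \<longleftrightarrow> l \<in> homog L i \<and> n \<in> homog N i \<and> m \<in> homog M (i - 1)"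
  by (simp_all add: mapping_cone_def)

lemma graded_vector_space_C: "graded_vector_space C"
proof -
  have vs: "vector_space (smul C)"
    unfolding vector_space_def by (auto simp: C_simps LV NV V)
  then interpret C: vector_space "smul C" .
  have "C.subspace (homog C i)" for i
    unfolding C.subspace_def by (auto simp: C_simps LV NV V zero_prod_def)
  then show ?thesis by (simp add: graded_vector_space_def vs)
qed

lemma graded_vector_space_H: "graded_vector_space H"
proof -
  have vs: "vector_space (smul H)"
    unfolding vector_space_def by (auto simp: H_simps LV NV FV)
  then interpret H: vector_space "smul H" .
  have "H.subspace (homog H i)" for i
    unfolding H.subspace_def
    by (auto simp: H_simps LV NV zero_prod_def poly_forms_simps form_eval_eq polys_intros hl gl)
  then show ?thesis by (simp add: graded_vector_space_def vs)
qed

text \<open>The axioms hold componentwise. The gluing conditions persist because \<open>h\<close>,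
  \<open>g\<close> and the evaluations at 1 and 0 all commute with differentials and
  brackets.\<close>

lemma is_dgla_H: "is_dgla H"
proof (rule is_dglaI)
  note gvsH = graded_vector_space_H
  show "graded_vector_space H" by (rule gvsH)
  show "graded_linear H H 1 (diff H)"
  proof (rule graded_linearI[OF gvsH gvsH])
    fix i x assume "x \<in> homog H i"
    then show "diff H i x \<in> homog H (i + 1)"
      by (cases x rule: prod_cases3) (auto simp: H_simps Ld(1) Nd(1) Fd(1) form_eval_diff h_diff g_diff)
  next
    fix i x y c assume "x \<in> homog H i" "y \<in> homog H i"
    then show "diff H i (smul H c x + y) = smul H c (diff H i x) + diff H i y"
      by (cases x rule: prod_cases3; cases y rule: prod_cases3)
        (auto simp: H_simps Ld(2,3) Nd(2,3) Fd(2,3) LV(6) NV(6) FV(6))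
  qed
  fix i x assume "x \<in> homog H i"
  then show "diff H (i + 1) (diff H i x) = 0"
    by (cases x rule: prod_cases3)
      (auto simp: H_simps LD(3) ND(3) FD(3) zero_prod_def[where 'a='l] zero_prod_def[where 'a='n])
next
  fix i j x y assume x: "x \<in> homog H i" and y: "y \<in> homog H j"
  obtain l n \<omega> where x': "x = (l, n, \<omega>)" "l \<in> homog L i" "n \<in> homog N i" "\<omega> \<in> homog F i"
      "h i l = form_eval M 1 \<omega>" "g i n = form_eval M 0 \<omega>"
    using x by (cases x rule: prod_cases3) (auto simp: H_simps)
  obtain l' n' \<omega>' where y': "y = (l', n', \<omega>')" "l' \<in> homog L j" "n' \<in> homog N j" "\<omega>' \<in> homog F j"
      "h j l' = form_eval M 1 \<omega>'" "g j n' = form_eval M 0 \<omega>'"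
    using y by (cases y rule: prod_cases3) (auto simp: H_simps)
  show "bracket H i j x y \<in> homog H (i + j)"
    using x' y' by (simp add: H_simps LD(6) ND(6) FD(6) form_eval_bracket h_bracket g_bracket)
  show "bracket H i j x y = - sg (i * j) (bracket H j i y x)"
    using LD(7)[OF x'(2) y'(2)] ND(7)[OF x'(3) y'(3)] FD(7)[OF x'(4) y'(4)]
    by (simp add: x'(1) y'(1) H_simps)
  show "diff H (i + j) (bracket H i j x y) =
      bracket H (i + 1) j (diff H i x) y + sg i (bracket H i (j + 1) x (diff H j y))"
    using LD(9)[OF x'(2) y'(2)] ND(9)[OF x'(3) y'(3)] FD(9)[OF x'(4) y'(4)]
    by (simp add: x'(1) y'(1) H_simps)
  show "bracket H i j x (smul H c y + y2) = smul H c (bracket H i j x y) + bracket H i j x y2"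
    if "y2 \<in> homog H j" for y2 c
    using that x' y'
    by (cases y2 rule: prod_cases3)
      (auto simp: H_simps Lb(2,3) Nb(2,3) Fb(2,3) LV(6) NV(6) FV(6))
  fix k z assume z: "z \<in> homog H k"
  obtain l2 n2 \<omega>2 where z': "z = (l2, n2, \<omega>2)" "l2 \<in> homog L k" "n2 \<in> homog N k" "\<omega>2 \<in> homog F k"
    using z by (cases z rule: prod_cases3) (auto simp: H_simps)
  show "bracket H i (j + k) x (bracket H j k y z) =
      bracket H (i + j) k (bracket H i j x y) z + sg (i * j) (bracket H j (i + k) y (bracket H i k x z))"
    using LD(8)[OF x'(2) y'(2) z'(2)] ND(8)[OF x'(3) y'(3) z'(3)] FD(8)[OF x'(4) y'(4) z'(4)]
    by (simp add: x'(1) y'(1) z'(1) H_simps)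
qed

lemma shift_C_iff: "(l, n, m) \<in> homog (shift C) i \<longleftrightarrow>
    l \<in> homog L (i + 1) \<and> n \<in> homog N (i + 1) \<and> m \<in> homog M i"
  by (simp add: C_simps)

lemma shift_H_iff: "(l, n, p, r) \<in> homog (shift H) i \<longleftrightarrow>
    l \<in> homog L (i + 1) \<and> n \<in> homog N (i + 1) \<and> p \<in> polys M (i + 1) \<and> r \<in> polys M i \<and>
    h (i + 1) l = poly_eval M 1 p \<and> g (i + 1) n = poly_eval M 0 p"
  by (simp add: H_simps poly_forms_simps form_eval_eq)

text \<open>In shifted degree \<open>i\<close> the coefficient \<open>r\<close> of \<open>dt\<close>
  has degree \<open>i\<close> in \<open>M\<close>. The sign moves \<open>dt\<close> to its left
  before integrating and so undoes the sign in \<open>cone_to_H\<close>.\<close>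

definition proj :: "int \<Rightarrow> 'l \<times> 'n \<times> 'm poly \<times> 'm poly \<Rightarrow> 'l \<times> 'n \<times> 'm" where
  "proj i = (\<lambda>(l, n, p, r). (l, n, sg i (integral r)))"

text \<open>
  Fibrewise the homotopy is the operator taking \<open>r dt\<close> to
  \<open>\<integral>\<^sub>0\<^sup>t r - t \<integral>\<^sub>0\<^sup>1 r\<close>, which vanishes at both ends of the interval.
\<close>

definition hom :: "int \<Rightarrow> 'l \<times> 'n \<times> 'm poly \<times> 'm poly \<Rightarrow> 'l \<times> 'n \<times> 'm poly \<times> 'm poly" where
  "hom i = (\<lambda>(l, n, p, r). (0, 0, sg i (primitive r - monom (integral r) 1), 0))"

lemma cone_to_H_eq: "cone_to_H M h g i (l, n, m) =
   (l, n, monom (g (i + 1) n) 0 - monom (g (i + 1) n) 1 + monom (h (i + 1) l) 1, monom (sg i m) 0)"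
  by (simp add: cone_to_H_def V(14))

lemma q_single: "dgla_Linf H [(i, (l, n, p, r))] =
    (- diff L (i + 1) l, - diff N (i + 1) n, - map_poly (diff M (i + 1)) p,
     - map_poly (diff M i) r + sg i (poly_derivative M p))"
  by (simp add: H_simps poly_forms_simps) (simp add: sg_def)

lemma map_diff_monom: "map_poly (diff M i) (monom x n) = monom (diff M i x) n"
  by (rule map_poly_monom) (rule d(4))

lemma map_diff_add: "p \<in> polys M i \<Longrightarrow> q \<in> polys M i \<Longrightarrow>
    map_poly (diff M i) (p + q) = map_poly (diff M i) p + map_poly (diff M i) q"
  and map_diff_diff: "p \<in> polys M i \<Longrightarrow> q \<in> polys M i \<Longrightarrow>
    map_poly (diff M i) (p - q) = map_poly (diff M i) p - map_poly (diff M i) q"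
  and map_diff_sg: "p \<in> polys M i \<Longrightarrow> map_poly (diff M i) (sg k p) = sg k (map_poly (diff M i) p)"
  by (rule poly_eqI; simp add: coeff_map_poly d polys_def)+

lemma monom_sg: "monom (sg k x) n = sg k (monom x n)"
  and monom_add: "monom (x + y) n = monom x n + monom y n"
  and monom_diff: "monom (x - y) n = monom x n - monom y n"
  and monom_minus: "monom (- x) n = - monom x n" for x y :: 'm
  by (simp_all add: poly_eq_iff sg_def coeff_monom)

lemma homotopy_transfer_cone: "homotopy_transfer (shift C) (shift H) (dgla_Linf H)
    (cone_suspended_diff L N M h g) (cone_to_H M h g) proj hom"
proof
  show C: "graded_vector_space (shift C)" and Hs: "graded_vector_space (shift H)"
    by (intro graded_vector_space_shift graded_vector_space_C graded_vector_space_H)+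
  show "sym_multilinear (shift H) (shift H) 1 (dgla_Linf H)"
    by (rule sym_multilinear_dgla_Linf[OF is_dgla_H])
  show "cod (dgla_Linf H) (dgla_Linf H) w = 0" if "w \<in> words (shift H)" for w
    by (rule cod_dgla_Linf[OF is_dgla_H that])
  show "graded_linear (shift C) (shift C) 1 (cone_suspended_diff L N M h g)"
  proof (rule graded_linearI[OF C C])
    fix i x assume "x \<in> homog (shift C) i"
    then show "cone_suspended_diff L N M h g i x \<in> homog (shift C) (i + 1)"
      using Ld(1)[of "fst x" "i + 1"] Nd(1)[of "fst (snd x)" "i + 1"]
      by (cases x rule: prod_cases3)
        (auto simp: shift_C_iff cone_suspended_diff_def V(3,4) LV(5) NV(5) d(1) hl(1) gl(1) simp del: shift_simps)
  next
    fix i x y c assume "x \<in> homog (shift C) i" "y \<in> homog (shift C) i"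
    then show "cone_suspended_diff L N M h g i (smul (shift C) c x + y) =
        smul (shift C) c (cone_suspended_diff L N M h g i x) + cone_suspended_diff L N M h g i y"
      by (cases x rule: prod_cases3; cases y rule: prod_cases3)
        (auto simp: C_simps cone_suspended_diff_def V(6,8,12) LV(6,8,12) NV(6,8,12) Ld(2,3) Nd(2,3) d(2,3)
          hl(2,3) gl(2,3) smul_diff)
  qed
  show "graded_linear (shift C) (shift H) 0 (cone_to_H M h g)"
  proof (rule graded_linearI[OF C Hs])
    fix i x assume "x \<in> homog (shift C) i"
    then show "cone_to_H M h g i x \<in> homog (shift H) (i + 0)"
      by (cases x rule: prod_cases3)
        (auto simp: shift_C_iff shift_H_iff cone_to_H_eq V hl(1) gl(1) simp del: shift_simps
          intro!: polys_intros)
  next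
    fix i x y c assume "x \<in> homog (shift C) i" "y \<in> homog (shift C) i"
    then show "cone_to_H M h g i (smul (shift C) c x + y) =
        smul (shift H) c (cone_to_H M h g i x) + cone_to_H M h g i y"
      by (cases x rule: prod_cases3; cases y rule: prod_cases3)
        (auto simp: C_simps H_simps poly_forms_simps cone_to_H_eq LV(6) NV(6) hl(2,3) gl(2,3)
          poly_eq_iff coeff_monom V(8,10,15) smul_diff sg_add)
  qed
  show "graded_linear (shift H) (shift C) 0 proj"
  proof (rule graded_linearI[OF Hs C])
    fix i x assume "x \<in> homog (shift H) i"
    then show "proj i x \<in> homog (shift C) (i + 0)"
      by (cases x rule: prod_cases4)
        (auto simp: shift_C_iff shift_H_iff proj_def V integral_mem simp del: shift_simps)
  next
    fix i x y c assume "x \<in> homog (shift H) i" "y \<in> homog (shift H) i"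
    then show "proj i (smul (shift H) c x + y) = smul (shift C) c (proj i x) + proj i y"
      by (cases x rule: prod_cases4; cases y rule: prod_cases4)
        (auto simp: C_simps H_simps poly_forms_simps proj_def integral_add integral_smul sg_add V(15))
  qed
  show "graded_linear (shift H) (shift H) (- 1) hom"
  proof (rule graded_linearI[OF Hs Hs])
    fix i x assume "x \<in> homog (shift H) i"
    then show "hom i x \<in> homog (shift H) (i + - 1)"
      by (cases x rule: prod_cases4)
        (auto simp: H_simps poly_forms_simps shift_H_iff hom_def V LV(2) NV(2) hl(4) gl(4) form_eval_eq
          polys_primitive integral_mem integral_def[symmetric] poly_eval_0 coeff_monom intro!: polys_intros)
  next
    fix i x y c assume "x \<in> homog (shift H) i" "y \<in> homog (shift H) i"
    then show "hom i (smul (shift H) c x + y) = smul (shift H) c (hom i x) + hom i y"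
      by (cases x rule: prod_cases4; cases y rule: prod_cases4)
        (auto simp: H_simps poly_forms_simps hom_def LV(10) NV(10) primitive_add primitive_smul
          integral_add integral_smul poly_eq_iff coeff_monom V(8,10,15) smul_diff sg_add sg_diff)
  qed
  fix i
  show "cone_suspended_diff L N M h g (i + 1) (cone_suspended_diff L N M h g i x) = 0"
    if "x \<in> homog (shift C) i" for x
  proof (cases x rule: prod_cases3)
    case (fields l n m)
    then have lnm: "l \<in> homog L (i + 1)" "n \<in> homog N (i + 1)" "m \<in> homog M i"
      using that by (simp_all add: shift_C_iff del: shift_simps)
    note mem = d(1)[OF lnm(3)] hl(1)[OF lnm(1)] gl(1)[OF lnm(2)] Ld(1)[OF lnm(1)] Nd(1)[OF lnm(2)]
    show ?thesis
      using LD(3)[OF lnm(1)] ND(3)[OF lnm(2)] D(3)[OF lnm(3)] h_diff[OF lnm(1)] g_diff[OF lnm(2)] mem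
      by (simp add: fields cone_suspended_diff_def zero_prod_def Ld(5) Nd(5) d(2,6) hl(5) gl(5) V(3))
  qed
  show "dgla_Linf H [(i, cone_to_H M h g i x)] = cone_to_H M h g (i + 1) (cone_suspended_diff L N M h g i x)"
    if "x \<in> homog (shift C) i" for x
  proof (cases x rule: prod_cases3)
    case (fields l n m)
    then have lnm: "l \<in> homog L (i + 1)" "n \<in> homog N (i + 1)" "m \<in> homog M i"
      using that by (simp_all add: shift_C_iff del: shift_simps)
    note mem = hl(1)[OF lnm(1)] gl(1)[OF lnm(2)] Ld(1)[OF lnm(1)] Nd(1)[OF lnm(2)]
    show ?thesis
      using lnm h_diff[OF lnm(1)] g_diff[OF lnm(2)] mem
      by (simp add: fields cone_suspended_diff_def cone_to_H_eq q_single map_diff_add map_diff_diff map_diff_sg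
          polys_intros map_diff_monom d(7) hl(5) gl(5) poly_derivative_add poly_derivative_diff
          poly_derivative_monom_0 poly_derivative_monom_1 monom_sg monom_add monom_diff monom_minus sg_add sg_diff
          del: dgla_Linf.simps One_nat_def)
         (simp add: sg_def)
  qed
  fix y assume y: "y \<in> homog (shift H) i"
  obtain l n p r where y': "y = (l, n, p, r)" by (cases y rule: prod_cases4)
  then have H: "l \<in> homog L (i + 1)" "n \<in> homog N (i + 1)" "p \<in> polys M (i + 1)" "r \<in> polys M i"
    "h (i + 1) l = poly_eval M 1 p" "g (i + 1) n = poly_eval M 0 p"
    using y by (simp_all add: shift_H_iff del: shift_simps)
  have int: "integral (map_poly (diff M i) r) = diff M i (integral r)"
    and prim: "primitive (map_poly (diff M i) r) = map_poly (diff M i) (primitive r)"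
    using H(4) by (simp_all add: integral_map[OF D(2)] primitive_map[OF D(2)])
  \<comment> \<open>The derivative of \<open>p\<close> integrates to \<open>p(1) - p(0)\<close>,
    which the gluing conditions turn into \<open>h l - g n\<close>: up to sign, the mixed term of
    the cone differential.\<close>
  show "proj (i + 1) (dgla_Linf H [(i, y)]) = cone_suspended_diff L N M h g i (proj i y)"
    using H integral_mem[OF H(4)]
    by (simp add: y' q_single proj_def cone_suspended_diff_def integral_add integral_minus integral_sg integral_diff
        int integral_poly_derivative d(7) del: dgla_Linf.simps One_nat_def) (simp add: sg_def)
  \<comment> \<open>Without \<open>dt\<close>, the contributions of the differential of
    \<open>M\<close> cancel, and integrating the derivative of \<open>p\<close> leaves the linear
    interpolation of \<open>p(0) = g n\<close> and \<open>p(1) = h l\<close>, minus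
    \<open>p\<close>. With \<open>dt\<close>, differentiating the homotopy leaves the constant
    integral of \<open>r\<close>, minus \<open>r\<close>.\<close>
  show "dgla_Linf H [(i - 1, hom i y)] + hom (i + 1) (dgla_Linf H [(i, y)]) =
    cone_to_H M h g i (proj i y) - y"
    using H integral_mem[OF H(4)] polys_primitive[OF H(4)]
    by (simp add: y' hom_def proj_def q_single cone_to_H_eq Ld(4) Nd(4) map_diff_sg map_diff_diff
        polys_intros map_diff_monom int prim primitive_add primitive_minus primitive_sg primitive_diff
        integral_add integral_diff integral_minus integral_sg integral_poly_derivative primitive_poly_derivative
        poly_derivative_sg poly_derivative_diff poly_derivative_primitive poly_derivative_monom_1
        monom_sg monom_add monom_diff monom_minus sg_diff sg_add
        del: dgla_Linf.simps One_nat_def)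
      (simp add: sg_def)
qed

lemma proj_cone_to_H: "proj i (cone_to_H M h g i x) = x"
  by (cases x rule: prod_cases3) (simp add: proj_def cone_to_H_eq integral_monom_0)

end

theorem corollary6p7:
  fixes L :: "('l::ab_group_add) dgla"
    and N :: "('n::ab_group_add) dgla"
    and M :: "('m::ab_group_add) dgla"
    and h :: "int \<Rightarrow> 'l \<Rightarrow> 'm"
    and g :: "int \<Rightarrow> 'n \<Rightarrow> 'm"
  assumes "is_dgla L" and "is_dgla N" and "is_dgla M"
    and "dgla_morphism L M h" and "dgla_morphism N M g"
  shows "\<exists>q :: ('l \<times> 'n \<times> 'm) gword \<Rightarrow> 'l \<times> 'n \<times> 'm.
    Linf_algebra (mapping_cone L N M) q \<and>
    (\<forall>i. \<forall>x\<in>homog (shift (mapping_cone L N M)) i.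
       linear_part q i x = cone_suspended_diff L N M h g i x) \<and>
    Linf_algebra (H_dgla L N M h g) (dgla_Linf (H_dgla L N M h g)) \<and>
    (\<exists>\<iota> :: ('l \<times> 'n \<times> 'm) gword \<Rightarrow> 'l \<times> 'n \<times> 'm poly \<times> 'm poly.
       Linf_quasi_isomorphism (mapping_cone L N M) q
         (H_dgla L N M h g) (dgla_Linf (H_dgla L N M h g)) \<iota> \<and>
       (\<forall>i. \<forall>x\<in>homog (shift (mapping_cone L N M)) i.
          linear_part \<iota> i x = cone_to_H M h g i x))"
proof -
  interpret dgla_cospan L N M h g
    using assms by unfold_locales
  have alg: "Linf_algebra H (dgla_Linf H)"
    by (rule Linf_algebra_dgla_Linf[OF is_dgla_H])
  obtain p f where "Linf_algebra C p" "Linf_quasi_isomorphism C p H (dgla_Linf H) f"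
    "linear_part p = cone_suspended_diff L N M h g" "linear_part f = cone_to_H M h g"
    using Linf_quasi_isomorphism_transfer[OF graded_vector_space_C alg homotopy_transfer_cone proj_cone_to_H] by blast
  then show ?thesis
    using alg by (intro exI[of _ p] conjI exI[of _ f]) simp_all
qed

end
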